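(* For ${\rm APP}=\{{\rm APP}_d\}_{d\in\mathbb N}$ in the average case setting with the absolute error criterion, ${\rm APP}$ is ALG-QPT for $\Lambda^{\rm all}$ if and only if it is ALG-QPT for $\Lambda^{\rm std}$, and in this case ${\rm ALG}\text{-}t^{\rm ABS}(\Lambda^{\rm all})={\rm ALG}\text{-}t^{\rm ABS}(\Lambda^{\rm std})$.
   Context: Setting (average case approximation). For each $d\in\mathbb N$: $D_d\subset\mathbb R^d$ is a Borel set of positive Lebesgue measure, $\rho_d$ is a probability density on $D_d$, and $G_d=L_2(D_d,\rho_d(x)\,dx)$. $F_d$ is a separable Banach space of real-valued functions on $D_d$, continuously embedded in $G_d$, such that every point evaluation $f\mapsto f(x)$, $x\in D_d$, is a continuous linear functional on $F_d$; $F_d$ carries a zero-mean Gaussian measure $\mu_d$. ${\rm APP}_d:F_d\to G_d$, ${\rm APP}_d f=f$. $\Lambda^{\rm all}$ is the class of all continuous linear functionals on $F_d$, $\Lambda^{\rm std}$ the class of point evaluations. For $\Lambda\in\{\Lambda^{\rm all},\Lambda^{\rm std}\}$, an algorithm is $A_{n,d}f=\phi_{n,d}(L_1(f),\dots,L_n(f))$ with $L_i\in\Lambda$ and $\phi_{n,d}:\mathbb R^n\to G_d$ measurable; its average case error is $e^{\rm avg}(A_{n,d})=\big(\int_{F_d}\|f-A_{n,d}f\|_{G_d}^2\,\mu_d(df)\big)^{1/2}$, and $e^{\rm avg}(n,d;\Lambda)$ is the infimum of $e^{\rm avg}(A_{n,d})$ over all such algorithms using $n$ functionals from $\Lambda$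 (for $n=0$, $A_{0,d}=0$). Absolute-error information complexity: $n^{\rm ABS}(\varepsilon,d;\Lambda)=\min\{n\ge0:\ e^{\rm avg}(n,d;\Lambda)\le\varepsilon\}$. ALG-QPT for $\Lambda$: there exist $C>0$, $t\ge0$ with $n^{\rm ABS}(\varepsilon,d;\Lambda)\le C\exp\big(t(1+\ln d)(1+\ln\varepsilon^{-1})\big)$ for all $d\in\mathbb N$, $\varepsilon\in(0,1)$; the exponent ${\rm ALG}\text{-}t^{\rm ABS}(\Lambda)$ is the infimum of all such $t$. *)

theory Defs
  imports "HOL-Probability.Probability"
begin

type_synonym pt = "nat \<Rightarrow> real"
type_synonym fn = "pt \<Rightarrow> real"

definition lborel_d :: "nat \<Rightarrow> pt measure" where
  "lborel_d d = PiM {..<d} (\<lambda>_. lborel)"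

definition Gmeas :: "(nat \<Rightarrow> pt set) \<Rightarrow> (nat \<Rightarrow> pt \<Rightarrow> real) \<Rightarrow> nat \<Rightarrow> pt measure" where
  "Gmeas D \<rho> d = density (lborel_d d) (\<lambda>x. ennreal (indicator (D d) x * \<rho> d x))"

definition Gnorm2 :: "(nat \<Rightarrow> pt set) \<Rightarrow> (nat \<Rightarrow> pt \<Rightarrow> real) \<Rightarrow> nat \<Rightarrow> fn \<Rightarrow> ennreal" where
  "Gnorm2 D \<rho> d g = (\<integral>\<^sup>+ x. ennreal ((g x)\<^sup>2) \<partial>Gmeas D \<rho> d)"

definition Gnorm :: "(nat \<Rightarrow> pt set) \<Rightarrow> (nat \<Rightarrow> pt \<Rightarrow> real) \<Rightarrow> nat \<Rightarrow> fn \<Rightarrow> real" where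
  "Gnorm D \<rho> d g = sqrt (enn2real (Gnorm2 D \<rho> d g))"

text \<open>Representatives of elements of G_d.\<close>
definition G_set :: "(nat \<Rightarrow> pt set) \<Rightarrow> (nat \<Rightarrow> pt \<Rightarrow> real) \<Rightarrow> nat \<Rightarrow> fn set" where
  "G_set D \<rho> d = {g. g \<in> borel_measurable (lborel_d d) \<and> Gnorm2 D \<rho> d g < \<infinity>}"

definition nopen :: "fn set \<Rightarrow> (fn \<Rightarrow> real) \<Rightarrow> fn set \<Rightarrow> bool" where
  "nopen S N U \<longleftrightarrow> U \<subseteq> S \<and> (\<forall>f\<in>U. \<exists>r>0. \<forall>g\<in>S. N (\<lambda>x. g x - f x) < r \<longrightarrow> g \<in> U)"

definition borel_of :: "fn set \<Rightarrow> (fn \<Rightarrow> real) \<Rightarrow> fn measure" where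
  "borel_of S N = sigma S {U. nopen S N U}"

definition sep_banach_fun_space :: "fn set \<Rightarrow> (fn \<Rightarrow> real) \<Rightarrow> bool" where
  "sep_banach_fun_space F N \<longleftrightarrow>
     (\<lambda>x. 0) \<in> F \<and>
     (\<forall>f\<in>F. \<forall>g\<in>F. (\<lambda>x. f x + g x) \<in> F) \<and>
     (\<forall>f\<in>F. \<forall>c. (\<lambda>x. c * f x) \<in> F) \<and>
     (\<forall>f\<in>F. N f \<ge> 0 \<and> (N f = 0 \<longrightarrow> f = (\<lambda>x. 0))) \<and>
     (\<forall>f\<in>F. \<forall>c. N (\<lambda>x. c * f x) = \<bar>c\<bar> * N f) \<and>
     (\<forall>f\<in>F. \<forall>g\<in>F. N (\<lambda>x. f x + g x) \<le> N f + N g) \<and>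
     (\<forall>s. (\<forall>n. s n \<in> F) \<longrightarrow> (\<forall>e>0. \<exists>M. \<forall>m\<ge>M. \<forall>n\<ge>M. N (\<lambda>x. s m x - s n x) < e) \<longrightarrow>
          (\<exists>g\<in>F. (\<lambda>n. N (\<lambda>x. s n x - g x)) \<longlonglongrightarrow> 0)) \<and>
     (\<exists>S\<subseteq>F. countable S \<and> (\<forall>f\<in>F. \<forall>e>0. \<exists>s\<in>S. N (\<lambda>x. f x - s x) < e))"

definition cont_lin_fun :: "fn set \<Rightarrow> (fn \<Rightarrow> real) \<Rightarrow> (fn \<Rightarrow> real) \<Rightarrow> bool" where
  "cont_lin_fun F N L \<longleftrightarrow>
     (\<forall>f\<in>F. \<forall>g\<in>F. \<forall>a b. L (\<lambda>x. a * f x + b * g x) = a * L f + b * L g) \<and>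
     (\<exists>c. \<forall>f\<in>F. \<bar>L f\<bar> \<le> c * N f)"

definition centered_gaussian :: "fn set \<Rightarrow> (fn \<Rightarrow> real) \<Rightarrow> fn measure \<Rightarrow> bool" where
  "centered_gaussian F N \<mu> \<longleftrightarrow>
     (\<forall>L. cont_lin_fun F N L \<longrightarrow>
        (\<exists>\<sigma>\<ge>0. distr \<mu> borel L =
            (if \<sigma> = 0 then return borel 0 else density lborel (normal_density 0 \<sigma>))))"

definition avg_app_setting ::
  "(nat \<Rightarrow> pt set) \<Rightarrow> (nat \<Rightarrow> pt \<Rightarrow> real) \<Rightarrow> (nat \<Rightarrow> fn set) \<Rightarrow> (nat \<Rightarrow> fn \<Rightarrow> real)
     \<Rightarrow> (nat \<Rightarrow> fn measure) \<Rightarrow> bool" where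
  "avg_app_setting D \<rho> F N \<mu> \<longleftrightarrow> (\<forall>d\<ge>1.
     D d \<in> sets (lborel_d d) \<and> emeasure (lborel_d d) (D d) > 0 \<and>
     \<rho> d \<in> borel_measurable (lborel_d d) \<and> (\<forall>x\<in>D d. \<rho> d x \<ge> 0) \<and>
     (\<integral>\<^sup>+ x. ennreal (indicator (D d) x * \<rho> d x) \<partial>lborel_d d) = 1 \<and>
     sep_banach_fun_space (F d) (N d) \<and>
     (\<forall>f\<in>F d. \<forall>x. x \<notin> D d \<longrightarrow> f x = 0) \<and>
     F d \<subseteq> G_set D \<rho> d \<and>
     (\<exists>c. \<forall>f\<in>F d. Gnorm D \<rho> d f \<le> c * N d f) \<and>
     (\<forall>f\<in>F d. Gnorm2 D \<rho> d f = 0 \<longrightarrow> f = (\<lambda>x. 0)) \<and>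
     (\<forall>x\<in>D d. \<exists>c. \<forall>f\<in>F d. \<bar>f x\<bar> \<le> c * N d f) \<and>
     prob_space (\<mu> d) \<and> space (\<mu> d) = F d \<and> sets (\<mu> d) = sets (borel_of (F d) (N d)) \<and>
     centered_gaussian (F d) (N d) (\<mu> d))"

definition Lall :: "(nat \<Rightarrow> fn set) \<Rightarrow> (nat \<Rightarrow> fn \<Rightarrow> real) \<Rightarrow> nat \<Rightarrow> (fn \<Rightarrow> real) set" where
  "Lall F N d = {L. cont_lin_fun (F d) (N d) L}"

definition Lstd :: "(nat \<Rightarrow> pt set) \<Rightarrow> nat \<Rightarrow> (fn \<Rightarrow> real) set" where
  "Lstd D d = (\<lambda>x f. f x) ` D d"

definition alg_err2 ::
  "(nat \<Rightarrow> pt set) \<Rightarrow> (nat \<Rightarrow> pt \<Rightarrow> real) \<Rightarrow> (nat \<Rightarrow> fn measure) \<Rightarrow> nat \<Rightarrow> nat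
     \<Rightarrow> (nat \<Rightarrow> fn \<Rightarrow> real) \<Rightarrow> ((nat \<Rightarrow> real) \<Rightarrow> fn) \<Rightarrow> ennreal" where
  "alg_err2 D \<rho> \<mu> d n L \<phi> =
     (\<integral>\<^sup>+ f. Gnorm2 D \<rho> d (\<lambda>x. f x - \<phi> (\<lambda>i\<in>{..<n}. L i f) x) \<partial>\<mu> d)"

definition avg_err2 ::
  "(nat \<Rightarrow> pt set) \<Rightarrow> (nat \<Rightarrow> pt \<Rightarrow> real) \<Rightarrow> (nat \<Rightarrow> fn measure) \<Rightarrow> (nat \<Rightarrow> (fn \<Rightarrow> real) set)
     \<Rightarrow> nat \<Rightarrow> nat \<Rightarrow> ennreal" where
  "avg_err2 D \<rho> \<mu> \<Lambda> n d =
     (if n = 0 then (\<integral>\<^sup>+ f. Gnorm2 D \<rho> d f \<partial>\<mu> d)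
      else (INF p \<in> {(L, \<phi>). (\<forall>i<n. L i \<in> \<Lambda> d) \<and>
                 \<phi> \<in> measurable (PiM {..<n} (\<lambda>_. borel)) (borel_of (G_set D \<rho> d) (Gnorm D \<rho> d))}.
              alg_err2 D \<rho> \<mu> d n (fst p) (snd p)))"

definition nABS ::
  "(nat \<Rightarrow> pt set) \<Rightarrow> (nat \<Rightarrow> pt \<Rightarrow> real) \<Rightarrow> (nat \<Rightarrow> fn measure) \<Rightarrow> (nat \<Rightarrow> (fn \<Rightarrow> real) set)
     \<Rightarrow> real \<Rightarrow> nat \<Rightarrow> enat" where
  "nABS D \<rho> \<mu> \<Lambda> \<epsilon> d =
     (if \<exists>n. avg_err2 D \<rho> \<mu> \<Lambda> n d \<le> ennreal (\<epsilon>\<^sup>2)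
      then enat (LEAST n. avg_err2 D \<rho> \<mu> \<Lambda> n d \<le> ennreal (\<epsilon>\<^sup>2)) else \<infinity>)"

definition qpt_bound ::
  "(nat \<Rightarrow> pt set) \<Rightarrow> (nat \<Rightarrow> pt \<Rightarrow> real) \<Rightarrow> (nat \<Rightarrow> fn measure) \<Rightarrow> (nat \<Rightarrow> (fn \<Rightarrow> real) set)
     \<Rightarrow> real \<Rightarrow> real \<Rightarrow> bool" where
  "qpt_bound D \<rho> \<mu> \<Lambda> C t \<longleftrightarrow>
     (\<forall>d\<ge>1. \<forall>\<epsilon>. 0 < \<epsilon> \<and> \<epsilon> < 1 \<longrightarrow>
        (\<exists>m. nABS D \<rho> \<mu> \<Lambda> \<epsilon> d = enat m \<and>
             real m \<le> C * exp (t * (1 + ln (real d)) * (1 + ln (1 / \<epsilon>)))))"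

definition alg_qpt ::
  "(nat \<Rightarrow> pt set) \<Rightarrow> (nat \<Rightarrow> pt \<Rightarrow> real) \<Rightarrow> (nat \<Rightarrow> fn measure) \<Rightarrow> (nat \<Rightarrow> (fn \<Rightarrow> real) set) \<Rightarrow> bool" where
  "alg_qpt D \<rho> \<mu> \<Lambda> \<longleftrightarrow> (\<exists>C>0. \<exists>t\<ge>0. qpt_bound D \<rho> \<mu> \<Lambda> C t)"

definition alg_t_abs ::
  "(nat \<Rightarrow> pt set) \<Rightarrow> (nat \<Rightarrow> pt \<Rightarrow> real) \<Rightarrow> (nat \<Rightarrow> fn measure) \<Rightarrow> (nat \<Rightarrow> (fn \<Rightarrow> real) set) \<Rightarrow> real" where
  "alg_t_abs D \<rho> \<mu> \<Lambda> = Inf {t. t \<ge> 0 \<and> (\<exists>C>0. qpt_bound D \<rho> \<mu> \<Lambda> C t)}"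

end

theory Submission
  imports Defs
begin

text \<open>Point evaluations are continuous functionals, so only the passage from \<open>\<Lambda>\<^sup>a\<^sup>l\<^sup>l\<close> to \<open>\<Lambda>\<^sup>s\<^sup>t\<^sup>d\<close>
  matters, and it suffices to turn an algorithm with \<open>n\<close> functionals and squared error \<open>e\<^sup>2\<close> into one with
  \<open>O(n\<^sup>1\<^sup>+\<^sup>\<kappa>)\<close> function values and squared error \<open>(1 + O(\<kappa>)) e\<^sup>2\<close>, for every \<open>\<kappa> > 0\<close>.

  Since a Gaussian variable uncorrelated with the information is orthogonal to every function of it,
  the algorithm yields a subspace \<open>V\<close> of dimension at most \<open>n\<close> with \<open>E dist(f, V)\<^sup>2\<close> at most slightly larger
  than \<open>e\<^sup>2\<close>. Points are then chosen one at a time, each because some average over the density \<open>k(x,x) / dim V\<close>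
  is small, \<open>k\<close> being the reproducing kernel of the projection onto \<open>V\<close>. Interpolation at \<open>dim V\<close> points,
  shrinking \<open>V\<close> to the elements vanishing at the chosen point, loses a factor \<open>dim V + 1\<close>. Relaxed randomized
  Kaczmarz steps then contract the component of the residual in \<open>V\<close> by \<open>1 - \<kappa> / dim V\<close> each, without changing
  the orthogonal one, so that \<open>O(n ln n)\<close> further points remove this factor.\<close>

section \<open>Square integrable functions\<close>

text \<open>Kaczmarz steps alone do not suffice: the component of f in V has no bound in terms of e,
  so the number of steps would depend on the problem. Interpolation bounds the starting ratio by dim
  V + 1, after which the count depends on n and \<kappa> only; logarithms are absorbed by
  \<open>n powr \<kappa>\<close>. Both this power and a dilation of \<epsilon> by a constant
  multiply the exponent t by a factor close to 1. So every exponent for arbitrary functionals,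
  enlarged by any \<delta> > 0, is one for function values, and the infima agree even when they are
  not attained.

  The setting provides only the laws of single functionals. Integrability of the squared norm, joint
  measurability of the value f x in f and x, and orthogonality of a functional to all functions of
  uncorrelated data are derived from it, the last one by trigonometric transforms instead of joint
  densities. Functions are not identified modulo null sets, because algorithms evaluate them at
  points.\<close>

definition sqint :: "'a measure \<Rightarrow> ('a \<Rightarrow> real) \<Rightarrow> bool" where
  "sqint M f \<longleftrightarrow> f \<in> borel_measurable M \<and> integrable M (\<lambda>x. (f x)\<^sup>2)"

definition ip :: "'a measure \<Rightarrow> ('a \<Rightarrow> real) \<Rightarrow> ('a \<Rightarrow> real) \<Rightarrow> real" where
  "ip M f g = (\<integral>x. f x * g x \<partial>M)"

lemma sqint_iff_nn_integral:
  "sqint M f \<longleftrightarrow> f \<in> borel_measurable M \<and> (\<integral>\<^sup>+x. ennreal ((f x)\<^sup>2) \<partial>M) < \<infinity>"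
  unfolding sqint_def by (auto simp: integrable_iff_bounded)

lemma sqint_mult_integrable:
  assumes "sqint M f" "sqint M g" shows "integrable M (\<lambda>x. f x * g x)"
proof (rule Bochner_Integration.integrable_bound[where f = "\<lambda>x. (f x)\<^sup>2 + (g x)\<^sup>2"])
  show "integrable M (\<lambda>x. (f x)\<^sup>2 + (g x)\<^sup>2)"
    using assms by (auto simp: sqint_def)
  show "(\<lambda>x. f x * g x) \<in> borel_measurable M"
    using assms by (auto simp: sqint_def)
  have "\<bar>a * b\<bar> \<le> a\<^sup>2 + b\<^sup>2" for a b :: real
  proof -
    have "0 \<le> (\<bar>a\<bar> - \<bar>b\<bar>)\<^sup>2" by simp
    then have "2 * \<bar>a * b\<bar> \<le> a\<^sup>2 + b\<^sup>2" by (simp add: power2_diff abs_mult)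
    then show ?thesis by (smt (verit) abs_ge_zero)
  qed
  then show "AE x in M. norm (f x * g x) \<le> norm ((f x)\<^sup>2 + (g x)\<^sup>2)"
    by (intro AE_I2) (simp add: order_trans[OF _ abs_ge_self])
qed

lemma sqint_cmult [intro, simp]: "sqint M f \<Longrightarrow> sqint M (\<lambda>x. c * f x)"
  by (auto simp: sqint_def power_mult_distrib)

lemma sqint_cdivide [intro, simp]: "sqint M f \<Longrightarrow> sqint M (\<lambda>x. f x / c)"
  using sqint_cmult[of M f "1 / c"] by simp

lemma sqint_zero [intro, simp]: "sqint M (\<lambda>x. 0)"
  by (auto simp: sqint_def)

lemma sqint_add [intro]:
  assumes "sqint M f" "sqint M g" shows "sqint M (\<lambda>x. f x + g x)"
proof -
  have "integrable M (\<lambda>x. (f x)\<^sup>2 + (g x)\<^sup>2 + 2 * (f x * g x))"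
    using assms sqint_mult_integrable[OF assms]
    by (intro Bochner_Integration.integrable_add integrable_mult_right) (auto simp: sqint_def)
  then show ?thesis
    using assms by (auto simp: sqint_def power2_sum mult.assoc)
qed

lemma sqint_diff [intro]:
  assumes "sqint M f" "sqint M g" shows "sqint M (\<lambda>x. f x - g x)"
  using sqint_add[OF assms(1) sqint_cmult[OF assms(2), of "-1"]] by simp

lemma sqint_sum [intro]:
  "(\<And>i. i \<in> I \<Longrightarrow> sqint M (f i)) \<Longrightarrow> sqint M (\<lambda>x. \<Sum>i\<in>I. f i x)"
  by (induction I rule: infinite_finite_induct) auto

lemma ip_commute: "ip M f g = ip M g f"
  by (simp add: ip_def mult.commute)

lemma ip_add_left: "sqint M f \<Longrightarrow> sqint M g \<Longrightarrow> sqint M h \<Longrightarrow>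
    ip M (\<lambda>x. f x + g x) h = ip M f h + ip M g h"
  by (simp add: ip_def distrib_right sqint_mult_integrable)

lemma ip_diff_left: "sqint M f \<Longrightarrow> sqint M g \<Longrightarrow> sqint M h \<Longrightarrow>
    ip M (\<lambda>x. f x - g x) h = ip M f h - ip M g h"
  by (simp add: ip_def left_diff_distrib sqint_mult_integrable)

lemma ip_cmult_left [simp]: "ip M (\<lambda>x. c * f x) g = c * ip M f g"
  by (simp add: ip_def mult.assoc)

lemma ip_cmult_right [simp]: "ip M f (\<lambda>x. c * g x) = c * ip M f g"
  by (simp add: ip_commute[of M f])

lemma ip_cdivide_left [simp]: "ip M (\<lambda>x. f x / c) g = ip M f g / c"
  using ip_cmult_left[of M "1 / c" f g] by simp

lemma ip_cdivide_right [simp]: "ip M f (\<lambda>x. g x / c) = ip M f g / c"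
  using ip_cmult_right[of M f "1 / c" g] by simp

lemma ip_add_right: "sqint M f \<Longrightarrow> sqint M g \<Longrightarrow> sqint M h \<Longrightarrow>
    ip M h (\<lambda>x. f x + g x) = ip M h f + ip M h g"
  by (simp add: ip_commute[of M h] ip_add_left)

lemma ip_diff_right: "sqint M f \<Longrightarrow> sqint M g \<Longrightarrow> sqint M h \<Longrightarrow>
    ip M h (\<lambda>x. f x - g x) = ip M h f - ip M h g"
  by (simp add: ip_commute[of M h] ip_diff_left)

lemma ip_sum_left: "(\<And>i. i \<in> I \<Longrightarrow> sqint M (f i)) \<Longrightarrow> sqint M h \<Longrightarrow>
    ip M (\<lambda>x. \<Sum>i\<in>I. f i x) h = (\<Sum>i\<in>I. ip M (f i) h)"
  unfolding ip_def sum_distrib_right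
  by (rule Bochner_Integration.integral_sum) (auto intro: sqint_mult_integrable)

lemma ip_sum_right: "(\<And>i. i \<in> I \<Longrightarrow> sqint M (f i)) \<Longrightarrow> sqint M h \<Longrightarrow>
    ip M h (\<lambda>x. \<Sum>i\<in>I. f i x) = (\<Sum>i\<in>I. ip M h (f i))"
  using ip_sum_left[of I M f h] by (simp add: ip_commute[of M h])

lemma ip_self: "ip M f f = (\<integral>x. (f x)\<^sup>2 \<partial>M)"
  by (simp add: ip_def power2_eq_square)

lemma ip_self_nonneg [simp]: "0 \<le> ip M f f"
  by (simp add: ip_self)

lemma nn_integral_ip: "sqint M f \<Longrightarrow> (\<integral>\<^sup>+x. ennreal ((f x)\<^sup>2) \<partial>M) = ennreal (ip M f f)"
  by (simp add: ip_self sqint_def nn_integral_eq_integral)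

lemma ip_self_eq_0: "sqint M f \<Longrightarrow> ip M f f = 0 \<Longrightarrow> AE x in M. f x = 0"
  unfolding ip_self sqint_def
  by (subst (asm) integral_nonneg_eq_0_iff_AE) auto

lemma ip_cong_AE: "f \<in> borel_measurable M \<Longrightarrow> f' \<in> borel_measurable M \<Longrightarrow> g \<in> borel_measurable M \<Longrightarrow>
    AE x in M. f x = f' x \<Longrightarrow> ip M f g = ip M f' g"
  unfolding ip_def by (rule integral_cong_AE) auto

lemma ip_add_self: "sqint M f \<Longrightarrow> sqint M g \<Longrightarrow>
    ip M (\<lambda>x. f x + g x) (\<lambda>x. f x + g x) = ip M f f + 2 * ip M f g + ip M g g"
  by (simp add: ip_add_left ip_add_right sqint_add ip_commute[of M g f])

lemma ip_diff_self: "sqint M f \<Longrightarrow> sqint M g \<Longrightarrow>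
    ip M (\<lambda>x. f x - g x) (\<lambda>x. f x - g x) = ip M f f - 2 * ip M f g + ip M g g"
  by (simp add: ip_diff_left ip_diff_right sqint_diff ip_commute[of M g f])

lemma ip_Cauchy_Schwarz:
  assumes f: "sqint M f" and g: "sqint M g"
  shows "(ip M f g)\<^sup>2 \<le> ip M f f * ip M g g"
proof -
  have *: "0 \<le> a\<^sup>2 * ip M f f - 2 * (a * b) * ip M f g + b\<^sup>2 * ip M g g" for a b
  proof -
    have "ip M (\<lambda>x. a * f x - b * g x) (\<lambda>x. a * f x - b * g x)
        = a\<^sup>2 * ip M f f - 2 * (a * b) * ip M f g + b\<^sup>2 * ip M g g"
      using ip_diff_self[of M "\<lambda>x. a * f x" "\<lambda>x. b * g x"] f g
      by (simp add: power2_eq_square)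
    then show ?thesis by (metis ip_self_nonneg)
  qed
  consider "ip M g g > 0" | "ip M g g = 0"
    using ip_self_nonneg[of M g] by linarith
  then show ?thesis
  proof cases
    case 1
    have "0 \<le> ip M g g * (ip M f f * ip M g g - (ip M f g)\<^sup>2)"
      using *[of "ip M g g" "ip M f g"] by (simp add: power2_eq_square algebra_simps)
    then show ?thesis using 1 by (simp add: zero_le_mult_iff)
  next
    case 2
    have "0 \<le> ip M f f - 2 * b * ip M f g" for b using *[of 1 b] 2 by simp
    \<comment> \<open>If \<open>ip M f g\<close> were nonzero, this \<open>b\<close> would make the
      right side equal to \<open>- ip M f f - 2\<close>, which is negative.\<close>
    from this[of "(ip M f f + 1) / ip M f g"] have "ip M f g = 0"
      using ip_self_nonneg[of M f] by (cases "ip M f g = 0") auto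
    then show ?thesis using 2 by simp
  qed
qed

section \<open>Orthonormal systems and orthogonal projections\<close>

definition onsys :: "'a measure \<Rightarrow> 'i set \<Rightarrow> ('i \<Rightarrow> 'a \<Rightarrow> real) \<Rightarrow> bool" where
  "onsys M J e \<longleftrightarrow> finite J \<and> (\<forall>j\<in>J. sqint M (e j)) \<and>
     (\<forall>i\<in>J. \<forall>j\<in>J. ip M (e i) (e j) = (if i = j then 1 else 0))"

definition proj :: "'a measure \<Rightarrow> 'i set \<Rightarrow> ('i \<Rightarrow> 'a \<Rightarrow> real) \<Rightarrow> ('a \<Rightarrow> real) \<Rightarrow> 'a \<Rightarrow> real" where
  "proj M J e f = (\<lambda>x. \<Sum>j\<in>J. ip M f (e j) * e j x)"

lemma onsys_sqint: "onsys M J e \<Longrightarrow> j \<in> J \<Longrightarrow> sqint M (e j)"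
  by (simp add: onsys_def)

lemma sqint_proj [intro]: "onsys M J e \<Longrightarrow> sqint M (proj M J e f)"
  unfolding proj_def by (intro sqint_sum sqint_cmult) (auto simp: onsys_def)

lemma ip_onsys_comb:
  assumes "onsys M J e" "j \<in> J"
  shows "ip M (\<lambda>x. \<Sum>i\<in>J. c i * e i x) (e j) = c j"
proof -
  have "ip M (\<lambda>x. \<Sum>i\<in>J. c i * e i x) (e j) = (\<Sum>i\<in>J. c i * ip M (e i) (e j))"
    using assms by (subst ip_sum_left) (auto simp: onsys_def)
  also have "\<dots> = (\<Sum>i\<in>J. if i = j then c i else 0)"
    using assms by (intro sum.cong) (auto simp: onsys_def)
  also have "\<dots> = c j" using assms by (simp add: onsys_def)
  finally show ?thesis .
qed

lemma ip_onsys_comb_comb: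
  assumes "onsys M J e"
  shows "ip M (\<lambda>x. \<Sum>i\<in>J. c i * e i x) (\<lambda>x. \<Sum>i\<in>J. d i * e i x) = (\<Sum>i\<in>J. c i * d i)"
proof -
  have "ip M (\<lambda>x. \<Sum>i\<in>J. c i * e i x) (\<lambda>x. \<Sum>i\<in>J. d i * e i x)
      = (\<Sum>j\<in>J. d j * ip M (\<lambda>x. \<Sum>i\<in>J. c i * e i x) (e j))"
    using assms by (subst ip_sum_right) (auto intro!: sqint_sum simp: onsys_def)
  also have "\<dots> = (\<Sum>j\<in>J. c j * d j)"
    using ip_onsys_comb[OF assms] by (intro sum.cong) auto
  finally show ?thesis .
qed

lemma ip_minus_proj_onsys:
  assumes "onsys M J e" "sqint M f" "j \<in> J"
  shows "ip M (\<lambda>x. f x - proj M J e f x) (e j) = 0"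
  using assms ip_onsys_comb[OF assms(1,3), of "\<lambda>i. ip M f (e i)"] sqint_proj[OF assms(1), of f]
  by (simp add: ip_diff_left onsys_sqint) (simp add: proj_def)

lemma ip_minus_proj_comb:
  assumes "onsys M J e" "sqint M f"
  shows "ip M (\<lambda>x. f x - proj M J e f x) (\<lambda>x. \<Sum>i\<in>J. c i * e i x) = 0"
  using assms ip_minus_proj_onsys[OF assms] sqint_proj[OF assms(1), of f]
  by (subst ip_sum_right) (auto simp: onsys_def)

text \<open>The error is the sum of \<open>f - proj\<close> and a combination of the
  \<open>e i\<close>, and these are orthogonal. General \<open>c\<close> gives best approximation,
  \<open>c = 0\<close> gives Bessel's identity.\<close>

lemma proj_pythagoras:
  assumes "onsys M J e" "sqint M f"
  shows "ip M (\<lambda>x. f x - (\<Sum>i\<in>J. c i * e i x)) (\<lambda>x. f x - (\<Sum>i\<in>J. c i * e i x))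
    = ip M (\<lambda>x. f x - proj M J e f x) (\<lambda>x. f x - proj M J e f x) + (\<Sum>i\<in>J. (ip M f (e i) - c i)\<^sup>2)"
proof -
  let ?g = "\<lambda>x. f x - proj M J e f x"
  let ?h = "\<lambda>x. \<Sum>i\<in>J. (ip M f (e i) - c i) * e i x"
  have g: "sqint M ?g" using assms by blast
  have h: "sqint M ?h" using assms(1) by (auto simp: onsys_def)
  have "f x - (\<Sum>i\<in>J. c i * e i x) = ?g x + ?h x" for x
    by (simp add: proj_def left_diff_distrib sum_subtractf)
  then have "ip M (\<lambda>x. f x - (\<Sum>i\<in>J. c i * e i x)) (\<lambda>x. f x - (\<Sum>i\<in>J. c i * e i x))
      = ip M (\<lambda>x. ?g x + ?h x) (\<lambda>x. ?g x + ?h x)"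
    by presburger
  also have "\<dots> = ip M ?g ?g + 2 * ip M ?g ?h + ip M ?h ?h"
    by (rule ip_add_self[OF g h])
  also have "\<dots> = ip M ?g ?g + (\<Sum>i\<in>J. (ip M f (e i) - c i)\<^sup>2)"
    unfolding ip_minus_proj_comb[OF assms] ip_onsys_comb_comb[OF assms(1)]
    by (simp add: power2_eq_square)
  finally show ?thesis .
qed

lemma Bessel:
  assumes "onsys M J e" "sqint M f"
  shows "ip M f f = ip M (\<lambda>x. f x - proj M J e f x) (\<lambda>x. f x - proj M J e f x) + (\<Sum>i\<in>J. (ip M f (e i))\<^sup>2)"
  using proj_pythagoras[OF assms, of "\<lambda>_. 0"] by simp

lemma Bessel_ineq:
  assumes "onsys M J e" "sqint M f"
  shows "(\<Sum>i\<in>J. (ip M f (e i))\<^sup>2) \<le> ip M f f"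
  using Bessel[OF assms] ip_self_nonneg[of M "\<lambda>x. f x - proj M J e f x"] by linarith

text \<open>Induction on \<open>m\<close>: the residual of the new function is normalised, and an
  index whose residual is null is dropped, so \<open>J\<close> has at most \<open>m\<close>
  elements. The coefficients \<open>A\<close> are explicit because the new system has to stay in the
  class of the \<open>X i\<close>: for functionals over the Gaussian measure it must again consist
  of continuous linear functionals. The \<open>X i\<close> are recovered only almost everywhere,
  since null residuals are discarded.\<close>

lemma Gram_Schmidt:
  fixes X :: "nat \<Rightarrow> 'a \<Rightarrow> real"
  assumes "\<And>i. i < m \<Longrightarrow> sqint M (X i)"
  shows "\<exists>A J. J \<subseteq> {..<m} \<and> onsys M J (\<lambda>j x. \<Sum>i<m. A j i * X i x) \<and>
    (\<forall>i<m. AE x in M. X i x = proj M J (\<lambda>j x. \<Sum>i<m. A j i * X i x) (X i) x)"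
  using assms
proof (induction m)
  case 0
  show ?case by (rule exI, rule exI[of _ "{}"]) (auto simp: onsys_def)
next
  case (Suc m)
  then obtain A J where J: "J \<subseteq> {..<m}" and on0: "onsys M J (\<lambda>j x. \<Sum>i<m. A j i * X i x)"
    and rep: "\<And>i. i < m \<Longrightarrow> AE x in M. X i x = proj M J (\<lambda>j x. \<Sum>i<m. A j i * X i x) (X i) x"
    by auto
  define e where "e = (\<lambda>j x. \<Sum>i<m. A j i * X i x)"
  have on: "onsys M J e" using on0 by (simp add: e_def)
  have fin: "finite J" using on by (simp add: onsys_def)
  define r where "r = (\<lambda>x. X m x - proj M J e (X m) x)"
  define c where "c = ip M r r"
  have Xm: "sqint M (X m)" using Suc.prems by simp
  have r: "sqint M r" unfolding r_def using on Xm by blast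
  show ?case
  proof (cases "c = 0")
    case True
    define A' where "A' = (\<lambda>j i. if i < m then A j i else 0)"
    have e': "(\<lambda>j x. \<Sum>i<Suc m. A' j i * X i x) = e"
      by (simp add: A'_def e_def)
    have "AE x in M. X m x = proj M J e (X m) x"
      using ip_self_eq_0[OF r] True by (simp add: c_def r_def)
    then have "\<forall>i<Suc m. AE x in M. X i x = proj M J e (X i) x"
      using rep by (auto simp: less_Suc_eq e_def)
    then show ?thesis using J on e' by (intro exI[of _ A'] exI[of _ J]) auto
  next
    case False
    then have c: "c > 0" using ip_self_nonneg[of M r] by (simp add: c_def less_le)
    \<comment> \<open>Coefficients of the residual \<open>r\<close> in terms of
      \<open>X 0, ..., X m\<close>.\<close>
    define B where "B = (\<lambda>i. (if i = m then 1 else 0) - (\<Sum>j\<in>J. ip M (X m) (e j) * (if i < m then A j i else 0)))"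
    define A' where "A' = (\<lambda>j i. if j = m then B i / sqrt c else if i < m then A j i else 0)"
    define e' where "e' = (\<lambda>j x. \<Sum>i<Suc m. A' j i * X i x)"
    have e'1: "e' j = e j" if "j \<in> J" for j
      using that J by (auto simp: e'_def e_def A'_def)
    have rB: "(\<Sum>i<Suc m. B i * X i x) = r x" for x
    proof -
      have "(\<Sum>i<Suc m. B i * X i x) = X m x - (\<Sum>i<m. (\<Sum>j\<in>J. ip M (X m) (e j) * A j i) * X i x)"
        by (simp add: B_def sum_negf)
      also have "(\<Sum>i<m. (\<Sum>j\<in>J. ip M (X m) (e j) * A j i) * X i x)
          = (\<Sum>j\<in>J. ip M (X m) (e j) * (\<Sum>i<m. A j i * X i x))"
        by (simp add: sum_distrib_right sum_distrib_left mult.assoc) (rule sum.swap)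
      finally show ?thesis by (simp add: r_def proj_def e_def)
    qed
    have e'2: "e' m = (\<lambda>x. (1 / sqrt c) * r x)"
    proof
      fix x
      show "e' m x = (1 / sqrt c) * r x"
        unfolding rB[symmetric] e'_def A'_def sum_distrib_left by (simp add: ac_simps)
    qed
    have mJ: "m \<notin> J" using J by auto
    have orth: "ip M r (e j) = 0" if "j \<in> J" for j
      unfolding r_def by (rule ip_minus_proj_onsys[OF on Xm that])
    have "ip M (e' m) (e' m) = 1"
      unfolding e'2 ip_cmult_left ip_cmult_right c_def[symmetric] using c by simp
    moreover have "sqint M (e' m)" unfolding e'2 using r by (rule sqint_cmult)
    moreover have "ip M (e' m) (e j) = 0" "ip M (e j) (e' m) = 0" if "j \<in> J" for j
      unfolding e'2 ip_cmult_left ip_cmult_right ip_commute[of M "e j" r] orth[OF that] by simp_all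
    ultimately have on': "onsys M (insert m J) e'"
      using on fin mJ e'1 by (auto simp: onsys_def)
    have e'3: "ip M f (e' m) * e' m x = ip M f r / c * r x" for f x
      unfolding e'2 ip_cmult_right using c by (simp add: field_simps)
    have Xrep: "AE x in M. X i x = proj M (insert m J) e' (X i) x" if "i < Suc m" for i
    proof (cases "i = m")
      case True
      have "ip M (X m) r = c"
      proof -
        have "ip M (X m) r = ip M r r + ip M (proj M J e (X m)) r"
          using ip_add_left[OF r sqint_proj[OF on, of "X m"] r] by (simp add: r_def)
        also have "ip M (proj M J e (X m)) r = 0"
          using ip_minus_proj_comb[OF on Xm, of "\<lambda>j. ip M (X m) (e j)"]
          by (subst ip_commute) (simp add: r_def proj_def)
        finally show ?thesis by (simp add: c_def)
      qed
      then have "proj M (insert m J) e' (X m) x = X m x" for x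
        using c fin mJ e'1 by (simp add: proj_def e'3) (simp add: r_def proj_def)
      then show ?thesis using True by simp
    next
      case False
      then have im: "i < m" using that by simp
      have Xi: "sqint M (X i)" using Suc.prems im by simp
      have AE: "AE x in M. X i x = proj M J e (X i) x" using rep[OF im] by (simp add: e_def)
      \<comment> \<open>\<open>X i\<close> agrees almost everywhere with an element of the old span,
        so it has no component along the new direction \<open>r\<close>.\<close>
      have "ip M (X i) r = ip M (proj M J e (X i)) r"
        using AE Xi r sqint_proj[OF on, of "X i"] by (intro ip_cong_AE) (auto simp: sqint_def)
      also have "\<dots> = 0"
        using ip_minus_proj_comb[OF on Xm, of "\<lambda>j. ip M (X i) (e j)"]
        by (subst ip_commute) (simp add: r_def proj_def)
      finally have "proj M (insert m J) e' (X i) x = proj M J e (X i) x" for x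
        using c fin mJ e'1 by (simp add: proj_def e'3)
      then show ?thesis using AE by simp
    qed
    show ?thesis
      using J on' Xrep
      by (intro exI[of _ A'] exI[of _ "insert m J"]) (auto simp: e'_def)
  qed
qed

section \<open>Projection kernels and residual reduction\<close>

definition kop :: "'a measure \<Rightarrow> ('a \<Rightarrow> 'a \<Rightarrow> real) \<Rightarrow> ('a \<Rightarrow> real) \<Rightarrow> 'a \<Rightarrow> real" where
  "kop P k f = (\<lambda>x. ip P (k x) f)"

text \<open>Kernel of an orthogonal projection with trace \<open>t\<close>, the dimension of its
  range. The identities hold at every point and not just almost everywhere, since single points are
  sampled. Described by identities instead of a basis, the class is visibly stable under removing
  the direction \<open>k x\<close>.\<close>

definition proj_kernel :: "'a measure \<Rightarrow> ('a \<Rightarrow> 'a \<Rightarrow> real) \<Rightarrow> real \<Rightarrow> bool" where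
  "proj_kernel P k t \<longleftrightarrow>
     (\<lambda>z. k (fst z) (snd z)) \<in> borel_measurable (P \<Otimes>\<^sub>M P) \<and>
     (\<forall>x. sqint P (k x)) \<and> (\<forall>x y. ip P (k x) (k y) = k x y) \<and>
     integrable P (\<lambda>x. k x x) \<and> (\<integral>x. k x x \<partial>P) = t \<and>
     (\<forall>f. sqint P f \<longrightarrow> sqint P (kop P k f) \<and> kop P k (kop P k f) = kop P k f \<and>
        ip P f (kop P k f) = ip P (kop P k f) (kop P k f))"

definition krange :: "'a measure \<Rightarrow> ('a \<Rightarrow> 'a \<Rightarrow> real) \<Rightarrow> ('a \<Rightarrow> real) set" where
  "krange P k = {a. sqint P a \<and> kop P k a = a}"

context
  fixes P :: "'a measure" and k :: "'a \<Rightarrow> 'a \<Rightarrow> real" and t :: real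
  assumes k: "proj_kernel P k t"
begin

lemma proj_kernel_sqint: "sqint P (k x)"
  and proj_kernel_ip: "ip P (k x) (k y) = k x y"
  and proj_kernel_measurable: "(\<lambda>z. k (fst z) (snd z)) \<in> borel_measurable (P \<Otimes>\<^sub>M P)"
  and proj_kernel_integrable: "integrable P (\<lambda>x. k x x)"
  and proj_kernel_trace: "(\<integral>x. k x x \<partial>P) = t"
  using k by (auto simp: proj_kernel_def)

lemma proj_kernel_kop:
  assumes "sqint P f"
  shows "sqint P (kop P k f)" "kop P k (kop P k f) = kop P k f"
    "ip P f (kop P k f) = ip P (kop P k f) (kop P k f)"
  using k assms by (auto simp: proj_kernel_def)

lemma proj_kernel_sym: "k x y = k y x"
  using proj_kernel_ip[of x y] proj_kernel_ip[of y x] by (simp add: ip_commute)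

lemma proj_kernel_diag_nonneg: "0 \<le> k x x"
  using proj_kernel_ip[of x x] ip_self_nonneg[of P "k x"] by simp

lemma kop_kernel: "kop P k (k x) = k x"
  by (auto simp: kop_def proj_kernel_ip proj_kernel_sym[of _ x])

lemma kop_diff: "sqint P f \<Longrightarrow> sqint P g \<Longrightarrow> kop P k (\<lambda>x. f x - g x) = (\<lambda>x. kop P k f x - kop P k g x)"
  by (simp add: kop_def ip_diff_right proj_kernel_sqint)

lemma kop_cmult: "kop P k (\<lambda>x. c * f x) = (\<lambda>x. c * kop P k f x)"
  by (simp add: kop_def)

lemma kop_cdivide: "kop P k (\<lambda>x. f x / c) = (\<lambda>x. kop P k f x / c)"
  by (simp add: kop_def)

lemma kernel_in_krange: "(\<lambda>y. c * k x y) \<in> krange P k"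
  by (simp add: krange_def proj_kernel_sqint kop_cmult kop_cdivide kop_kernel)

lemma kop_Pythagoras:
  assumes "sqint P f"
  shows "ip P f f = ip P (kop P k f) (kop P k f) + ip P (\<lambda>x. f x - kop P k f x) (\<lambda>x. f x - kop P k f x)"
  using proj_kernel_kop[OF assms] ip_diff_self[OF assms proj_kernel_kop(1)[OF assms]] by simp

text \<open>\<open>k x x\<close> is nonnegative with integral zero, and by Cauchy-Schwarz it
  controls the squared value at \<open>x\<close> of every projected function. This is the situation
  when interpolation has used up all dimensions.\<close>

lemma kop_trace_0:
  assumes "t = 0" "sqint P f"
  shows "AE x in P. kop P k f x = 0"
proof -
  have "AE x in P. k x x = 0"
    using integral_nonneg_eq_0_iff_AE[OF proj_kernel_integrable] proj_kernel_diag_nonneg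
      proj_kernel_trace assms by auto
  then show ?thesis
  proof eventually_elim
    case (elim x)
    have "(kop P k f x)\<^sup>2 \<le> 0"
      using ip_Cauchy_Schwarz[OF proj_kernel_sqint[of x] assms(2)] elim
      by (simp add: kop_def proj_kernel_ip)
    then show ?case by simp
  qed
qed

text \<open>Removing the direction of the reproducing function at a point leaves the projection onto
  the elements of the range that vanish at that point.\<close>

lemma proj_kernel_remove:
  assumes x: "k x x > 0" and xs: "x \<in> space P"
  defines "k' \<equiv> \<lambda>y z. k y z - (k x y / k x x) * k x z"
  shows "proj_kernel P k' (t - 1)"
    and "sqint P f \<Longrightarrow> kop P k' f = (\<lambda>y. kop P k f y - (kop P k f x / k x x) * k x y)"
    and "krange P k' \<subseteq> krange P k"
proof -
  have sq: "sqint P (k' y)" for y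
    unfolding k'_def by (intro sqint_diff sqint_cmult proj_kernel_sqint)
  show K: "kop P k' f = (\<lambda>y. kop P k f y - (kop P k f x / k x x) * k x y)" if "sqint P f" for f
  proof
    fix y
    have "kop P k' f y = ip P (k y) f - (k x y / k x x) * ip P (k x) f"
      unfolding kop_def k'_def using that
      by (subst ip_diff_left) (auto simp: proj_kernel_sqint)
    then show "kop P k' f y = kop P k f y - (kop P k f x / k x x) * k x y"
      by (simp add: kop_def)
  qed
  have ip: "ip P (k' y) (k' z) = k' y z" for y z
  proof -
    have "ip P (k' y) (k' z) = kop P k' (k' z) y" by (simp add: kop_def)
    also have "\<dots> = kop P k (k' z) y - (kop P k (k' z) x / k x x) * k x y"
      using K[OF sq] by simp
    also have "kop P k (k' z) = k' z"
      unfolding k'_def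
      by (subst kop_diff) (auto simp: kop_cmult kop_cdivide kop_kernel proj_kernel_sqint)
    also have "k' z x = 0"
      using x by (simp add: k'_def proj_kernel_sym[of z x])
    finally show ?thesis
      by (simp add: k'_def proj_kernel_sym[of z y])
  qed
  have kx[measurable]: "k x \<in> borel_measurable P"
    using proj_kernel_sqint by (simp add: sqint_def)
  note proj_kernel_measurable[measurable]
  have int2: "integrable P (\<lambda>y. k x y / k x x * k x y)"
    using sqint_mult_integrable[OF sqint_cmult[of P "k x" "1 / k x x"] proj_kernel_sqint[of x]]
      proj_kernel_sqint by simp
  \<comment> \<open>The subtracted diagonal is the square of the unit vector
    \<open>k x / sqrt (k x x)\<close>, so the trace drops by exactly 1.\<close>
  have "(\<integral>y. k x y / k x x * k x y \<partial>P) = ip P (\<lambda>y. (1 / k x x) * k x y) (k x)"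
    by (simp add: ip_def)
  also have "\<dots> = 1" using x by (simp only: ip_cmult_left proj_kernel_ip) simp
  finally have tr: "(\<integral>y. k' y y \<partial>P) = t - 1" "integrable P (\<lambda>y. k' y y)"
    using int2 proj_kernel_integrable proj_kernel_trace by (simp_all add: k'_def)
  have meas: "(\<lambda>z. k' (fst z) (snd z)) \<in> borel_measurable (P \<Otimes>\<^sub>M P)"
    unfolding k'_def by measurable
  have kop: "sqint P (kop P k' f) \<and> kop P k' (kop P k' f) = kop P k' f \<and>
        ip P f (kop P k' f) = ip P (kop P k' f) (kop P k' f)" if f: "sqint P f" for f
  proof -
    let ?v = "kop P k f" and ?c = "kop P k f x / k x x"
    have v: "sqint P ?v" by (rule proj_kernel_kop[OF f])
    have s: "sqint P (kop P k' f)"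
      using K[OF f] v proj_kernel_sqint[of x] by auto
    have fx: "kop P k' f x = 0" using x K[OF f] by simp
    have "kop P k (kop P k' f) = kop P k' f"
      using v proj_kernel_sqint[of x]
      by (subst (1 2) K[OF f]) (auto simp: kop_diff kop_cmult kop_cdivide kop_kernel proj_kernel_kop[OF f])
    then have "kop P k' (kop P k' f) = kop P k' f"
      using K[OF s] fx by simp
    moreover have "ip P f (kop P k' f) = ip P (kop P k' f) (kop P k' f)"
    proof -
      have "ip P f (kop P k' f) = ip P ?v ?v - ?c * ?v x"
        using f v proj_kernel_sqint[of x] proj_kernel_kop(3)[OF f]
        by (simp add: K[OF f] ip_diff_right ip_commute[of P f "k x"]) (simp add: kop_def)
      moreover have "ip P ?v (k x) = ?v x"
        using proj_kernel_kop(2)[OF f] by (subst ip_commute) (metis kop_def)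
      then have "ip P (kop P k' f) (kop P k' f) = ip P ?v ?v - 2 * (?c * ?v x) + ?c * (?c * k x x)"
        using v proj_kernel_sqint[of x]
        by (simp add: K[OF f] ip_diff_self proj_kernel_ip)
      ultimately show ?thesis using x by simp
    qed
    ultimately show ?thesis using s by blast
  qed
  show "proj_kernel P k' (t - 1)"
    unfolding proj_kernel_def using meas sq ip tr kop by blast
  show "krange P k' \<subseteq> krange P k"
  proof
    fix a assume "a \<in> krange P k'"
    then have a: "sqint P a" "a = (\<lambda>y. kop P k a y - (kop P k a x / k x x) * k x y)"
      using K by (auto simp: krange_def)
    have "kop P k a = kop P k (\<lambda>y. kop P k a y - (kop P k a x / k x x) * k x y)"
      using a(2) by simp
    also have "\<dots> = (\<lambda>y. kop P k a y - (kop P k a x / k x x) * k x y)"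
      using a(1) proj_kernel_kop[OF a(1)] proj_kernel_sqint[of x]
      by (subst kop_diff) (auto simp: kop_cmult kop_cdivide kop_kernel)
    finally show "a \<in> krange P k" using a by (simp add: krange_def)
  qed
qed

end

section \<open>Residuals after successive point samples\<close>

text \<open>One sample per step: the current residual is evaluated at a point, and this value times
  a fixed function is subtracted. The points and functions do not depend on \<omega>, so such a
  chain is a nonadaptive linear algorithm.\<close>

inductive reduces :: "'x set \<Rightarrow> ('x \<Rightarrow> real) set \<Rightarrow> nat \<Rightarrow> ('w \<Rightarrow> 'x \<Rightarrow> real) \<Rightarrow> ('w \<Rightarrow> 'x \<Rightarrow> real) \<Rightarrow> bool"
  for D V where
    reduces_0: "reduces D V 0 H H"
  | reduces_Suc: "reduces D V n H H' \<Longrightarrow> x \<in> D \<Longrightarrow> a \<in> V \<Longrightarrow>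
      reduces D V (Suc n) H (\<lambda>\<omega> y. H' \<omega> y - H' \<omega> x * a y)"

lemma reduces_trans:
  assumes "reduces D V n' H' H''" "reduces D V n H H'"
  shows "reduces D V (n + n') H H''"
  using assms by (induction rule: reduces.induct) (auto intro: reduces.intros)

lemma reduces_mono: "reduces D V n H H' \<Longrightarrow> V \<subseteq> W \<Longrightarrow> reduces D W n H H'"
  by (induction rule: reduces.induct) (auto intro: reduces.intros)

text \<open>A value of an intermediate residual is a linear combination of values of
  \<open>H\<close>, so the chain unfolds into one linear formula in these values. Closure of
  \<open>V\<close> under the occurring combinations keeps the coefficient functions in
  \<open>V\<close>.\<close>

lemma reduces_linear_algorithm:
  assumes "reduces D V n H H'" and V: "\<And>u v c. u \<in> V \<Longrightarrow> v \<in> V \<Longrightarrow> (\<lambda>y. u y - c * v y) \<in> V"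
  shows "\<exists>x a. (\<forall>i<n. x i \<in> D \<and> a i \<in> V) \<and> H' = (\<lambda>\<omega> y. H \<omega> y - (\<Sum>i<n. H \<omega> (x i) * a i y))"
  using assms(1)
proof (induction rule: reduces.induct)
  case (reduces_0 H)
  show ?case by simp
next
  case (reduces_Suc n H H' x0 a0)
  then obtain x a where xa: "\<forall>i<n. x i \<in> D \<and> a i \<in> V"
    "H' = (\<lambda>\<omega> y. H \<omega> y - (\<Sum>i<n. H \<omega> (x i) * a i y))" by blast
  \<comment> \<open>The residual at \<open>x0\<close> already contains the earlier samples; their
    coefficient functions are corrected by \<open>a i x0 * a0\<close>.\<close>
  let ?x = "x(n := x0)" and ?a = "\<lambda>i. if i = n then a0 else (\<lambda>y. a i y - a i x0 * a0 y)"
  have "(\<lambda>\<omega> y. H' \<omega> y - H' \<omega> x0 * a0 y) = (\<lambda>\<omega> y. H \<omega> y - (\<Sum>i<Suc n. H \<omega> (?x i) * ?a i y))"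
    unfolding xa(2)
    by (intro ext) (simp add: algebra_simps sum_subtractf sum_distrib_right sum_distrib_left)
  moreover have "\<forall>i<Suc n. ?x i \<in> D \<and> ?a i \<in> V"
  proof (intro allI impI)
    fix i assume "i < Suc n"
    then consider "i = n" | "i < n" by linarith
    then show "?x i \<in> D \<and> ?a i \<in> V"
    proof cases
      case 1
      then show ?thesis using reduces_Suc.hyps(2,3) by simp
    next
      case 2
      then have "x i \<in> D" and ai: "a i \<in> V" using xa(1) by blast+
      have "(\<lambda>y. a i y - a i x0 * a0 y) \<in> V"
        by (rule V[OF ai reduces_Suc.hyps(3)])
      with \<open>x i \<in> D\<close> 2 show ?thesis by simp
    qed
  qed
  ultimately show ?case by (intro exI[of _ ?x] exI[of _ ?a] conjI)
qed

lemma measurable_joint: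
  assumes "(\<lambda>z. H (fst z) (snd z)) \<in> borel_measurable (A \<Otimes>\<^sub>M B)" "f \<in> measurable C A" "g \<in> measurable C B"
  shows "(\<lambda>z. H (f z) (g z)) \<in> borel_measurable C"
  using measurable_compose[OF measurable_Pair[OF assms(2,3)] assms(1)] by simp

text \<open>If \<open>\<Psi>\<close> exceeded \<open>B * w\<close> wherever \<open>w\<close> is
  positive on \<open>D\<close>, integration would contradict the bound on the integrals, as
  \<open>B * w\<close> is 0 elsewhere. The weight is not normalised, and positivity of
  \<open>w x\<close> is part of the result because the later steps divide by it.\<close>

lemma exists_below_average:
  fixes \<Psi> w :: "'a \<Rightarrow> ennreal"
  assumes [measurable]: "\<Psi> \<in> borel_measurable P" "w \<in> borel_measurable P"
    and le: "(\<integral>\<^sup>+x. \<Psi> x \<partial>P) \<le> B * (\<integral>\<^sup>+x. w x \<partial>P)"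
    and fin: "B < \<infinity>" "(\<integral>\<^sup>+x. w x \<partial>P) < \<infinity>" and pos: "(\<integral>\<^sup>+x. w x \<partial>P) \<noteq> 0"
    and D: "AE x in P. x \<in> D"
  shows "\<exists>x\<in>D \<inter> space P. w x > 0 \<and> \<Psi> x \<le> B * w x"
proof (rule ccontr)
  assume neg: "\<not> ?thesis"
  have "(\<integral>\<^sup>+x. B * w x \<partial>P) < (\<integral>\<^sup>+x. \<Psi> x \<partial>P)"
  proof (rule nn_integral_less)
    show "(\<integral>\<^sup>+ x. B * w x \<partial>P) \<noteq> \<infinity>"
      using fin by (simp add: nn_integral_cmult ennreal_mult_eq_top_iff less_top)
    show "AE x in P. B * w x \<le> \<Psi> x"
      using D AE_space
    proof eventually_elim
      case (elim x)
      then show ?case using neg by (cases "w x = 0") (auto simp: zero_less_iff_neq_zero)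
    qed
    show "\<not> (AE x in P. \<Psi> x \<le> B * w x)"
    proof
      assume "AE x in P. \<Psi> x \<le> B * w x"
      with D AE_space have "AE x in P. w x = 0"
      proof eventually_elim
        case (elim x)
        then show ?case using neg by (auto simp: zero_less_iff_neq_zero)
      qed
      then show False using pos by (simp add: nn_integral_0_iff_AE)
    qed
  qed simp_all
  also have "\<dots> \<le> (\<integral>\<^sup>+x. B * w x \<partial>P)"
    using le by (simp add: nn_integral_cmult)
  finally show False by simp
qed

section \<open>Choosing the sample points\<close>

text \<open>Random square integrable function with just enough measurability for Tonelli, which
  exchanges the average over \<omega> with the average over sample points.\<close>

definition rfun :: "'w measure \<Rightarrow> 'x measure \<Rightarrow> ('w \<Rightarrow> 'x \<Rightarrow> real) \<Rightarrow> bool" where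
  "rfun M P H \<longleftrightarrow> (\<lambda>z. H (fst z) (snd z)) \<in> borel_measurable (M \<Otimes>\<^sub>M P) \<and> (\<forall>\<omega>\<in>space M. sqint P (H \<omega>))"

definition mean_sq :: "'w measure \<Rightarrow> 'x measure \<Rightarrow> ('w \<Rightarrow> 'x \<Rightarrow> real) \<Rightarrow> ennreal" where
  "mean_sq M P H = (\<integral>\<^sup>+\<omega>. (\<integral>\<^sup>+x. ennreal ((H \<omega> x)\<^sup>2) \<partial>P) \<partial>M)"

lemma mean_sq_eq: "rfun M P H \<Longrightarrow> mean_sq M P H = (\<integral>\<^sup>+\<omega>. ennreal (ip P (H \<omega>) (H \<omega>)) \<partial>M)"
  unfolding mean_sq_def by (rule nn_integral_cong) (simp add: nn_integral_ip rfun_def)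

lemma rfun_sqint: "rfun M P H \<Longrightarrow> \<omega> \<in> space M \<Longrightarrow> sqint P (H \<omega>)"
  by (simp add: rfun_def)

lemma rfun_step:
  assumes "rfun M P H" "x \<in> space P" "sqint P a"
  shows "rfun M P (\<lambda>\<omega> y. H \<omega> y - H \<omega> x * a y)"
proof -
  have [measurable]: "(\<lambda>z. H (fst z) (snd z)) \<in> borel_measurable (M \<Otimes>\<^sub>M P)"
    and [measurable]: "a \<in> borel_measurable P"
    using assms by (simp_all add: rfun_def sqint_def)
  have [measurable]: "(\<lambda>z. H (fst z) x) \<in> borel_measurable (M \<Otimes>\<^sub>M P)"
    by (rule measurable_joint[of H M P fst _ "\<lambda>_. x"]) (use assms in simp_all)
  show ?thesis
    using assms by (auto simp: rfun_def)
qed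

context
  fixes M :: "'w measure" and P :: "'x measure" and D :: "'x set"
  assumes sfM: "sigma_finite_measure M" and sfP: "sigma_finite_measure P"
    and D_sub: "D \<subseteq> space P" and D_AE: "AE x in P. x \<in> D"
begin

lemma rfun_kop:
  assumes k: "proj_kernel P k t" and H: "rfun M P H"
  shows "rfun M P (\<lambda>\<omega>. kop P k (H \<omega>))" "rfun M P (\<lambda>\<omega> y. H \<omega> y - kop P k (H \<omega>) y)"
proof -
  interpret P: sigma_finite_measure P by (rule sfP)
  have H1[measurable]: "(\<lambda>z. H (fst z) (snd z)) \<in> borel_measurable (M \<Otimes>\<^sub>M P)"
    using H by (simp add: rfun_def)
  have [measurable]: "(\<lambda>u. H (fst (fst u)) (snd u)) \<in> borel_measurable ((M \<Otimes>\<^sub>M P) \<Otimes>\<^sub>M P)"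
    by (rule measurable_joint[OF H1]) measurable
  have [measurable]: "(\<lambda>u. k (snd (fst u)) (snd u)) \<in> borel_measurable ((M \<Otimes>\<^sub>M P) \<Otimes>\<^sub>M P)"
    by (rule measurable_joint[OF proj_kernel_measurable[OF k]]) measurable
  have "(\<lambda>z. kop P k (H (fst z)) (snd z)) \<in> borel_measurable (M \<Otimes>\<^sub>M P)"
    unfolding kop_def ip_def by (rule P.borel_measurable_lebesgue_integral) (simp add: split_beta')
  then show 1: "rfun M P (\<lambda>\<omega>. kop P k (H \<omega>))"
    using H proj_kernel_kop(1)[OF k] by (auto simp: rfun_def)
  then show "rfun M P (\<lambda>\<omega> y. H \<omega> y - kop P k (H \<omega>) y)"
    using H by (auto simp: rfun_def)
qed

lemma reduces_rfun:
  assumes "reduces D V n H H'" "\<And>a. a \<in> V \<Longrightarrow> sqint P a" "rfun M P H"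
  shows "rfun M P H'"
  using assms by (induction rule: reduces.induct) (use D_sub in \<open>auto intro!: rfun_step\<close>)

lemma mean_sq_swap:
  assumes "rfun M P H"
  shows "(\<integral>\<^sup>+x. (\<integral>\<^sup>+\<omega>. ennreal ((H \<omega> x)\<^sup>2) \<partial>M) \<partial>P) = mean_sq M P H"
    "(\<lambda>x. \<integral>\<^sup>+\<omega>. ennreal ((H \<omega> x)\<^sup>2) \<partial>M) \<in> borel_measurable P"
proof -
  interpret pair_sigma_finite M P
    using sfM sfP by (simp add: pair_sigma_finite_def)
  have H[measurable]: "(\<lambda>z. H (fst z) (snd z)) \<in> borel_measurable (M \<Otimes>\<^sub>M P)"
    using assms by (simp add: rfun_def)
  have m: "(\<lambda>(\<omega>, x). ennreal ((H \<omega> x)\<^sup>2)) \<in> borel_measurable (M \<Otimes>\<^sub>M P)"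
    unfolding split_beta' by measurable
  show "(\<integral>\<^sup>+x. (\<integral>\<^sup>+\<omega>. ennreal ((H \<omega> x)\<^sup>2) \<partial>M) \<partial>P) = mean_sq M P H"
    unfolding mean_sq_def by (rule Fubini') (rule m)
  have [measurable]: "(\<lambda>z. H (snd z) (fst z)) \<in> borel_measurable (P \<Otimes>\<^sub>M M)"
    by (rule measurable_joint[OF H]) measurable
  show "(\<lambda>x. \<integral>\<^sup>+\<omega>. ennreal ((H \<omega> x)\<^sup>2) \<partial>M) \<in> borel_measurable P"
    by (rule M1.borel_measurable_nn_integral) (simp add: split_beta')
qed

lemma ip_self_measurable:
  assumes "rfun M P H"
  shows "(\<lambda>\<omega>. ip P (H \<omega>) (H \<omega>)) \<in> borel_measurable M"
proof -
  interpret P: sigma_finite_measure P by (rule sfP)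
  have H[measurable]: "(\<lambda>z. H (fst z) (snd z)) \<in> borel_measurable (M \<Otimes>\<^sub>M P)"
    using assms by (simp add: rfun_def)
  show ?thesis
    unfolding ip_def by (rule P.borel_measurable_lebesgue_integral) (simp add: split_beta')
qed

lemma kernel_nn_trace:
  assumes k: "proj_kernel P k t"
  shows "(\<integral>\<^sup>+x. ennreal (k x x) \<partial>P) = ennreal t"
  using nn_integral_eq_integral[OF proj_kernel_integrable[OF k]] proj_kernel_diag_nonneg[OF k]
    proj_kernel_trace[OF k] by simp

lemma kernel_diag_measurable:
  assumes k: "proj_kernel P k t"
  shows "(\<lambda>x. k x x) \<in> borel_measurable P"
  using proj_kernel_integrable[OF k] by simp

text \<open>The point is drawn from the density k(x,x)/t.\<close>

lemma interpolation_step: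
  assumes k: "proj_kernel P k t" and t: "t > 0" and H: "rfun M P H"
    and fin: "mean_sq M P (\<lambda>\<omega> y. H \<omega> y - kop P k (H \<omega>) y) < \<infinity>"
  shows "\<exists>x\<in>D. k x x > 0 \<and>
    mean_sq M P (\<lambda>\<omega> y. (H \<omega> y - H \<omega> x * (1 / k x x * k x y)) -
        kop P (\<lambda>y z. k y z - (k x y / k x x) * k x z) (\<lambda>y. H \<omega> y - H \<omega> x * (1 / k x x * k x y)) y)
      \<le> ennreal (1 + 1 / t) * mean_sq M P (\<lambda>\<omega> y. H \<omega> y - kop P k (H \<omega>) y)"
proof -
  let ?G = "\<lambda>\<omega> y. H \<omega> y - kop P k (H \<omega>) y"
  let ?E = "mean_sq M P ?G"
  have G: "rfun M P ?G" by (rule rfun_kop(2)[OF k H])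
  \<comment> \<open>\<open>\<Psi> x\<close> is \<open>k x x\<close> times the mean square error
    outside the smaller range after a sample at \<open>x\<close>. Its integral is
    \<open>t * ?E + ?E\<close>, hence the factor \<open>1 + 1 / t\<close> relative to the total
    weight \<open>t\<close>.\<close>
  define \<Psi> where "\<Psi> = (\<lambda>x. ennreal (k x x) * ?E + (\<integral>\<^sup>+\<omega>. ennreal ((?G \<omega> x)\<^sup>2) \<partial>M))"
  note kernel_diag_measurable[OF k, measurable] mean_sq_swap(2)[OF G, measurable]
  have "\<exists>x\<in>D \<inter> space P. ennreal (k x x) > 0 \<and> \<Psi> x \<le> (ennreal (1 + 1 / t) * ?E) * ennreal (k x x)"
  proof (rule exists_below_average)
    show "\<Psi> \<in> borel_measurable P" unfolding \<Psi>_def by measurable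
    have "(\<integral>\<^sup>+ x. \<Psi> x \<partial>P) = ennreal t * ?E + ?E"
      unfolding \<Psi>_def
      by (subst nn_integral_add) (auto simp: nn_integral_multc kernel_nn_trace[OF k] mean_sq_swap(1)[OF G])
    also have "\<dots> = ennreal (t + 1) * ?E"
      using t by (simp add: distrib_right)
    also have "ennreal (t + 1) = ennreal (1 + 1 / t) * ennreal t"
      using t by (simp add: ennreal_mult[symmetric] distrib_right)
    finally show "(\<integral>\<^sup>+ x. \<Psi> x \<partial>P) \<le> ennreal (1 + 1 / t) * ?E * (\<integral>\<^sup>+ x. ennreal (k x x) \<partial>P)"
      by (simp add: kernel_nn_trace[OF k] mult_ac)
    show "ennreal (1 + 1 / t) * ?E < \<infinity>"
      using fin by (simp add: ennreal_mult_less_top)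
  qed (use t D_AE in \<open>auto simp: kernel_nn_trace[OF k]\<close>)
  then obtain x where x: "x \<in> D" "x \<in> space P" "k x x > 0"
    and le: "\<Psi> x \<le> (ennreal (1 + 1 / t) * ?E) * ennreal (k x x)" by auto
  let ?k' = "\<lambda>y z. k y z - (k x y / k x x) * k x z"
  let ?H' = "\<lambda>\<omega> y. H \<omega> y - H \<omega> x * (1 / k x x * k x y)"
  let ?G' = "\<lambda>\<omega> y. ?H' \<omega> y - kop P ?k' (?H' \<omega>) y"
  note [simp] = proj_kernel_sqint[OF k]
  have H': "rfun M P ?H'" using x by (intro rfun_step H sqint_cmult) simp_all
  have G': "rfun M P ?G'" by (rule rfun_kop(2)[OF proj_kernel_remove(1)[OF k x(3,2)] H'])
  \<comment> \<open>The new residual vanishes at \<open>x\<close>, which forces its component along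
    \<open>k x\<close> to be \<open>- ?G \<omega> x / k x x\<close> times \<open>k x\<close>. Once
    \<open>k x\<close> is removed from the range, this component joins the part outside, to which it
    is orthogonal.\<close>
  have id: "ip P (?G' \<omega>) (?G' \<omega>) = ip P (?G \<omega>) (?G \<omega>) + (?G \<omega> x)\<^sup>2 / k x x" if "\<omega> \<in> space M" for \<omega>
  proof -
    have sH: "sqint P (H \<omega>)" and sH': "sqint P (?H' \<omega>)" and sG: "sqint P (?G \<omega>)"
      using that H H' G by (auto simp: rfun_def)
    have kH': "kop P k (?H' \<omega>) = (\<lambda>y. kop P k (H \<omega>) y - H \<omega> x * (1 / k x x * k x y))"
      using sH by (subst kop_diff[OF k]) (auto simp only: kop_cmult[OF k] kop_kernel[OF k] intro!: sqint_cmult proj_kernel_sqint[OF k])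
    have "?G' \<omega> = (\<lambda>y. ?G \<omega> y - (?G \<omega> x / k x x) * k x y)"
      unfolding proj_kernel_remove(2)[OF k x(3,2) sH'] kH'
      using x by (simp add: fun_eq_iff field_simps)
    moreover have "ip P (?G \<omega>) (k x) = 0"
    proof -
      have "ip P (?G \<omega>) (k x) = kop P k (?G \<omega>) x" by (simp add: kop_def ip_commute)
      also have "kop P k (?G \<omega>) = (\<lambda>_. 0)"
        using sH proj_kernel_kop[OF k sH] by (subst kop_diff[OF k]) auto
      finally show ?thesis .
    qed
    ultimately have "ip P (?G' \<omega>) (?G' \<omega>)
        = ip P (?G \<omega>) (?G \<omega>) + (?G \<omega> x / k x x) * ((?G \<omega> x / k x x) * k x x)"
      using ip_diff_self[OF sG sqint_cmult[OF proj_kernel_sqint[OF k]], of "?G \<omega> x / k x x" x]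
      by (simp only: ip_cmult_left ip_cmult_right proj_kernel_ip[OF k])
    then show ?thesis using x by (simp add: power2_eq_square)
  qed
  have [measurable]: "(\<lambda>\<omega>. ip P (?G \<omega>) (?G \<omega>)) \<in> borel_measurable M"
    by (rule ip_self_measurable[OF G])
  have [measurable]: "(\<lambda>z. ?G (fst z) (snd z)) \<in> borel_measurable (M \<Otimes>\<^sub>M P)"
    using G by (simp add: rfun_def)
  have [measurable]: "(\<lambda>\<omega>. ?G \<omega> x) \<in> borel_measurable M"
    by (rule measurable_joint[of ?G M P "\<lambda>\<omega>. \<omega>" _ "\<lambda>_. x"]) (use x in simp_all)
  have "ennreal (k x x) * mean_sq M P ?G' = (\<integral>\<^sup>+\<omega>. ennreal (k x x) * ennreal (ip P (?G' \<omega>) (?G' \<omega>)) \<partial>M)"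
    unfolding mean_sq_eq[OF G'] by (rule nn_integral_cmult[symmetric], rule measurable_compose[OF ip_self_measurable[OF G'] measurable_ennreal])
  also have "\<dots> = (\<integral>\<^sup>+\<omega>. ennreal (k x x) * ennreal (ip P (?G \<omega>) (?G \<omega>)) + ennreal ((?G \<omega> x)\<^sup>2) \<partial>M)"
  proof (rule nn_integral_cong)
    fix \<omega> assume w: "\<omega> \<in> space M"
    have "k x x * ip P (?G' \<omega>) (?G' \<omega>) = k x x * ip P (?G \<omega>) (?G \<omega>) + (?G \<omega> x)\<^sup>2"
      using x by (simp only: id[OF w]) (simp add: distrib_left)
    then show "ennreal (k x x) * ennreal (ip P (?G' \<omega>) (?G' \<omega>))
        = ennreal (k x x) * ennreal (ip P (?G \<omega>) (?G \<omega>)) + ennreal ((?G \<omega> x)\<^sup>2)"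
      using x by (simp add: ennreal_mult[symmetric] ennreal_plus[symmetric] del: ennreal_plus)
  qed
  also have "\<dots> = \<Psi> x"
    unfolding \<Psi>_def mean_sq_eq[OF G] by (subst nn_integral_add) (simp_all add: nn_integral_cmult)
  finally have "ennreal (k x x) * mean_sq M P ?G' \<le> ennreal (k x x) * (ennreal (1 + 1 / t) * ?E)"
    using le by (simp add: mult_ac)
  then have "mean_sq M P ?G' \<le> ennreal (1 + 1 / t) * ?E"
    using x by (simp add: ennreal_mult_le_mult_iff)
  then show ?thesis using x by (intro bexI[of _ x]) auto
qed

text \<open>Each point reduces the dimension from \<open>i\<close> to \<open>i - 1\<close> and costs
  a factor \<open>1 + 1 / i\<close>; the product over \<open>i\<close> from 1 to \<open>m\<close>
  telescopes to \<open>m + 1\<close>. In dimension 0 the residual lies entirely outside the range,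
  so its full norm is controlled.\<close>

lemma stable_interpolation:
  assumes "proj_kernel P k (real m)" "rfun M P H"
    "mean_sq M P (\<lambda>\<omega> y. H \<omega> y - kop P k (H \<omega>) y) < \<infinity>"
  shows "\<exists>H'. reduces D (krange P k) m H H' \<and>
    mean_sq M P H' \<le> ennreal (real m + 1) * mean_sq M P (\<lambda>\<omega> y. H \<omega> y - kop P k (H \<omega>) y)"
  using assms
proof (induction m arbitrary: k H)
  case 0
  have "mean_sq M P H = mean_sq M P (\<lambda>\<omega> y. H \<omega> y - kop P k (H \<omega>) y)"
    unfolding mean_sq_def
  proof (rule nn_integral_cong)
    fix \<omega> assume "\<omega> \<in> space M"
    then have "AE y in P. kop P k (H \<omega>) y = 0"
      using kop_trace_0[OF 0(1)] 0(2) by (simp add: rfun_def)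
    then show "(\<integral>\<^sup>+ x. ennreal ((H \<omega> x)\<^sup>2) \<partial>P) = (\<integral>\<^sup>+ x. ennreal ((H \<omega> x - kop P k (H \<omega>) x)\<^sup>2) \<partial>P)"
      by (intro nn_integral_cong_AE) auto
  qed
  then show ?case by (intro exI[of _ H]) (auto intro: reduces_0)
next
  case (Suc m)
  note k = Suc.prems(1)
  let ?E = "mean_sq M P (\<lambda>\<omega> y. H \<omega> y - kop P k (H \<omega>) y)"
  obtain x where x: "x \<in> D" "k x x > 0" and
    le: "mean_sq M P (\<lambda>\<omega> y. (H \<omega> y - H \<omega> x * (1 / k x x * k x y)) -
        kop P (\<lambda>y z. k y z - (k x y / k x x) * k x z) (\<lambda>y. H \<omega> y - H \<omega> x * (1 / k x x * k x y)) y)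
      \<le> ennreal (1 + 1 / real (Suc m)) * ?E"
    using interpolation_step[OF k _ Suc.prems(2,3)] by auto
  define k' where "k' = (\<lambda>y z. k y z - (k x y / k x x) * k x z)"
  define H1 where "H1 = (\<lambda>\<omega> y. H \<omega> y - H \<omega> x * (1 / k x x * k x y))"
  let ?E1 = "mean_sq M P (\<lambda>\<omega> y. H1 \<omega> y - kop P k' (H1 \<omega>) y)"
  have xs: "x \<in> space P" using x D_sub by auto
  have k': "proj_kernel P k' (real m)"
    using proj_kernel_remove(1)[OF k x(2) xs] by (simp add: k'_def)
  have a: "(\<lambda>y. 1 / k x x * k x y) \<in> krange P k" by (rule kernel_in_krange[OF k])
  have H1: "rfun M P H1"
    unfolding H1_def using a by (intro rfun_step Suc.prems(2) xs) (simp add: krange_def)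
  have le1: "?E1 \<le> ennreal (1 + 1 / real (Suc m)) * ?E"
    using le by (simp add: H1_def k'_def)
  also have "\<dots> < \<infinity>" using Suc.prems(3) by (simp add: ennreal_mult_less_top)
  finally have "?E1 < \<infinity>" .
  from Suc.IH[OF k' H1 this] obtain H' where H': "reduces D (krange P k') m H1 H'"
    "mean_sq M P H' \<le> ennreal (real m + 1) * ?E1" by blast
  have "reduces D (krange P k) (Suc 0) H H1"
    unfolding H1_def by (intro reduces_Suc reduces_0 x a)
  moreover have "reduces D (krange P k) m H1 H'"
    using H'(1) proj_kernel_remove(3)[OF k x(2) xs] by (intro reduces_mono[OF H'(1)]) (simp add: k'_def)
  ultimately have "reduces D (krange P k) (Suc m) H H'"
    using reduces_trans by fastforce
  moreover have "mean_sq M P H' \<le> ennreal (real m + 1) * (ennreal (1 + 1 / real (Suc m)) * ?E)"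
    using H'(2) le1 by (meson mult_left_mono order_trans zero_le)
  moreover have "ennreal (real m + 1) * ennreal (1 + 1 / real (Suc m)) = ennreal (real (Suc m) + 1)"
    by (simp add: ennreal_mult[symmetric] field_simps del: ennreal_plus)
  ultimately show ?case by (intro exI[of _ H']) (simp add: mult.assoc[symmetric])
qed

text \<open>A step of the randomized Kaczmarz iteration with relaxation \<open>\<kappa>\<close>, the point again being drawn from
  the density k(x,x)/t.\<close>

lemma Kaczmarz_step:
  assumes k: "proj_kernel P k t" and t: "t \<ge> 1" and H: "rfun M P H" and \<kappa>: "0 < \<kappa>" "\<kappa> \<le> 1"
    and fin: "mean_sq M P (\<lambda>\<omega>. kop P k (H \<omega>)) < \<infinity>" "mean_sq M P (\<lambda>\<omega> y. H \<omega> y - kop P k (H \<omega>) y) < \<infinity>"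
  shows "\<exists>H'. reduces D (krange P k) (Suc 0) H H' \<and>
    mean_sq M P (\<lambda>\<omega>. kop P k (H' \<omega>))
      \<le> ennreal (1 - \<kappa> / t) * mean_sq M P (\<lambda>\<omega>. kop P k (H \<omega>))
        + ennreal (\<kappa>\<^sup>2 / t) * mean_sq M P (\<lambda>\<omega> y. H \<omega> y - kop P k (H \<omega>) y) \<and>
    mean_sq M P (\<lambda>\<omega> y. H' \<omega> y - kop P k (H' \<omega>) y) = mean_sq M P (\<lambda>\<omega> y. H \<omega> y - kop P k (H \<omega>) y)"
proof -
  interpret pair_sigma_finite M P
    using sfM sfP by (simp add: pair_sigma_finite_def)
  let ?V = "\<lambda>\<omega>. kop P k (H \<omega>)"
  let ?G = "\<lambda>\<omega> y. H \<omega> y - ?V \<omega> y"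
  let ?B = "ennreal (1 - \<kappa> / t) * mean_sq M P ?V + ennreal (\<kappa>\<^sup>2 / t) * mean_sq M P ?G"
  have V: "rfun M P ?V" by (rule rfun_kop(1)[OF k H])
  have G: "rfun M P ?G" by (rule rfun_kop(2)[OF k H])
  \<comment> \<open>\<open>k x x\<close> times the squared norm of the component in the range after
    a relaxed step at \<open>x\<close>. The form without division also makes sense where
    \<open>k x x\<close> is 0; there \<open>?V \<omega> x\<close> vanishes as well and only the
    nonnegative last term remains.\<close>
  define q where "q = (\<lambda>\<omega> x. k x x * ip P (?V \<omega>) (?V \<omega>) - 2 * \<kappa> * (H \<omega> x * ?V \<omega> x) + \<kappa>\<^sup>2 * (H \<omega> x)\<^sup>2)"
  have kx: "\<kappa> / t \<le> 1" using \<kappa> t by simp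
  note kernel_diag_measurable[OF k, measurable]
  have Hm[measurable]: "(\<lambda>z. H (fst z) (snd z)) \<in> borel_measurable (M \<Otimes>\<^sub>M P)"
    using H by (simp add: rfun_def)
  have Vm[measurable]: "(\<lambda>z. ?V (fst z) (snd z)) \<in> borel_measurable (M \<Otimes>\<^sub>M P)"
    using V by (simp add: rfun_def)
  have [measurable]: "(\<lambda>\<omega>. ip P (?V \<omega>) (?V \<omega>)) \<in> borel_measurable M"
    by (rule ip_self_measurable[OF V])
  have [measurable]: "(\<lambda>\<omega>. ip P (?G \<omega>) (?G \<omega>)) \<in> borel_measurable M"
    by (rule ip_self_measurable[OF G])
  have qm[measurable]: "(\<lambda>z. q (fst z) (snd z)) \<in> borel_measurable (M \<Otimes>\<^sub>M P)"
    unfolding q_def by measurable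
  have [measurable]: "(\<lambda>z. q (snd z) (fst z)) \<in> borel_measurable (P \<Otimes>\<^sub>M M)"
    by (rule measurable_joint[OF qm]) measurable
  have V': "kop P k (\<lambda>y. H \<omega> y - H \<omega> x * (\<kappa> / k x x * k x y)) = (\<lambda>y. ?V \<omega> y - H \<omega> x * (\<kappa> / k x x * k x y))"
    if "\<omega> \<in> space M" for \<omega> x
    using rfun_sqint[OF H that]
    by (subst kop_diff[OF k]) (auto simp only: kop_cmult[OF k] kop_kernel[OF k] intro!: sqint_cmult proj_kernel_sqint[OF k])
  have id: "k x x * ip P (\<lambda>y. ?V \<omega> y - H \<omega> x * (\<kappa> / k x x * k x y)) (\<lambda>y. ?V \<omega> y - H \<omega> x * (\<kappa> / k x x * k x y)) = q \<omega> x"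
    if w: "\<omega> \<in> space M" and x: "k x x > 0" for \<omega> x
  proof -
    have sV: "sqint P (?V \<omega>)" using rfun_sqint[OF V w] .
    have Vx: "ip P (?V \<omega>) (k x) = ?V \<omega> x"
      using proj_kernel_kop(2)[OF k rfun_sqint[OF H w]] by (subst ip_commute) (metis kop_def)
    have "ip P (\<lambda>y. ?V \<omega> y - H \<omega> x * (\<kappa> / k x x * k x y)) (\<lambda>y. ?V \<omega> y - H \<omega> x * (\<kappa> / k x x * k x y))
      = ip P (?V \<omega>) (?V \<omega>) - 2 * (H \<omega> x * (\<kappa> / k x x * ?V \<omega> x))
        + H \<omega> x * (\<kappa> / k x x * (H \<omega> x * (\<kappa> / k x x * k x x)))"
      using ip_diff_self[OF sV sqint_cmult[OF sqint_cmult[OF proj_kernel_sqint[OF k]]], of "H \<omega> x" "\<kappa> / k x x" x]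
      by (simp only: ip_cmult_left ip_cmult_right proj_kernel_ip[OF k] Vx)
    then show ?thesis using x by (simp add: q_def field_simps power2_eq_square)
  qed
  have q_nonneg: "0 \<le> q \<omega> x" if w: "\<omega> \<in> space M" for \<omega> x
  proof (cases "k x x > 0")
    case True
    then show ?thesis using id[OF w True, symmetric] by simp
  next
    case False
    then have k0: "k x x = 0" using proj_kernel_diag_nonneg[OF k, of x] by simp
    have "(?V \<omega> x)\<^sup>2 \<le> 0"
      using ip_Cauchy_Schwarz[OF proj_kernel_sqint[OF k, of x] rfun_sqint[OF H w]] k0
      by (simp add: kop_def proj_kernel_ip[OF k])
    then show ?thesis using k0 by (simp add: q_def)
  qed
  have q_int: "(\<integral>\<^sup>+x. ennreal (q \<omega> x) \<partial>P)
      \<le> ennreal (t - \<kappa>) * ennreal (ip P (?V \<omega>) (?V \<omega>)) + ennreal (\<kappa>\<^sup>2) * ennreal (ip P (?G \<omega>) (?G \<omega>))"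
    if w: "\<omega> \<in> space M" for \<omega>
  proof -
    have sH: "sqint P (H \<omega>)" and sV: "sqint P (?V \<omega>)"
      using rfun_sqint[OF H w] rfun_sqint[OF V w] by auto
    have i1: "integrable P (\<lambda>x. k x x * ip P (?V \<omega>) (?V \<omega>))"
      using proj_kernel_integrable[OF k] by simp
    have i2: "integrable P (\<lambda>x. 2 * \<kappa> * (H \<omega> x * ?V \<omega> x))"
      using sqint_mult_integrable[OF sH sV] by simp
    have i3: "integrable P (\<lambda>x. \<kappa>\<^sup>2 * (H \<omega> x)\<^sup>2)"
      using sH by (simp add: sqint_def)
    have "(\<integral>x. q \<omega> x \<partial>P) = t * ip P (?V \<omega>) (?V \<omega>) - 2 * \<kappa> * ip P (H \<omega>) (?V \<omega>) + \<kappa>\<^sup>2 * ip P (H \<omega>) (H \<omega>)"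
      unfolding q_def
      using i1 i2 i3 proj_kernel_trace[OF k] by (simp add: ip_def power2_eq_square)
    \<comment> \<open>The inner product of \<open>H \<omega>\<close> and \<open>?V \<omega>\<close>
      is the squared norm of \<open>?V \<omega>\<close>, and Pythagoras splits the norm of
      \<open>H \<omega>\<close>. The term with \<open>\<kappa>\<^sup>2\<close> is the noise that the
      part outside the range feeds into the range.\<close>
    also have "\<dots> = (t - (2 * \<kappa> - \<kappa>\<^sup>2)) * ip P (?V \<omega>) (?V \<omega>) + \<kappa>\<^sup>2 * ip P (?G \<omega>) (?G \<omega>)"
      unfolding proj_kernel_kop(3)[OF k sH] kop_Pythagoras[OF k sH] by (simp add: algebra_simps)
    \<comment> \<open>For \<kappa> at most 1, \<open>2 * \<kappa> - \<kappa>\<^sup>2\<close> is at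
      least \<kappa>.\<close>
    also have "\<dots> \<le> (t - \<kappa>) * ip P (?V \<omega>) (?V \<omega>) + \<kappa>\<^sup>2 * ip P (?G \<omega>) (?G \<omega>)"
      using \<kappa> by (intro add_right_mono mult_right_mono) (auto simp: power2_eq_square)
    finally have *: "(\<integral>x. q \<omega> x \<partial>P) \<le> (t - \<kappa>) * ip P (?V \<omega>) (?V \<omega>) + \<kappa>\<^sup>2 * ip P (?G \<omega>) (?G \<omega>)" .
    have "integrable P (q \<omega>)"
      unfolding q_def by (intro Bochner_Integration.integrable_add Bochner_Integration.integrable_diff i1 i2 i3)
    then have "(\<integral>\<^sup>+x. ennreal (q \<omega> x) \<partial>P) = ennreal (\<integral>x. q \<omega> x \<partial>P)"
      using q_nonneg[OF w] by (intro nn_integral_eq_integral) auto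
    also have "\<dots> \<le> ennreal ((t - \<kappa>) * ip P (?V \<omega>) (?V \<omega>) + \<kappa>\<^sup>2 * ip P (?G \<omega>) (?G \<omega>))"
      by (rule ennreal_leI[OF *])
    also have "\<dots> = ennreal (t - \<kappa>) * ennreal (ip P (?V \<omega>) (?V \<omega>)) + ennreal (\<kappa>\<^sup>2) * ennreal (ip P (?G \<omega>) (?G \<omega>))"
      using \<kappa> t by (simp add: ennreal_mult)
    finally show ?thesis .
  qed
  have "\<exists>x\<in>D \<inter> space P. ennreal (k x x) > 0 \<and> (\<integral>\<^sup>+\<omega>. ennreal (q \<omega> x) \<partial>M) \<le> ?B * ennreal (k x x)"
  proof (rule exists_below_average)
    show "(\<lambda>x. \<integral>\<^sup>+\<omega>. ennreal (q \<omega> x) \<partial>M) \<in> borel_measurable P"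
      by (rule M1.borel_measurable_nn_integral) (simp add: split_beta')
    have "(\<integral>\<^sup>+x. (\<integral>\<^sup>+\<omega>. ennreal (q \<omega> x) \<partial>M) \<partial>P) = (\<integral>\<^sup>+\<omega>. (\<integral>\<^sup>+x. ennreal (q \<omega> x) \<partial>P) \<partial>M)"
      by (rule Fubini') (simp add: split_beta')
    also have "\<dots> \<le> (\<integral>\<^sup>+\<omega>. ennreal (t - \<kappa>) * ennreal (ip P (?V \<omega>) (?V \<omega>)) + ennreal (\<kappa>\<^sup>2) * ennreal (ip P (?G \<omega>) (?G \<omega>)) \<partial>M)"
      by (rule nn_integral_mono) (rule q_int)
    also have "\<dots> = ennreal (t - \<kappa>) * mean_sq M P ?V + ennreal (\<kappa>\<^sup>2) * mean_sq M P ?G"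
      unfolding mean_sq_eq[OF V] mean_sq_eq[OF G]
      by (subst nn_integral_add) (simp_all add: nn_integral_cmult)
    also have "ennreal (t - \<kappa>) = ennreal (1 - \<kappa> / t) * ennreal t"
      using t kx by (simp add: ennreal_mult[symmetric] left_diff_distrib)
    also have "ennreal (\<kappa>\<^sup>2) = ennreal (\<kappa>\<^sup>2 / t) * ennreal t"
      using t by (simp add: ennreal_mult[symmetric])
    finally show "(\<integral>\<^sup>+x. (\<integral>\<^sup>+\<omega>. ennreal (q \<omega> x) \<partial>M) \<partial>P) \<le> ?B * (\<integral>\<^sup>+ x. ennreal (k x x) \<partial>P)"
      by (simp add: kernel_nn_trace[OF k] distrib_right distrib_left mult_ac)
    show "?B < \<infinity>"
      using fin by (simp add: ennreal_mult_less_top)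
  qed (use t D_AE in \<open>auto simp: kernel_nn_trace[OF k]\<close>)
  then obtain x where x: "x \<in> D" "x \<in> space P" "k x x > 0"
    and le: "(\<integral>\<^sup>+\<omega>. ennreal (q \<omega> x) \<partial>M) \<le> ?B * ennreal (k x x)" by auto
  let ?H' = "\<lambda>\<omega> y. H \<omega> y - H \<omega> x * (\<kappa> / k x x * k x y)"
  have a: "(\<lambda>y. \<kappa> / k x x * k x y) \<in> krange P k" by (rule kernel_in_krange[OF k])
  have H': "rfun M P ?H'"
    using a by (intro rfun_step H x) (simp add: krange_def)
  have rV': "rfun M P (\<lambda>\<omega>. kop P k (?H' \<omega>))" by (rule rfun_kop(1)[OF k H'])
  have "ennreal (k x x) * mean_sq M P (\<lambda>\<omega>. kop P k (?H' \<omega>))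
      = (\<integral>\<^sup>+\<omega>. ennreal (k x x) * ennreal (ip P (kop P k (?H' \<omega>)) (kop P k (?H' \<omega>))) \<partial>M)"
    unfolding mean_sq_eq[OF rV']
    by (rule nn_integral_cmult[symmetric], rule measurable_compose[OF ip_self_measurable[OF rV'] measurable_ennreal])
  also have "\<dots> = (\<integral>\<^sup>+\<omega>. ennreal (q \<omega> x) \<partial>M)"
  proof (rule nn_integral_cong)
    fix \<omega> assume w: "\<omega> \<in> space M"
    show "ennreal (k x x) * ennreal (ip P (kop P k (?H' \<omega>)) (kop P k (?H' \<omega>))) = ennreal (q \<omega> x)"
      unfolding V'[OF w] id[OF w x(3), symmetric]
      by (rule ennreal_mult[symmetric]) (use x in auto)
  qed
  finally have "ennreal (k x x) * mean_sq M P (\<lambda>\<omega>. kop P k (?H' \<omega>)) \<le> ennreal (k x x) * ?B"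
    using le by (simp add: mult_ac)
  then have "mean_sq M P (\<lambda>\<omega>. kop P k (?H' \<omega>)) \<le> ?B"
    using x by (simp add: ennreal_mult_le_mult_iff)
  moreover have "reduces D (krange P k) (Suc 0) H ?H'"
    by (intro reduces_Suc reduces_0 x a)
  moreover have "mean_sq M P (\<lambda>\<omega> y. ?H' \<omega> y - kop P k (?H' \<omega>) y) = mean_sq M P ?G"
    unfolding mean_sq_def
  proof (rule nn_integral_cong)
    fix \<omega> assume w: "\<omega> \<in> space M"
    show "(\<integral>\<^sup>+y. ennreal ((?H' \<omega> y - kop P k (?H' \<omega>) y)\<^sup>2) \<partial>P) = (\<integral>\<^sup>+y. ennreal ((?G \<omega> y)\<^sup>2) \<partial>P)"
      unfolding V'[OF w] by simp
  qed
  ultimately show ?thesis by blast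
qed

lemma mean_sq_Pythagoras:
  assumes k: "proj_kernel P k t" and H: "rfun M P H"
  shows "mean_sq M P H = mean_sq M P (\<lambda>\<omega>. kop P k (H \<omega>)) + mean_sq M P (\<lambda>\<omega> y. H \<omega> y - kop P k (H \<omega>) y)"
proof -
  have V: "rfun M P (\<lambda>\<omega>. kop P k (H \<omega>))" by (rule rfun_kop(1)[OF k H])
  have G: "rfun M P (\<lambda>\<omega> y. H \<omega> y - kop P k (H \<omega>) y)" by (rule rfun_kop(2)[OF k H])
  have "mean_sq M P H = (\<integral>\<^sup>+\<omega>. ennreal (ip P (kop P k (H \<omega>)) (kop P k (H \<omega>)))
      + ennreal (ip P (\<lambda>y. H \<omega> y - kop P k (H \<omega>) y) (\<lambda>y. H \<omega> y - kop P k (H \<omega>) y)) \<partial>M)"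
    unfolding mean_sq_eq[OF H]
    by (rule nn_integral_cong) (subst kop_Pythagoras[OF k rfun_sqint[OF H]], auto)
  also have "\<dots> = mean_sq M P (\<lambda>\<omega>. kop P k (H \<omega>)) + mean_sq M P (\<lambda>\<omega> y. H \<omega> y - kop P k (H \<omega>) y)"
    unfolding mean_sq_eq[OF V] mean_sq_eq[OF G]
    by (rule nn_integral_add;
        rule measurable_compose[OF _ measurable_ennreal], rule ip_self_measurable[OF V] ip_self_measurable[OF G])
  finally show ?thesis .
qed

text \<open>In units of \<open>E\<close>, one step maps a bound \<open>a\<close> to
  \<open>(1 - \<kappa> / t) * a + \<kappa>\<^sup>2 / t\<close>. This map has the fixed point
  \<kappa>, and deviations from it contract by \<open>1 - \<kappa> / t\<close>; hence the shape of
  the bound.\<close>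

lemma Kaczmarz_iterate:
  assumes k: "proj_kernel P k t" and t: "t \<ge> 1" and H: "rfun M P H" and \<kappa>: "0 < \<kappa>" "\<kappa> \<le> 1"
    and c: "c \<ge> 0" "mean_sq M P (\<lambda>\<omega>. kop P k (H \<omega>)) \<le> ennreal c * E"
    and E: "E = mean_sq M P (\<lambda>\<omega> y. H \<omega> y - kop P k (H \<omega>) y)" "E < \<infinity>"
  shows "\<exists>H'. reduces D (krange P k) j H H' \<and>
    mean_sq M P (\<lambda>\<omega>. kop P k (H' \<omega>)) \<le> ennreal (\<kappa> + (1 - \<kappa> / t) ^ j * c) * E \<and>
    mean_sq M P (\<lambda>\<omega> y. H' \<omega> y - kop P k (H' \<omega>) y) = E"
proof (induction j)
  case 0
  have "ennreal c * E \<le> ennreal (\<kappa> + c) * E"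
    using \<kappa> by (intro mult_right_mono ennreal_leI) auto
  then show ?case using c E
    by (intro exI[of _ H]) (auto intro: reduces_0 order_trans)
next
  case (Suc j)
  then obtain H' where H': "reduces D (krange P k) j H H'"
    "mean_sq M P (\<lambda>\<omega>. kop P k (H' \<omega>)) \<le> ennreal (\<kappa> + (1 - \<kappa> / t) ^ j * c) * E"
    "mean_sq M P (\<lambda>\<omega> y. H' \<omega> y - kop P k (H' \<omega>) y) = E" by blast
  have r: "rfun M P H'"
    by (rule reduces_rfun[OF H'(1) _ H]) (simp add: krange_def)
  have "mean_sq M P (\<lambda>\<omega>. kop P k (H' \<omega>)) < \<infinity>"
    by (rule le_less_trans[OF H'(2)]) (use E(2) in \<open>simp add: ennreal_mult_less_top\<close>)
  from Kaczmarz_step[OF k t r \<kappa> this] E(2) H'(3) obtain H'' where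
    H'': "reduces D (krange P k) (Suc 0) H' H''"
    "mean_sq M P (\<lambda>\<omega>. kop P k (H'' \<omega>)) \<le> ennreal (1 - \<kappa> / t) * mean_sq M P (\<lambda>\<omega>. kop P k (H' \<omega>)) + ennreal (\<kappa>\<^sup>2 / t) * E"
    "mean_sq M P (\<lambda>\<omega> y. H'' \<omega> y - kop P k (H'' \<omega>) y) = E" by auto
  have kt: "\<kappa> / t \<le> 1" using \<kappa> t by simp
  have nn: "0 \<le> \<kappa> + (1 - \<kappa> / t) ^ j * c" using \<kappa> kt c by simp
  have "mean_sq M P (\<lambda>\<omega>. kop P k (H'' \<omega>)) \<le> ennreal (1 - \<kappa> / t) * (ennreal (\<kappa> + (1 - \<kappa> / t) ^ j * c) * E) + ennreal (\<kappa>\<^sup>2 / t) * E"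
    using H''(2) H'(2) by (meson add_right_mono mult_left_mono order_trans zero_le)
  also have "\<dots> = ennreal ((1 - \<kappa> / t) * (\<kappa> + (1 - \<kappa> / t) ^ j * c) + \<kappa>\<^sup>2 / t) * E"
    using kt nn t by (simp add: mult.assoc[symmetric] ennreal_mult[symmetric] distrib_right[symmetric] ennreal_plus[symmetric] del: ennreal_plus)
  also have "(1 - \<kappa> / t) * (\<kappa> + (1 - \<kappa> / t) ^ j * c) + \<kappa>\<^sup>2 / t = \<kappa> + (1 - \<kappa> / t) ^ Suc j * c"
    using t by (simp add: field_simps power2_eq_square)
  finally show ?case
    using reduces_trans[OF H''(1) H'(1)] H''(3) by (intro exI[of _ H'']) simp
qed

text \<open>Interpolation supplies the starting value \<open>real m + 1\<close> of the iteration.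
  Afterwards the component in the range costs at most \<open>2 * \<kappa>\<close> times the error
  outside: one \<kappa> is the fixed point of the recursion, the other is the decayed starting
  value, bounded by the assumption on \<open>j\<close>.\<close>

lemma sampling_reduction:
  assumes k: "proj_kernel P k (real m)" and m: "m \<ge> 1" and H: "rfun M P H" and \<kappa>: "0 < \<kappa>" "\<kappa> \<le> 1"
    and fin: "mean_sq M P (\<lambda>\<omega> y. H \<omega> y - kop P k (H \<omega>) y) < \<infinity>"
    and j: "(1 - \<kappa> / real m) ^ j * (real m + 1) \<le> \<kappa>"
  shows "\<exists>H'. reduces D (krange P k) (j + m) H H' \<and>
    mean_sq M P H' \<le> ennreal (1 + 2 * \<kappa>) * mean_sq M P (\<lambda>\<omega> y. H \<omega> y - kop P k (H \<omega>) y)"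
proof -
  define E where "E = mean_sq M P (\<lambda>\<omega> y. H \<omega> y - kop P k (H \<omega>) y)"
  obtain H1 where H1: "reduces D (krange P k) m H H1" "mean_sq M P H1 \<le> ennreal (real m + 1) * E"
    using stable_interpolation[OF k H fin] by (auto simp: E_def)
  have sq: "\<And>a. a \<in> krange P k \<Longrightarrow> sqint P a" by (simp add: krange_def)
  have r1: "rfun M P H1" by (rule reduces_rfun[OF H1(1) sq H])
  \<comment> \<open>All subtracted functions lie in the range of the original \<open>k\<close>, so
    the part outside that range never changes, although interpolation worked with ever smaller
    ranges.\<close>
  have inv: "\<omega> \<in> space M \<longrightarrow> (\<lambda>y. H1 \<omega> y - kop P k (H1 \<omega>) y) = (\<lambda>y. H \<omega> y - kop P k (H \<omega>) y)" for \<omega>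
    using H1(1) H
  proof (induction rule: reduces.induct)
    case (reduces_Suc n H H' x a)
    have "rfun M P H'" by (rule reduces_rfun[OF reduces_Suc.hyps(1) sq reduces_Suc.prems])
    moreover have "sqint P a" "kop P k a = a" using reduces_Suc.hyps(3) by (auto simp: krange_def)
    ultimately show ?case
      using reduces_Suc.IH[OF reduces_Suc.prems]
      by (auto simp: kop_diff[OF k] kop_cmult[OF k] rfun_sqint)
  qed simp
  have E1: "E = mean_sq M P (\<lambda>\<omega> y. H1 \<omega> y - kop P k (H1 \<omega>) y)"
    unfolding E_def mean_sq_def
  proof (rule nn_integral_cong)
    fix \<omega> assume "\<omega> \<in> space M"
    then have "\<And>y. H1 \<omega> y - kop P k (H1 \<omega>) y = H \<omega> y - kop P k (H \<omega>) y"
      using inv by (metis (lifting))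
    then show "(\<integral>\<^sup>+ x. ennreal ((H \<omega> x - kop P k (H \<omega>) x)\<^sup>2) \<partial>P) = (\<integral>\<^sup>+ x. ennreal ((H1 \<omega> x - kop P k (H1 \<omega>) x)\<^sup>2) \<partial>P)"
      by simp
  qed
  have "mean_sq M P (\<lambda>\<omega>. kop P k (H1 \<omega>)) \<le> ennreal (real m + 1) * E"
    using H1(2) unfolding mean_sq_Pythagoras[OF k r1] by (rule order_trans[rotated]) simp
  from Kaczmarz_iterate[OF k _ r1 \<kappa> _ this E1, of j] m fin obtain H2 where
    H2: "reduces D (krange P k) j H1 H2"
    "mean_sq M P (\<lambda>\<omega>. kop P k (H2 \<omega>)) \<le> ennreal (\<kappa> + (1 - \<kappa> / real m) ^ j * (real m + 1)) * E"
    "mean_sq M P (\<lambda>\<omega> y. H2 \<omega> y - kop P k (H2 \<omega>) y) = E"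
    unfolding E_def by auto
  have r2: "rfun M P H2" by (rule reduces_rfun[OF H2(1) sq r1])
  have "mean_sq M P H2 \<le> ennreal (2 * \<kappa>) * E + E"
    unfolding mean_sq_Pythagoras[OF k r2] H2(3)
    using H2(2) j by (intro add_right_mono) (erule order_trans, intro mult_right_mono ennreal_leI, auto)
  also have "\<dots> = ennreal (1 + 2 * \<kappa>) * E"
    using \<kappa> by (simp add: distrib_right add.commute)
  finally show ?thesis
    using reduces_trans[OF H2(1) H1(1)] by (auto simp: E_def add.commute)
qed

end

section \<open>Number of sample points\<close>

lemma contraction_power_le:
  fixes x c \<kappa> :: real
  assumes "0 \<le> x" "x \<le> 1" "c > 0" "\<kappa> > 0" "ln (c / \<kappa>) \<le> x * real j"
  shows "(1 - x) ^ j * c \<le> \<kappa>"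
proof -
  have "(1 - x) ^ j \<le> exp (- x) ^ j"
    using assms exp_ge_add_one_self[of "- x"] by (intro power_mono) auto
  also have "\<dots> = exp (- (x * real j))" by (simp add: exp_of_nat_mult[symmetric] mult.commute)
  also have "\<dots> \<le> exp (- ln (c / \<kappa>))" using assms by simp
  also have "\<dots> = \<kappa> / c" using assms by (simp add: exp_minus)
  finally show ?thesis using assms by (simp add: field_simps)
qed

text \<open>The contraction requirement is met by
  \<open>m' / \<kappa> * ln ((m' + 1) / \<kappa>)\<close> steps, rounded up. The logarithm is paid
  for by \<open>ln m \<le> m powr \<kappa> / \<kappa>\<close>, which produces a term with
  \<open>2 / \<kappa>\<^sup>2\<close>; the rounding and the \<open>m'\<close> interpolation points
  cost at most \<open>m powr (1 + \<kappa>)\<close> each. The dimension \<open>m'\<close> may lie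
  below the number \<open>m\<close> of functionals in which the count is expressed.\<close>

lemma sample_count:
  fixes \<kappa> :: real
  assumes \<kappa>: "0 < \<kappa>" "\<kappa> \<le> 1" and m: "1 \<le> m'" "m' \<le> m"
  shows "\<exists>j. (1 - \<kappa> / real m') ^ j * (real m' + 1) \<le> \<kappa> \<and>
    real (j + m') \<le> (2 + 3 / \<kappa>\<^sup>2) * real m powr (1 + \<kappa>)"
proof -
  define j where "j = nat \<lceil>real m' / \<kappa> * ln ((real m' + 1) / \<kappa>)\<rceil>"
  have m1: "real m' \<ge> 1" and mm: "real m' \<le> real m" using m by auto
  have lnn: "0 \<le> ln ((real m' + 1) / \<kappa>)" using \<kappa> m1 by (intro ln_ge_zero) (simp add: field_simps)
  then have pos: "0 \<le> real m' / \<kappa> * ln ((real m' + 1) / \<kappa>)" using \<kappa> by simp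
  have jge: "real m' / \<kappa> * ln ((real m' + 1) / \<kappa>) \<le> real j"
    unfolding j_def using real_nat_ceiling_ge by blast
  have jle: "real j \<le> real m' / \<kappa> * ln ((real m' + 1) / \<kappa>) + 1"
    unfolding j_def using pos by linarith
  have "ln ((real m' + 1) / \<kappa>) \<le> (\<kappa> / real m') * real j"
    using jge m1 \<kappa> by (simp add: field_simps)
  then have 1: "(1 - \<kappa> / real m') ^ j * (real m' + 1) \<le> \<kappa>"
    using \<kappa> m1 by (intro contraction_power_le) auto
  define p where "p = real m powr \<kappa>"
  have p1: "p \<ge> 1" unfolding p_def using m1 mm \<kappa> by (intro ge_one_powr_ge_zero) auto
  have "ln (real m') \<le> ln (real m)" using m1 mm by simp
  also have "\<dots> \<le> p / \<kappa>"
    unfolding p_def using ln_powr_bound[of "real m" \<kappa>] m1 mm \<kappa> by simp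
  finally have l1: "ln (real m') \<le> p / \<kappa>" .
  have "ln ((real m' + 1) / \<kappa>) \<le> ln (2 * real m' / \<kappa>)"
    using m1 \<kappa> by (simp add: field_simps)
  also have "\<dots> = ln 2 + ln (real m') + ln (1 / \<kappa>)"
    using m1 \<kappa> by (simp add: ln_mult ln_div)
  \<comment> \<open>The bounds 1 for \<open>ln 2\<close> and \<open>1 / \<kappa> - 1\<close> for
    \<open>ln (1 / \<kappa>)\<close> make the constants cancel.\<close>
  also have "\<dots> \<le> 1 + p / \<kappa> + (1 / \<kappa> - 1)"
    using l1 \<kappa> ln_le_minus_one[of "1 / \<kappa>"] ln_le_minus_one[of 2] by (intro add_mono) auto
  also have "\<dots> = (p + 1) / \<kappa>" by (simp add: add_divide_distrib)
  also have "\<dots> \<le> 2 * p / \<kappa>" using p1 \<kappa> by (intro divide_right_mono) auto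
  finally have "real m' / \<kappa> * ln ((real m' + 1) / \<kappa>) \<le> real m / \<kappa> * (2 * p / \<kappa>)"
    using lnn mm \<kappa> by (intro mult_mono divide_right_mono) auto
  then have "real (j + m') \<le> 2 / \<kappa>\<^sup>2 * (real m * p) + 1 + real m"
    using jle mm by (simp add: power2_eq_square ac_simps)
  also have "\<dots> \<le> 2 / \<kappa>\<^sup>2 * (real m * p) + real m * p + real m * p"
  proof -
    have "real m \<le> real m * p"
      using mult_left_mono[OF p1, of "real m"] by simp
    moreover from this have "1 \<le> real m * p" using m1 mm by linarith
    ultimately show ?thesis by linarith
  qed
  also have "\<dots> \<le> (2 + 3 / \<kappa>\<^sup>2) * (real m * p)"
    using p1 m1 mm \<kappa> by (simp add: distrib_right divide_right_mono mult_right_mono)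
  also have "real m * p = real m powr (1 + \<kappa>)"
    using m1 mm by (simp add: p_def powr_add)
  finally show ?thesis using 1 by blast
qed

section \<open>Uniqueness of trigonometric transforms\<close>

text \<open>Separates real and imaginary part, so that all later transforms are real
  integrals.\<close>

lemma (in real_distribution) char_cos_sin:
  "char M t = complex_of_real (\<integral>x. cos (t * x) \<partial>M) + \<i> * complex_of_real (\<integral>x. sin (t * x) \<partial>M)"
proof -
  have i: "integrable M (\<lambda>x. complex_of_real (cos (t * x)))" "integrable M (\<lambda>x. \<i> * complex_of_real (sin (t * x)))"
    by (auto intro!: integrable_const_bound[of _ 1] simp: norm_mult)
  have "char M t = (\<integral>x. complex_of_real (cos (t * x)) + \<i> * complex_of_real (sin (t * x)) \<partial>M)"
    unfolding char_def by (intro Bochner_Integration.integral_cong) (auto simp: complex_eq_iff Re_exp Im_exp)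
  also have "\<dots> = complex_of_real (\<integral>x. cos (t * x) \<partial>M) + \<i> * complex_of_real (\<integral>x. sin (t * x) \<partial>M)"
    using i by simp
  finally show ?thesis .
qed

text \<open>The positive and negative part of \<open>V\<close> have equal mass \<open>I\<close>, by
  the cosine condition at \<open>t = 0\<close>. If \<open>I\<close> is positive, both are normalised
  and pushed forward along \<open>Y\<close>; the resulting probability measures have the same
  characteristic function and coincide by Levy's theorem. If \<open>I\<close> is 0, then
  \<open>V\<close> vanishes almost everywhere.\<close>

lemma trig_transform_unique_real:
  fixes V Y :: "'a \<Rightarrow> real"
  assumes V: "integrable M V" and Y[measurable]: "Y \<in> borel_measurable M"
    and c: "\<And>t. (\<integral>\<omega>. V \<omega> * cos (t * Y \<omega>) \<partial>M) = 0" and s: "\<And>t. (\<integral>\<omega>. V \<omega> * sin (t * Y \<omega>) \<partial>M) = 0"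
    and B[measurable]: "B \<in> sets borel"
  shows "(\<integral>\<omega>. V \<omega> * indicator B (Y \<omega>) \<partial>M) = 0"
proof -
  have [measurable]: "V \<in> borel_measurable M" using V by simp
  define p where "p = (\<lambda>\<omega>. max 0 (V \<omega>))"
  define n where "n = (\<lambda>\<omega>. max 0 (- V \<omega>))"
  have pn: "V \<omega> = p \<omega> - n \<omega>" and pos: "0 \<le> p \<omega>" "0 \<le> n \<omega>" for \<omega>
    by (auto simp: p_def n_def)
  have pm[measurable]: "p \<in> borel_measurable M" and nm[measurable]: "n \<in> borel_measurable M"
    unfolding p_def n_def by measurable
  have ip: "integrable M p" and "in": "integrable M n"
    unfolding p_def n_def using V by auto
  have bnd: "integrable M (\<lambda>\<omega>. q \<omega> * h \<omega>)"
    if "integrable M q" "h \<in> borel_measurable M" "\<And>\<omega>. \<bar>h \<omega>\<bar> \<le> 1" for q h :: "'a \<Rightarrow> real"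
  proof (rule Bochner_Integration.integrable_bound[OF that(1)])
    show "(\<lambda>\<omega>. q \<omega> * h \<omega>) \<in> borel_measurable M" using that by measurable
    show "AE \<omega> in M. norm (q \<omega> * h \<omega>) \<le> norm (q \<omega>)"
      using that(3) by (auto simp: abs_mult intro!: mult_left_le)
  qed
  have split: "(\<integral>\<omega>. p \<omega> * h \<omega> \<partial>M) - (\<integral>\<omega>. n \<omega> * h \<omega> \<partial>M) = (\<integral>\<omega>. V \<omega> * h \<omega> \<partial>M)"
    if "h \<in> borel_measurable M" "\<And>\<omega>. \<bar>h \<omega>\<bar> \<le> 1" for h
    using bnd[OF ip that] bnd[OF "in" that] by (simp add: pn left_diff_distrib)
  define I where "I = (\<integral>\<omega>. p \<omega> \<partial>M)"
  have I: "I = (\<integral>\<omega>. n \<omega> \<partial>M)"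
    using c[of 0] split[of "\<lambda>_. 1"] by (simp add: I_def)
  have I0: "0 \<le> I" unfolding I_def using pos by (intro integral_nonneg_AE) auto
  define \<nu> where "\<nu> = (\<lambda>q. distr (density M (\<lambda>\<omega>. ennreal (q \<omega> / I))) borel Y)"
  show ?thesis
  proof (cases "I = 0")
    case True
    have "AE \<omega> in M. p \<omega> = 0" "AE \<omega> in M. n \<omega> = 0"
      using integral_nonneg_eq_0_iff_AE[OF ip] integral_nonneg_eq_0_iff_AE[OF "in"] True I pos
      by (auto simp: I_def)
    then have "AE \<omega> in M. V \<omega> * indicator B (Y \<omega>) = 0"
      by eventually_elim (simp add: pn)
    then show ?thesis by (rule integral_eq_zero_AE)
  next
    case False
    then have I0: "I > 0" using I0 by simp
    have rd: "real_distribution (\<nu> q)" and ch: "\<And>h. h \<in> borel_measurable borel \<Longrightarrow>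
        (\<integral>y. h y \<partial>\<nu> q) = (\<integral>\<omega>. q \<omega> * h (Y \<omega>) \<partial>M) / I"
      and char: "\<And>t. char (\<nu> q) t = complex_of_real ((\<integral>\<omega>. q \<omega> * cos (t * Y \<omega>) \<partial>M) / I)
        + \<i> * complex_of_real ((\<integral>\<omega>. q \<omega> * sin (t * Y \<omega>) \<partial>M) / I)"
      if q: "integrable M q" "\<And>\<omega>. 0 \<le> q \<omega>" "(\<integral>\<omega>. q \<omega> \<partial>M) = I" for q :: "'a \<Rightarrow> real"
    proof -
      have [measurable]: "q \<in> borel_measurable M" using q by simp
      have "(\<integral>\<^sup>+\<omega>. ennreal (q \<omega> / I) \<partial>M) = ennreal (\<integral>\<omega>. q \<omega> / I \<partial>M)"
        using q I0 by (intro nn_integral_eq_integral) auto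
      also have "\<dots> = 1" using q I0 by simp
      finally have one: "(\<integral>\<^sup>+\<omega>. ennreal (q \<omega> / I) \<partial>M) = 1" .
      have ps: "prob_space (density M (\<lambda>\<omega>. ennreal (q \<omega> / I)))"
        by (rule prob_spaceI) (simp add: emeasure_density one cong: nn_integral_cong)
      have "prob_space (\<nu> q)"
        unfolding \<nu>_def by (rule prob_space.prob_space_distr[OF ps]) simp
      then show rd: "real_distribution (\<nu> q)"
        by (simp add: real_distribution_def real_distribution_axioms_def \<nu>_def)
      show 1: "(\<integral>y. h y \<partial>\<nu> q) = (\<integral>\<omega>. q \<omega> * h (Y \<omega>) \<partial>M) / I"
        if [measurable]: "h \<in> borel_measurable borel" for h :: "real \<Rightarrow> real"
      proof -
        have "(\<integral>y. h y \<partial>\<nu> q) = (\<integral>\<omega>. h (Y \<omega>) \<partial>density M (\<lambda>\<omega>. ennreal (q \<omega> / I)))"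
          unfolding \<nu>_def by (rule integral_distr) simp_all
        also have "\<dots> = (\<integral>\<omega>. (q \<omega> / I) *\<^sub>R h (Y \<omega>) \<partial>M)"
          using q I0 by (intro integral_density) auto
        finally show ?thesis by simp
      qed
      show "char (\<nu> q) t = complex_of_real ((\<integral>\<omega>. q \<omega> * cos (t * Y \<omega>) \<partial>M) / I)
        + \<i> * complex_of_real ((\<integral>\<omega>. q \<omega> * sin (t * Y \<omega>) \<partial>M) / I)" for t
        unfolding real_distribution.char_cos_sin[OF rd] by (simp add: 1)
    qed
    have "char (\<nu> p) = char (\<nu> n)"
    proof
      fix t
      have "(\<integral>\<omega>. p \<omega> * cos (t * Y \<omega>) \<partial>M) = (\<integral>\<omega>. n \<omega> * cos (t * Y \<omega>) \<partial>M)"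
        "(\<integral>\<omega>. p \<omega> * sin (t * Y \<omega>) \<partial>M) = (\<integral>\<omega>. n \<omega> * sin (t * Y \<omega>) \<partial>M)"
        using split[of "\<lambda>\<omega>. cos (t * Y \<omega>)"] split[of "\<lambda>\<omega>. sin (t * Y \<omega>)"] c[of t] s[of t] by auto
      then show "char (\<nu> p) t = char (\<nu> n) t"
        using char[OF ip pos(1) I_def[symmetric]] char[OF "in" pos(2) I[symmetric]] by simp
    qed
    then have "\<nu> p = \<nu> n"
      using rd[OF ip pos(1) I_def[symmetric]] rd[OF "in" pos(2) I[symmetric]] by (intro Levy_uniqueness)
    then have "(\<integral>\<omega>. p \<omega> * indicator B (Y \<omega>) \<partial>M) / I = (\<integral>\<omega>. n \<omega> * indicator B (Y \<omega>) \<partial>M) / I"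
      using ch[OF ip pos(1) I_def[symmetric], of "indicator B"] ch[OF "in" pos(2) I[symmetric], of "indicator B"] by simp
    then have "(\<integral>\<omega>. p \<omega> * indicator B (Y \<omega>) \<partial>M) = (\<integral>\<omega>. n \<omega> * indicator B (Y \<omega>) \<partial>M)"
      using I0 by simp
    then show ?thesis
      using split[of "\<lambda>\<omega>. indicator B (Y \<omega>)"] by (auto simp: indicator_def)
  qed
qed

text \<open>Reduction to one variable by induction: with the first \<open>n\<close> frequencies
  fixed, the weights \<open>W * cos\<close> and \<open>W * sin\<close> satisfy the one-dimensional
  hypotheses for \<open>Y n\<close>, so a cosine or sine in \<open>Y n\<close> may be replaced by an
  indicator.\<close>

lemma trig_transform_unique_rectangle:
  fixes W :: "'a \<Rightarrow> real" and Y :: "nat \<Rightarrow> 'a \<Rightarrow> real"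
  assumes "integrable M W" "\<And>i. i < n \<Longrightarrow> Y i \<in> borel_measurable M"
    and "\<And>s. (\<integral>\<omega>. W \<omega> * cos (\<Sum>i<n. s i * Y i \<omega>) \<partial>M) = 0"
    and "\<And>s. (\<integral>\<omega>. W \<omega> * sin (\<Sum>i<n. s i * Y i \<omega>) \<partial>M) = 0"
    and "\<And>i. i < n \<Longrightarrow> B i \<in> sets borel"
  shows "(\<integral>\<omega>. W \<omega> * (\<Prod>i<n. indicator (B i) (Y i \<omega>)) \<partial>M) = 0"
  using assms
proof (induction n arbitrary: W)
  case 0
  show ?case using 0(3) by simp
next
  case (Suc n)
  have [measurable]: "W \<in> borel_measurable M" and Y[measurable]: "\<And>i. i < Suc n \<Longrightarrow> Y i \<in> borel_measurable M"
    using Suc.prems by auto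
  have Yn[measurable]: "Y n \<in> borel_measurable M" by simp
  have Bn[measurable]: "B n \<in> sets borel" using Suc.prems(5) by simp
  have sm[measurable]: "(\<lambda>\<omega>. \<Sum>i<n. s i * Y i \<omega>) \<in> borel_measurable M" for s
    using Y by (intro borel_measurable_sum borel_measurable_times) auto
  have bnd: "integrable M (\<lambda>\<omega>. W \<omega> * h \<omega>)"
    if "h \<in> borel_measurable M" "\<And>\<omega>. \<bar>h \<omega>\<bar> \<le> 1" for h
  proof (rule Bochner_Integration.integrable_bound[OF Suc.prems(1)])
    show "(\<lambda>\<omega>. W \<omega> * h \<omega>) \<in> borel_measurable M" using that by measurable
    show "AE \<omega> in M. norm (W \<omega> * h \<omega>) \<le> norm (W \<omega>)"
      using that(2) by (auto simp: abs_mult intro!: mult_left_le)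
  qed
  have ext: "(\<Sum>i<Suc n. (if i = n then t else s i) * Y i \<omega>) = (\<Sum>i<n. s i * Y i \<omega>) + t * Y n \<omega>" for s t \<omega>
    by simp
  have C: "(\<integral>\<omega>. W \<omega> * cos ((\<Sum>i<n. s i * Y i \<omega>) + t * Y n \<omega>) \<partial>M) = 0"
    and S: "(\<integral>\<omega>. W \<omega> * sin ((\<Sum>i<n. s i * Y i \<omega>) + t * Y n \<omega>) \<partial>M) = 0" for s t
    using Suc.prems(3)[of "\<lambda>i. if i = n then t else s i"] Suc.prems(4)[of "\<lambda>i. if i = n then t else s i"]
    unfolding ext by blast+
  have lin: "(\<integral>\<omega>. W \<omega> * (a * h \<omega> + b * g \<omega>) \<partial>M) = a * (\<integral>\<omega>. W \<omega> * h \<omega> \<partial>M) + b * (\<integral>\<omega>. W \<omega> * g \<omega> \<partial>M)"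
    if "h \<in> borel_measurable M" "\<And>\<omega>. \<bar>h \<omega>\<bar> \<le> 1" "g \<in> borel_measurable M" "\<And>\<omega>. \<bar>g \<omega>\<bar> \<le> 1" for h g a b
  proof -
    have "(\<integral>\<omega>. W \<omega> * (a * h \<omega> + b * g \<omega>) \<partial>M) = (\<integral>\<omega>. a * (W \<omega> * h \<omega>) + b * (W \<omega> * g \<omega>) \<partial>M)"
      by (simp add: distrib_left ac_simps)
    also have "\<dots> = a * (\<integral>\<omega>. W \<omega> * h \<omega> \<partial>M) + b * (\<integral>\<omega>. W \<omega> * g \<omega> \<partial>M)"
      using bnd that by (subst Bochner_Integration.integral_add) auto
    finally show ?thesis .
  qed
  let ?a = "\<lambda>s \<omega>. \<Sum>i<n. s i * Y i \<omega>"
  have cc: "cos x * cos y = (1/2) * cos (x + (-y)) + (1/2) * cos (x + y)"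
    and cs: "cos x * sin y = (1/2) * sin (x + y) + (-1/2) * sin (x + (-y))"
    and sc: "sin x * cos y = (1/2) * sin (x + y) + (1/2) * sin (x + (-y))"
    and ss: "sin x * sin y = (1/2) * cos (x + (-y)) + (-1/2) * cos (x + y)" for x y :: real
    by (simp_all add: cos_add sin_add cos_diff sin_diff field_simps)
  \<comment> \<open>Product formulas reduce the mixed transforms to the given ones with last
    frequency \<open>t\<close> and \<open>- t\<close>.\<close>
  have CC: "(\<integral>\<omega>. W \<omega> * (cos (?a s \<omega>) * cos (t * Y n \<omega>)) \<partial>M) = 0"
    and CS: "(\<integral>\<omega>. W \<omega> * (cos (?a s \<omega>) * sin (t * Y n \<omega>)) \<partial>M) = 0"
    and SC: "(\<integral>\<omega>. W \<omega> * (sin (?a s \<omega>) * cos (t * Y n \<omega>)) \<partial>M) = 0"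
    and SS: "(\<integral>\<omega>. W \<omega> * (sin (?a s \<omega>) * sin (t * Y n \<omega>)) \<partial>M) = 0" for s t
    unfolding cc cs sc ss
    by (subst lin; simp add: C[of s t] S[of s t] C[of s "- t", simplified] S[of s "- t", simplified])+
  have cI: "(\<integral>\<omega>. W \<omega> * indicator (B n) (Y n \<omega>) * cos (?a s \<omega>) \<partial>M) = 0" for s
  proof -
    have "(\<integral>\<omega>. (W \<omega> * cos (?a s \<omega>)) * indicator (B n) (Y n \<omega>) \<partial>M) = 0"
      by (rule trig_transform_unique_real) (use bnd CC CS in \<open>simp_all add: mult.assoc\<close>)
    then show ?thesis by (simp add: ac_simps)
  qed
  have sI: "(\<integral>\<omega>. W \<omega> * indicator (B n) (Y n \<omega>) * sin (?a s \<omega>) \<partial>M) = 0" for s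
  proof -
    have "(\<integral>\<omega>. (W \<omega> * sin (?a s \<omega>)) * indicator (B n) (Y n \<omega>) \<partial>M) = 0"
      by (rule trig_transform_unique_real) (use bnd SC SS in \<open>simp_all add: mult.assoc\<close>)
    then show ?thesis by (simp add: ac_simps)
  qed
  \<comment> \<open>The indicator of the last variable joins the weight, to which the induction
    hypothesis applies.\<close>
  have "(\<integral>\<omega>. (W \<omega> * indicator (B n) (Y n \<omega>)) * (\<Prod>i<n. indicator (B i) (Y i \<omega>)) \<partial>M) = 0"
  proof (rule Suc.IH)
    show "integrable M (\<lambda>\<omega>. W \<omega> * indicator (B n) (Y n \<omega>))"
      by (rule bnd) (auto simp: indicator_def)
  qed (use Suc.prems cI sI in auto)
  then show ?case by (simp add: ac_simps)
qed

text \<open>Rectangles determine a finite measure on the product space, so the positive and the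
  negative part of \<open>W\<close> have the same image under the data map. Integrating
  \<open>h\<close> against both images gives the claim for unbounded \<open>h\<close> too, as long
  as \<open>W * h\<close> is integrable.\<close>

lemma trig_transform_unique:
  fixes W :: "'a \<Rightarrow> real" and Y :: "nat \<Rightarrow> 'a \<Rightarrow> real"
  assumes W: "integrable M W" and Y: "\<And>i. i < n \<Longrightarrow> Y i \<in> borel_measurable M"
    and c: "\<And>s. (\<integral>\<omega>. W \<omega> * cos (\<Sum>i<n. s i * Y i \<omega>) \<partial>M) = 0"
    and s: "\<And>s. (\<integral>\<omega>. W \<omega> * sin (\<Sum>i<n. s i * Y i \<omega>) \<partial>M) = 0"
    and h[measurable]: "h \<in> borel_measurable (PiM {..<n} (\<lambda>_. borel))"
    and Wh: "integrable M (\<lambda>\<omega>. W \<omega> * h (\<lambda>i\<in>{..<n}. Y i \<omega>))"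
  shows "(\<integral>\<omega>. W \<omega> * h (\<lambda>i\<in>{..<n}. Y i \<omega>) \<partial>M) = 0"
proof -
  let ?Y = "\<lambda>\<omega>. \<lambda>i\<in>{..<n}. Y i \<omega>"
  let ?N = "PiM {..<n} (\<lambda>_. borel :: real measure)"
  have Ym[measurable]: "?Y \<in> measurable M ?N"
    by (rule measurable_restrict) (use Y in auto)
  have [measurable]: "W \<in> borel_measurable M" using W by simp
  define p where "p = (\<lambda>\<omega>. max 0 (W \<omega>))"
  define q where "q = (\<lambda>\<omega>. max 0 (- W \<omega>))"
  have pq: "W \<omega> = p \<omega> - q \<omega>" and pos: "0 \<le> p \<omega>" "0 \<le> q \<omega>" for \<omega>
    by (auto simp: p_def q_def)
  have pm[measurable]: "p \<in> borel_measurable M" and qm[measurable]: "q \<in> borel_measurable M"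
    unfolding p_def q_def by measurable
  have ip: "integrable M p" and iq: "integrable M q"
    unfolding p_def q_def using W by auto
  have iph: "integrable M (\<lambda>\<omega>. p \<omega> * h (?Y \<omega>))" "integrable M (\<lambda>\<omega>. q \<omega> * h (?Y \<omega>))"
    by (rule Bochner_Integration.integrable_bound[OF Wh]; auto simp: p_def q_def abs_mult intro!: mult_right_mono)+
  define \<nu> where "\<nu> = (\<lambda>r. distr (density M (\<lambda>\<omega>. ennreal (r \<omega>))) ?N ?Y)"
  have em: "emeasure (\<nu> r) (PiE {..<n} B) = ennreal (\<integral>\<omega>. r \<omega> * (\<Prod>i<n. indicator (B i) (Y i \<omega>)) \<partial>M)"
    if r: "integrable M r" "\<And>\<omega>. 0 \<le> r \<omega>" and B: "\<And>i. i < n \<Longrightarrow> B i \<in> sets borel" for r :: "'a \<Rightarrow> real" and B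
  proof -
    have [measurable]: "r \<in> borel_measurable M" using r by simp
    have Bm[measurable]: "PiE {..<n} B \<in> sets ?N" using B by (intro sets_PiM_I_finite) auto
    have "emeasure (\<nu> r) (PiE {..<n} B) = (\<integral>\<^sup>+\<omega>. ennreal (r \<omega>) * indicator (?Y -` PiE {..<n} B \<inter> space M) \<omega> \<partial>M)"
      unfolding \<nu>_def by (subst emeasure_distr) (auto simp: emeasure_density)
    also have "\<dots> = (\<integral>\<^sup>+\<omega>. ennreal (r \<omega> * (\<Prod>i<n. indicator (B i) (Y i \<omega>))) \<partial>M)"
    proof (rule nn_integral_cong)
      fix \<omega> assume "\<omega> \<in> space M"
      moreover have "(\<Prod>i<n. indicator (B i) (Y i \<omega>)) = (if \<forall>i<n. Y i \<omega> \<in> B i then 1 else 0 :: real)"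
        by (auto simp: indicator_def)
      ultimately show "ennreal (r \<omega>) * indicator (?Y -` PiE {..<n} B \<inter> space M) \<omega> = ennreal (r \<omega> * (\<Prod>i<n. indicator (B i) (Y i \<omega>)))"
        by (auto simp: indicator_def PiE_def Pi_def)
    qed
    also have "\<dots> = ennreal (\<integral>\<omega>. r \<omega> * (\<Prod>i<n. indicator (B i) (Y i \<omega>)) \<partial>M)"
    proof (rule nn_integral_eq_integral)
      have "(\<lambda>\<omega>. \<Prod>i<n. indicator (B i) (Y i \<omega>) :: real) \<in> borel_measurable M"
        using Y B by (intro borel_measurable_prod) (auto intro: measurable_compose[of "Y _" M borel])
      then show "integrable M (\<lambda>\<omega>. r \<omega> * (\<Prod>i<n. indicator (B i) (Y i \<omega>)))"
        by (intro Bochner_Integration.integrable_bound[OF r(1)])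
          (auto simp: abs_mult abs_prod intro!: AE_I2 mult_left_le prod_le_1)
    qed (use r in \<open>auto intro!: AE_I2 mult_nonneg_nonneg prod_nonneg\<close>)
    finally show ?thesis .
  qed
  have "\<nu> p = \<nu> q"
  \<comment> \<open>Both measures are finite, so the constant sequence consisting of the whole space
    serves as exhaustion.\<close>
  proof (rule measure_eqI_PiM_finite[where I = "{..<n}" and M = "\<lambda>_. borel" and A = "\<lambda>_. space ?N"])
    fix B :: "nat \<Rightarrow> real set" assume B: "\<And>i. i \<in> {..<n} \<Longrightarrow> B i \<in> sets borel"
    have *: "integrable M (\<lambda>\<omega>. r \<omega> * (\<Prod>i<n. indicator (B i) (Y i \<omega>)))"
      if r: "integrable M r" for r :: "'a \<Rightarrow> real"
    proof -
      have "(\<lambda>\<omega>. \<Prod>i<n. indicator (B i) (Y i \<omega>) :: real) \<in> borel_measurable M"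
        using Y B by (intro borel_measurable_prod) (auto intro: measurable_compose[of "Y _" M borel])
      then show ?thesis
        by (intro Bochner_Integration.integrable_bound[OF r(1)])
          (use r in \<open>auto simp: abs_mult abs_prod intro!: AE_I2 mult_left_le prod_le_1\<close>)
    qed
    have "(\<integral>\<omega>. W \<omega> * (\<Prod>i<n. indicator (B i) (Y i \<omega>)) \<partial>M) = 0"
      using B by (intro trig_transform_unique_rectangle[OF W Y c s]) auto
    then have "(\<integral>\<omega>. p \<omega> * (\<Prod>i<n. indicator (B i) (Y i \<omega>)) \<partial>M) = (\<integral>\<omega>. q \<omega> * (\<Prod>i<n. indicator (B i) (Y i \<omega>)) \<partial>M)"
      using *[OF ip] *[OF iq] by (simp add: pq left_diff_distrib)
    then show "emeasure (\<nu> p) (PiE {..<n} B) = emeasure (\<nu> q) (PiE {..<n} B)"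
      using B by (subst (1 2) em) (auto simp: ip iq pos)
  next
    have sp: "space ?N = PiE {..<n} (\<lambda>_. UNIV)" by (simp add: space_PiM)
    show "range (\<lambda>_::nat. space ?N) \<subseteq> prod_algebra {..<n} (\<lambda>_. borel)"
      unfolding sp by (auto intro!: prod_algebraI_finite)
    show "emeasure (\<nu> p) (space ?N) \<noteq> \<infinity>"
      unfolding sp by (subst em) (auto simp: ip pos)
  qed (auto simp: \<nu>_def)
  then have "(\<integral>y. h y \<partial>\<nu> p) = (\<integral>y. h y \<partial>\<nu> q)" by simp
  moreover have "(\<integral>y. h y \<partial>\<nu> r) = (\<integral>\<omega>. r \<omega> * h (?Y \<omega>) \<partial>M)"
    if "r \<in> borel_measurable M" "\<And>\<omega>. 0 \<le> r \<omega>" for r :: "'a \<Rightarrow> real"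
    unfolding \<nu>_def using that by (subst integral_distr) (auto simp: integral_density)
  ultimately have "(\<integral>\<omega>. p \<omega> * h (?Y \<omega>) \<partial>M) = (\<integral>\<omega>. q \<omega> * h (?Y \<omega>) \<partial>M)"
    using pos by simp
  then show ?thesis
    using iph by (simp add: pq left_diff_distrib)
qed

section \<open>The Gaussian setting\<close>

lemma space_borel_of: "space (borel_of S N) = S"
  and sets_borel_of: "sets (borel_of S N) = sigma_sets S {U. nopen S N U}"
proof -
  have "{U. nopen S N U} \<subseteq> Pow S" by (auto simp: nopen_def)
  then show "space (borel_of S N) = S" "sets (borel_of S N) = sigma_sets S {U. nopen S N U}"
    by (simp_all add: borel_of_def)
qed

lemma nopen_in_sets: "nopen S N U \<Longrightarrow> U \<in> sets (borel_of S N)"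
  unfolding sets_borel_of by (rule sigma_sets.Basic) simp

lemma measurable_borel_of_continuous:
  fixes L :: "fn \<Rightarrow> real"
  assumes "\<And>f e. f \<in> S \<Longrightarrow> e > 0 \<Longrightarrow> \<exists>r>0. \<forall>g\<in>S. N (\<lambda>x. g x - f x) < r \<longrightarrow> \<bar>L g - L f\<bar> < e"
  shows "L \<in> borel_measurable (borel_of S N)"
proof (rule borel_measurableI)
  fix T :: "real set" assume T: "open T"
  have "nopen S N (L -` T \<inter> S)"
    unfolding nopen_def
  proof (intro conjI ballI)
    fix f assume f: "f \<in> L -` T \<inter> S"
    then obtain e where e: "e > 0" "\<And>y. dist y (L f) < e \<Longrightarrow> y \<in> T"
      using T by (auto simp: open_dist)
    from assms[OF _ e(1)] f obtain r where "r > 0" "\<forall>g\<in>S. N (\<lambda>x. g x - f x) < r \<longrightarrow> \<bar>L g - L f\<bar> < e"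
      by auto
    then show "\<exists>r>0. \<forall>g\<in>S. N (\<lambda>x. g x - f x) < r \<longrightarrow> g \<in> L -` T \<inter> S"
      using e(2) by (auto simp: dist_real_def)
  qed auto
  then show "L -` T \<inter> space (borel_of S N) \<in> sets (borel_of S N)"
    unfolding space_borel_of by (rule nopen_in_sets)
qed

lemma bounded_linear_continuous:
  fixes L :: "fn \<Rightarrow> real"
  assumes lin: "\<And>f g. f \<in> S \<Longrightarrow> g \<in> S \<Longrightarrow> L g - L f = L (\<lambda>x. g x - f x)"
    and sub: "\<And>f g. f \<in> S \<Longrightarrow> g \<in> S \<Longrightarrow> (\<lambda>x. g x - f x) \<in> S"
    and bnd: "\<And>f. f \<in> S \<Longrightarrow> \<bar>L f\<bar> \<le> c * N f" and N: "\<And>f. f \<in> S \<Longrightarrow> 0 \<le> N f"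
  shows "L \<in> borel_measurable (borel_of S N)"
proof (rule measurable_borel_of_continuous)
  fix f and e :: real assume f: "f \<in> S" and e: "e > 0"
  \<comment> \<open>The given bound \<open>c\<close> may be zero or negative; \<open>C\<close> is a
    positive bound to divide by.\<close>
  define C where "C = \<bar>c\<bar> + 1"
  have C: "C > 0" by (simp add: C_def)
  have "\<bar>L g - L f\<bar> < e" if g: "g \<in> S" and r: "N (\<lambda>x. g x - f x) < e / C" for g
  proof -
    let ?h = "\<lambda>x. g x - f x"
    have h: "?h \<in> S" by (rule sub[OF f g])
    have "\<bar>L g - L f\<bar> \<le> c * N ?h" using lin[OF f g] bnd[OF h] by simp
    also have "\<dots> \<le> C * N ?h" unfolding C_def using N[OF h] by (intro mult_right_mono) auto
    also have "\<dots> < e" using r C by (simp add: field_simps)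
    finally show ?thesis .
  qed
  then show "\<exists>r>0. \<forall>g\<in>S. N (\<lambda>x. g x - f x) < r \<longrightarrow> \<bar>L g - L f\<bar> < e"
    using e C by (intro exI[of _ "e / C"]) auto
qed

text \<open>Fourth moments serve the integrability of the squared norm, the trigonometric means the
  orthogonality to functions of the data. Frequency 1 is enough because multiples of a functional
  are functionals too. The degenerate law at 0 is treated separately, as it has no density.\<close>

lemma (in prob_space) centered_normal:
  fixes X :: "'a \<Rightarrow> real"
  assumes X[measurable]: "X \<in> borel_measurable M" and \<sigma>: "\<sigma> \<ge> 0"
    and d: "distr M borel X = (if \<sigma> = 0 then return borel 0 else density lborel (normal_density 0 \<sigma>))"
  shows "sqint M X" "ip M X X = \<sigma>\<^sup>2" "sqint M (\<lambda>\<omega>. (X \<omega>)\<^sup>2)"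
    "ip M (\<lambda>\<omega>. (X \<omega>)\<^sup>2) (\<lambda>\<omega>. (X \<omega>)\<^sup>2) = 3 * (\<sigma>\<^sup>2)\<^sup>2"
    "(\<integral>\<omega>. cos (X \<omega>) \<partial>M) = exp (- \<sigma>\<^sup>2 / 2)" "(\<integral>\<omega>. sin (X \<omega>) \<partial>M) = 0"
proof -
  have "sqint M X \<and> ip M X X = \<sigma>\<^sup>2 \<and> sqint M (\<lambda>\<omega>. (X \<omega>)\<^sup>2) \<and>
    ip M (\<lambda>\<omega>. (X \<omega>)\<^sup>2) (\<lambda>\<omega>. (X \<omega>)\<^sup>2) = 3 * (\<sigma>\<^sup>2)\<^sup>2 \<and>
    (\<integral>\<omega>. cos (X \<omega>) \<partial>M) = exp (- \<sigma>\<^sup>2 / 2) \<and> (\<integral>\<omega>. sin (X \<omega>) \<partial>M) = 0"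
  proof (cases "\<sigma> = 0")
    case True
    then have d0: "distr M borel X = return borel 0" using d by simp
    have "AE y in distr M borel X. y = 0" unfolding d0 by (subst AE_return) auto
    then have ae: "AE \<omega> in M. X \<omega> = 0" by (subst (asm) AE_distr_iff) auto
    have "integrable M (\<lambda>\<omega>. (X \<omega>)\<^sup>2) \<longleftrightarrow> integrable M (\<lambda>\<omega>. 0 :: real)"
      by (rule integrable_cong_AE) (use ae in auto)
    moreover have "integrable M (\<lambda>\<omega>. ((X \<omega>)\<^sup>2)\<^sup>2) \<longleftrightarrow> integrable M (\<lambda>\<omega>. 0 :: real)"
      by (rule integrable_cong_AE) (use ae in auto)
    moreover have "(\<integral>\<omega>. X \<omega> * X \<omega> \<partial>M) = 0"
      by (rule integral_eq_zero_AE) (use ae in auto)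
    moreover have "(\<integral>\<omega>. (X \<omega>)\<^sup>2 * (X \<omega>)\<^sup>2 \<partial>M) = 0"
      by (rule integral_eq_zero_AE) (use ae in auto)
    moreover have "(\<integral>\<omega>. sin (X \<omega>) \<partial>M) = 0"
      by (rule integral_eq_zero_AE) (use ae in auto)
    moreover have "(\<integral>\<omega>. cos (X \<omega>) \<partial>M) = (\<integral>\<omega>. 1 \<partial>M)"
      by (rule integral_cong_AE) (use ae in auto)
    ultimately show ?thesis using True by (simp add: sqint_def ip_def prob_space)
  next
    case False
    then have s: "\<sigma> > 0" using \<sigma> by simp
    have d: "distr M borel X = density lborel (normal_density 0 \<sigma>)" using d False by simp
    have dl: "distributed M lborel X (normal_density 0 \<sigma>)"
      unfolding distributed_def using d by (auto cong: distr_cong)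
    then have dn: "distributed M lborel (\<lambda>\<omega>. (X \<omega> - 0) / \<sigma>) std_normal_density"
      using normal_standard_normal_convert[OF s, of X 0] by simp
    then have ds: "distr M borel (\<lambda>\<omega>. X \<omega> / \<sigma>) = std_normal_distribution"
      by (simp add: distributed_def cong: distr_cong)
    have mom: "integrable M (\<lambda>\<omega>. (X \<omega>) ^ (2 * j))"
      "(\<integral>\<omega>. (X \<omega>) ^ (2 * j) \<partial>M) = fact (2 * j) / ((2 / \<sigma>\<^sup>2) ^ j * fact j)" for j :: nat
    proof -
      have "integrable lborel (\<lambda>x. normal_density 0 \<sigma> x * x ^ (2 * j))"
        using integrable_normal_moment[OF s, of 0 "2 * j"] by simp
      then have "integrable (distr M borel X) (\<lambda>x. x ^ (2 * j))"
        unfolding d by (subst integrable_density) (auto intro: s)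
      then show "integrable M (\<lambda>\<omega>. (X \<omega>) ^ (2 * j))"
        by (subst (asm) integrable_distr_eq) auto
      have "(\<integral>\<omega>. (X \<omega>) ^ (2 * j) \<partial>M) = (\<integral>x. x ^ (2 * j) \<partial>distr M borel X)"
        by (subst integral_distr) auto
      also have "\<dots> = (\<integral>x. normal_density 0 \<sigma> x * x ^ (2 * j) \<partial>lborel)"
        unfolding d by (subst integral_density) (auto intro: s)
      also have "\<dots> = fact (2 * j) / ((2 / \<sigma>\<^sup>2) ^ j * fact j)"
        using integral_normal_moment_even[OF s, of 0 j] by simp
      finally show "(\<integral>\<omega>. (X \<omega>) ^ (2 * j) \<partial>M) = fact (2 * j) / ((2 / \<sigma>\<^sup>2) ^ j * fact j)" .
    qed
    interpret S: real_distribution std_normal_distribution by (rule real_dist_normal_dist)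
    \<comment> \<open>\<open>X / \<sigma>\<close> is standard normal, and its characteristic
      function at \<sigma> is that of \<open>X\<close> at 1.\<close>
    have "complex_of_real (\<integral>x. cos (\<sigma> * x) \<partial>std_normal_distribution) + \<i> * complex_of_real (\<integral>x. sin (\<sigma> * x) \<partial>std_normal_distribution)
      = complex_of_real (exp (- \<sigma>\<^sup>2 / 2))"
      using S.char_cos_sin[of \<sigma>] char_std_normal_distribution by (simp add: fun_eq_iff)
    then have "(\<integral>x. cos (\<sigma> * x) \<partial>distr M borel (\<lambda>\<omega>. X \<omega> / \<sigma>)) = exp (- \<sigma>\<^sup>2 / 2)"
      "(\<integral>x. sin (\<sigma> * x) \<partial>distr M borel (\<lambda>\<omega>. X \<omega> / \<sigma>)) = 0"
      unfolding ds by (simp_all add: complex_eq_iff)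
    then have "(\<integral>\<omega>. cos (X \<omega>) \<partial>M) = exp (- \<sigma>\<^sup>2 / 2)" "(\<integral>\<omega>. sin (X \<omega>) \<partial>M) = 0"
      using s by (simp_all add: integral_distr)
    moreover have "(\<lambda>\<omega>. ((X \<omega>)\<^sup>2)\<^sup>2) = (\<lambda>\<omega>. (X \<omega>) ^ 4)" "(\<lambda>\<omega>. (X \<omega>)\<^sup>2 * (X \<omega>)\<^sup>2) = (\<lambda>\<omega>. (X \<omega>) ^ 4)"
      by (simp_all add: power2_eq_square power4_eq_xxxx mult.assoc)
    moreover have "integrable M (\<lambda>\<omega>. (X \<omega>)\<^sup>2)" "(\<integral>\<omega>. (X \<omega>)\<^sup>2 \<partial>M) = \<sigma>\<^sup>2"
      using mom[of 1] s by (simp_all add: fact_numeral)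
    moreover have "integrable M (\<lambda>\<omega>. (X \<omega>) ^ 4)" "(\<integral>\<omega>. (X \<omega>) ^ 4 \<partial>M) = 3 * (\<sigma>\<^sup>2)\<^sup>2"
      using mom[of 2] s by (simp_all add: fact_numeral power_divide)
    ultimately show ?thesis
      by (simp add: sqint_def ip_self ip_def[of M "\<lambda>\<omega>. (X \<omega>)\<^sup>2"])
  qed
  then show "sqint M X" "ip M X X = \<sigma>\<^sup>2" "sqint M (\<lambda>\<omega>. (X \<omega>)\<^sup>2)"
    "ip M (\<lambda>\<omega>. (X \<omega>)\<^sup>2) (\<lambda>\<omega>. (X \<omega>)\<^sup>2) = 3 * (\<sigma>\<^sup>2)\<^sup>2"
    "(\<integral>\<omega>. cos (X \<omega>) \<partial>M) = exp (- \<sigma>\<^sup>2 / 2)" "(\<integral>\<omega>. sin (X \<omega>) \<partial>M) = 0" by blast+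
qed

section \<open>The approximation problem in a fixed dimension\<close>

locale avg_app =
  fixes D :: "nat \<Rightarrow> pt set" and \<rho> :: "nat \<Rightarrow> pt \<Rightarrow> real"
    and F :: "nat \<Rightarrow> fn set" and N :: "nat \<Rightarrow> fn \<Rightarrow> real" and \<mu> :: "nat \<Rightarrow> fn measure" and d :: nat
  assumes setting: "avg_app_setting D \<rho> F N \<mu>" and d: "d \<ge> 1"
begin

abbreviation "P \<equiv> Gmeas D \<rho> d"
abbreviation "M \<equiv> \<mu> d"
abbreviation "clf \<equiv> cont_lin_fun (F d) (N d)"

lemma D_sets: "D d \<in> sets (lborel_d d)" and \<rho>_meas: "\<rho> d \<in> borel_measurable (lborel_d d)"
  and density_1: "(\<integral>\<^sup>+ x. ennreal (indicator (D d) x * \<rho> d x) \<partial>lborel_d d) = 1"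
  and banach: "sep_banach_fun_space (F d) (N d)"
  and F_outside: "f \<in> F d \<Longrightarrow> x \<notin> D d \<Longrightarrow> f x = 0"
  and F_sub_G: "F d \<subseteq> G_set D \<rho> d"
  and embed: "\<exists>c. \<forall>f\<in>F d. Gnorm D \<rho> d f \<le> c * N d f"
  and eval_bounded: "x \<in> D d \<Longrightarrow> \<exists>c. \<forall>f\<in>F d. \<bar>f x\<bar> \<le> c * N d f"
  and prob_M: "prob_space M" and space_M: "space M = F d"
  and sets_M: "sets M = sets (borel_of (F d) (N d))"
  and gauss: "centered_gaussian (F d) (N d) M"
  using setting d unfolding avg_app_setting_def by blast+

sublocale M: prob_space M by (rule prob_M)

lemma space_P: "space P = space (lborel_d d)" and sets_P: "sets P = sets (lborel_d d)"
  by (simp_all add: Gmeas_def)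

lemma meas_P: "f \<in> measurable P K \<longleftrightarrow> f \<in> measurable (lborel_d d) K"
  by (simp add: Gmeas_def)

sublocale P: prob_space P
proof (rule prob_spaceI)
  have [measurable]: "D d \<in> sets (lborel_d d)" "\<rho> d \<in> borel_measurable (lborel_d d)"
    by (rule D_sets \<rho>_meas)+
  show "emeasure P (space P) = 1"
    unfolding space_P unfolding Gmeas_def
    by (subst emeasure_density) (auto simp: density_1 cong: nn_integral_cong)
qed

lemma D_space: "D d \<subseteq> space P"
  using sets.sets_into_space[OF D_sets] by (simp add: space_P)

lemma AE_D: "AE x in P. x \<in> D d"
proof -
  have [measurable]: "D d \<in> sets (lborel_d d)" "\<rho> d \<in> borel_measurable (lborel_d d)"
    by (rule D_sets \<rho>_meas)+
  show ?thesis unfolding Gmeas_def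
    by (subst AE_density) (auto simp: indicator_def)
qed

lemma G_set_iff: "g \<in> G_set D \<rho> d \<longleftrightarrow> sqint P g"
  by (simp add: G_set_def sqint_iff_nn_integral Gnorm2_def meas_P)

lemma F_sqint: "f \<in> F d \<Longrightarrow> sqint P f"
  using F_sub_G G_set_iff by blast

lemma Gnorm2_ip: "sqint P g \<Longrightarrow> Gnorm2 D \<rho> d g = ennreal (ip P g g)"
  by (simp add: Gnorm2_def nn_integral_ip)

lemma Gnorm_ip: "sqint P g \<Longrightarrow> Gnorm D \<rho> d g = sqrt (ip P g g)"
  by (simp add: Gnorm_def Gnorm2_ip)

lemma F_lincomb:
  assumes "f \<in> F d" "g \<in> F d" shows "(\<lambda>x. a * f x + b * g x) \<in> F d"
proof -
  have c: "\<forall>f\<in>F d. \<forall>c. (\<lambda>x. c * f x) \<in> F d" and p: "\<forall>f\<in>F d. \<forall>g\<in>F d. (\<lambda>x. f x + g x) \<in> F d"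
    using banach unfolding sep_banach_fun_space_def by blast+
  from p[rule_format, OF c[rule_format, OF assms(1), of a] c[rule_format, OF assms(2), of b]]
  show ?thesis .
qed

lemma F_zero: "(\<lambda>x. 0) \<in> F d"
  using banach unfolding sep_banach_fun_space_def by blast

lemma F_diff: "f \<in> F d \<Longrightarrow> g \<in> F d \<Longrightarrow> (\<lambda>x. f x - g x) \<in> F d"
  using F_lincomb[of f g 1 "-1"] by simp

lemma N_nonneg: "f \<in> F d \<Longrightarrow> 0 \<le> N d f"
  using banach unfolding sep_banach_fun_space_def by blast

lemma N_triangle: "f \<in> F d \<Longrightarrow> g \<in> F d \<Longrightarrow> h \<in> F d \<Longrightarrow>
    N d (\<lambda>x. f x - h x) \<le> N d (\<lambda>x. f x - g x) + N d (\<lambda>x. g x - h x)"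
proof -
  assume fgh: "f \<in> F d" "g \<in> F d" "h \<in> F d"
  have "\<forall>f\<in>F d. \<forall>g\<in>F d. N d (\<lambda>x. f x + g x) \<le> N d f + N d g"
    using banach unfolding sep_banach_fun_space_def by blast
  from this[rule_format, OF F_diff[OF fgh(1,2)] F_diff[OF fgh(2,3)]] show ?thesis by simp
qed

lemma dense_sequence:
  obtains s :: "nat \<Rightarrow> fn" where "\<And>n. s n \<in> F d" "\<And>f e. f \<in> F d \<Longrightarrow> e > 0 \<Longrightarrow> \<exists>n. N d (\<lambda>x. f x - s n x) < e"
proof -
  obtain S where S: "S \<subseteq> F d" "countable S" "\<forall>f\<in>F d. \<forall>e>0. \<exists>s\<in>S. N d (\<lambda>x. f x - s x) < e"
    using banach unfolding sep_banach_fun_space_def by blast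
  have "S \<noteq> {}" using S(3) F_zero by (metis empty_iff zero_less_one)
  show thesis
  proof (rule that[of "from_nat_into S"])
    show "from_nat_into S n \<in> F d" for n
      using S(1) from_nat_into[OF \<open>S \<noteq> {}\<close>] by blast
    show "\<exists>n. N d (\<lambda>x. f x - from_nat_into S n x) < e" if "f \<in> F d" "e > 0" for f e
      using S that from_nat_into_surj[OF S(2)] by metis
  qed
qed

lemma clf_lin: "clf L \<Longrightarrow> f \<in> F d \<Longrightarrow> g \<in> F d \<Longrightarrow> L (\<lambda>x. a * f x + b * g x) = a * L f + b * L g"
  unfolding cont_lin_fun_def by blast

lemma clf_measurable:
  assumes L: "clf L" shows "L \<in> borel_measurable M"
proof -
  obtain c where c: "\<forall>f\<in>F d. \<bar>L f\<bar> \<le> c * N d f" using L unfolding cont_lin_fun_def by blast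
  have "L \<in> borel_measurable (borel_of (F d) (N d))"
  proof (rule bounded_linear_continuous[where c = c])
    show "L g - L f = L (\<lambda>x. g x - f x)" if "f \<in> F d" "g \<in> F d" for f g
      using clf_lin[OF L that(2,1), of 1 "-1"] by simp
  qed (use c N_nonneg F_diff in auto)
  then show ?thesis using measurable_cong_sets[OF sets_M refl] by blast
qed

lemma clf_lincomb:
  assumes L: "clf L" and L': "clf L'" shows "clf (\<lambda>f. a * L f + b * L' f)"
proof -
  obtain c where c: "\<And>f. f \<in> F d \<Longrightarrow> \<bar>L f\<bar> \<le> c * N d f" using L unfolding cont_lin_fun_def by blast
  obtain c' where c': "\<And>f. f \<in> F d \<Longrightarrow> \<bar>L' f\<bar> \<le> c' * N d f" using L' unfolding cont_lin_fun_def by blast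
  have "\<bar>a * L f + b * L' f\<bar> \<le> (\<bar>a\<bar> * c + \<bar>b\<bar> * c') * N d f" if "f \<in> F d" for f
  proof -
    have "\<bar>a * L f + b * L' f\<bar> \<le> \<bar>a\<bar> * \<bar>L f\<bar> + \<bar>b\<bar> * \<bar>L' f\<bar>"
      by (metis abs_mult abs_triangle_ineq)
    also have "\<dots> \<le> \<bar>a\<bar> * (c * N d f) + \<bar>b\<bar> * (c' * N d f)"
      using c[OF that] c'[OF that] by (intro add_mono mult_left_mono) auto
    finally show ?thesis by (simp add: algebra_simps)
  qed
  then have "\<exists>c. \<forall>f\<in>F d. \<bar>a * L f + b * L' f\<bar> \<le> c * N d f" by blast
  then show ?thesis
    using clf_lin[OF L] clf_lin[OF L'] unfolding cont_lin_fun_def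
    by (simp add: algebra_simps)
qed

lemma clf_zero: "clf (\<lambda>f. 0)"
  unfolding cont_lin_fun_def by (auto intro: exI[of _ 0])

lemma clf_sum: "finite I \<Longrightarrow> (\<And>i. i \<in> I \<Longrightarrow> clf (L i)) \<Longrightarrow> clf (\<lambda>f. \<Sum>i\<in>I. c i * L i f)"
proof (induction I rule: finite_induct)
  case empty
  then show ?case by (simp add: clf_zero)
next
  case (insert i I)
  then show ?case using clf_lincomb[of "L i" "\<lambda>f. \<Sum>i\<in>I. c i * L i f" "c i" 1] by simp
qed

lemma clf_eval: "x \<in> D d \<Longrightarrow> clf (\<lambda>f. f x)"
  unfolding cont_lin_fun_def using eval_bounded by auto

text \<open>Off \<open>D d\<close> all elements of the space vanish and evaluation is the zero
  functional. Having evaluations at all points avoids case distinctions when integrating over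
  \<open>P\<close>.\<close>

lemma clf_eval': "clf (\<lambda>f. f x)"
proof (cases "x \<in> D d")
  case False
  then show ?thesis
    using F_outside unfolding cont_lin_fun_def by (auto intro: exI[of _ 0])
qed (rule clf_eval)

text \<open>Cauchy-Schwarz and the continuous embedding into G give the bound. Consequently the
  coefficients of a random element along an orthonormal system of G are Gaussian.\<close>

lemma clf_ip:
  assumes b: "sqint P b" shows "clf (\<lambda>f. ip P f b)"
proof -
  obtain c where c: "\<And>f. f \<in> F d \<Longrightarrow> Gnorm D \<rho> d f \<le> c * N d f" using embed by blast
  have "\<bar>ip P f b\<bar> \<le> (c * sqrt (ip P b b)) * N d f" if f: "f \<in> F d" for f
  proof -
    have "\<bar>ip P f b\<bar> = sqrt ((ip P f b)\<^sup>2)" by simp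
    also have "\<dots> \<le> sqrt (ip P f f * ip P b b)"
      using ip_Cauchy_Schwarz[OF F_sqint[OF f] b] by (rule real_sqrt_le_mono)
    also have "\<dots> = Gnorm D \<rho> d f * sqrt (ip P b b)"
      by (simp add: Gnorm_ip F_sqint f real_sqrt_mult)
    also have "\<dots> \<le> c * N d f * sqrt (ip P b b)"
      using c[OF f] by (intro mult_right_mono) auto
    finally show ?thesis by (simp add: ac_simps)
  qed
  then show ?thesis
    using F_sqint b unfolding cont_lin_fun_def
    by (auto simp: ip_add_left)
qed

lemma G_ip_measurable:
  assumes b: "sqint P b"
  shows "(\<lambda>g. ip P g b) \<in> borel_measurable (borel_of (G_set D \<rho> d) (Gnorm D \<rho> d))"
proof (rule bounded_linear_continuous[where c = "sqrt (ip P b b)"])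
  show "\<bar>ip P f b\<bar> \<le> sqrt (ip P b b) * Gnorm D \<rho> d f" if "f \<in> G_set D \<rho> d" for f
  proof -
    have f: "sqint P f" using that G_set_iff by blast
    have "\<bar>ip P f b\<bar> = sqrt ((ip P f b)\<^sup>2)" by simp
    also have "\<dots> \<le> sqrt (ip P f f * ip P b b)"
      using ip_Cauchy_Schwarz[OF f b] by (rule real_sqrt_le_mono)
    finally show ?thesis by (simp add: Gnorm_ip f real_sqrt_mult ac_simps)
  qed
qed (use b in \<open>auto simp: G_set_iff ip_diff_left Gnorm_ip\<close>)

lemma clf_gaussian:
  assumes "clf L"
  shows "sqint M L" "sqint M (\<lambda>f. (L f)\<^sup>2)"
    "ip M (\<lambda>f. (L f)\<^sup>2) (\<lambda>f. (L f)\<^sup>2) = 3 * (ip M L L)\<^sup>2"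
    "(\<integral>f. cos (L f) \<partial>M) = exp (- ip M L L / 2)" "(\<integral>f. sin (L f) \<partial>M) = 0"
proof -
  obtain \<sigma> where \<sigma>: "\<sigma> \<ge> 0" "distr M borel L = (if \<sigma> = 0 then return borel 0 else density lborel (normal_density 0 \<sigma>))"
    using gauss assms unfolding centered_gaussian_def by blast
  show "sqint M L" "sqint M (\<lambda>f. (L f)\<^sup>2)"
    "ip M (\<lambda>f. (L f)\<^sup>2) (\<lambda>f. (L f)\<^sup>2) = 3 * (ip M L L)\<^sup>2"
    "(\<integral>f. cos (L f) \<partial>M) = exp (- ip M L L / 2)" "(\<integral>f. sin (L f) \<partial>M) = 0"
    using M.centered_normal[OF clf_measurable[OF assms] \<sigma>] by simp_all
qed

text \<open>The weight \<open>sin (t * Z)\<close> has vanishing trigonometric transforms in the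
  data: its product with a cosine is a difference of means of sines of centered Gaussians, each 0;
  its product with a sine is a difference of means of cosines of \<open>Y + t * Z\<close> and
  \<open>Y - t * Z\<close>, whose variances agree when \<open>Z\<close> and \<open>Y\<close> are
  uncorrelated. So \<open>sin (t * Z)\<close> is orthogonal to \<open>h\<close> of the data, and
  dividing by \<open>t\<close> and letting \<open>t\<close> tend to 0 replaces the sine by
  \<open>Z\<close>. Only laws of single functionals are used.\<close>

lemma gaussian_uncorrelated:
  fixes n :: nat
  assumes Y: "\<And>i. i < n \<Longrightarrow> clf (Y i)" and Z: "clf Z" and ZY: "\<And>i. i < n \<Longrightarrow> ip M Z (Y i) = 0"
    and h[measurable]: "h \<in> borel_measurable (PiM {..<n} (\<lambda>_. borel))"
    and h2: "sqint M (\<lambda>f. h (\<lambda>i\<in>{..<n}. Y i f))"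
  shows "ip M Z (\<lambda>f. h (\<lambda>i\<in>{..<n}. Y i f)) = 0"
proof -
  let ?h = "\<lambda>f. h (\<lambda>i\<in>{..<n}. Y i f)"
  have [measurable]: "Z \<in> borel_measurable M" by (rule clf_measurable[OF Z])
  have hm[measurable]: "?h \<in> borel_measurable M" using h2 by (simp add: sqint_def)
  have hi: "integrable M ?h"
    using sqint_mult_integrable[OF h2, of "\<lambda>_. 1"] by (simp add: sqint_def)
  have Ys: "clf (\<lambda>f. \<Sum>i<n. s i * Y i f)" for s by (rule clf_sum) (simp_all add: Y)
  have sY: "sqint M (\<lambda>f. \<Sum>i<n. s i * Y i f)" for s by (rule clf_gaussian(1)[OF Ys])
  have sZ: "sqint M Z" by (rule clf_gaussian(1)[OF Z])
  have ZY0: "ip M (\<lambda>f. \<Sum>i<n. s i * Y i f) Z = 0" for s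
  proof -
    have "ip M (\<lambda>f. \<Sum>i<n. s i * Y i f) Z = (\<Sum>i<n. s i * ip M (Y i) Z)"
      using Y sZ clf_gaussian(1) by (subst ip_sum_left) auto
    then show ?thesis using ZY by (simp add: ip_commute[of M _ Z])
  qed
  have C: "clf (\<lambda>f. (\<Sum>i<n. s i * Y i f) + t * Z f)" for s t
    using clf_lincomb[OF Ys[of s] Z, of 1 t] by simp
  \<comment> \<open>Even in \<open>t\<close>, because the mixed term vanishes; this is where the
    missing correlation enters.\<close>
  have var: "ip M (\<lambda>f. (\<Sum>i<n. s i * Y i f) + t * Z f) (\<lambda>f. (\<Sum>i<n. s i * Y i f) + t * Z f)
      = ip M (\<lambda>f. (\<Sum>i<n. s i * Y i f)) (\<lambda>f. (\<Sum>i<n. s i * Y i f)) + t\<^sup>2 * ip M Z Z" for s t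
    using ip_add_self[OF sY[of s] sqint_cmult[OF sZ, of t]] by (simp add: ZY0 power2_eq_square)
  have 0: "(\<integral>f. sin (t * Z f) * ?h f \<partial>M) = 0" for t
  proof (rule trig_transform_unique[OF _ _ _ _ h])
    fix s :: "nat \<Rightarrow> real"
    let ?Y = "\<lambda>f. \<Sum>i<n. s i * Y i f"
    have [measurable]: "?Y \<in> borel_measurable M" by (rule clf_measurable[OF Ys])
    have bi: "integrable M (\<lambda>f. sin (?Y f + c * Z f))" "integrable M (\<lambda>f. cos (?Y f + c * Z f))" for c
      by (auto intro!: M.integrable_const_bound[of _ 1])
    have "(\<integral>f. sin (t * Z f) * cos (?Y f) \<partial>M) = (\<integral>f. (1/2) * sin (?Y f + t * Z f) - (1/2) * sin (?Y f + (- t) * Z f) \<partial>M)"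
      by (intro Bochner_Integration.integral_cong) (auto simp: sin_add sin_diff field_simps)
    also have "\<dots> = (1/2) * (\<integral>f. sin (?Y f + t * Z f) \<partial>M) - (1/2) * (\<integral>f. sin (?Y f + (- t) * Z f) \<partial>M)"
      using bi[of t] bi[of "- t"] by (subst Bochner_Integration.integral_diff) auto
    also have "\<dots> = 0" by (simp only: clf_gaussian(5)[OF C])
    finally show "(\<integral>f. sin (t * Z f) * cos (?Y f) \<partial>M) = 0" .
    have "(\<integral>f. sin (t * Z f) * sin (?Y f) \<partial>M) = (\<integral>f. (1/2) * cos (?Y f + (- t) * Z f) - (1/2) * cos (?Y f + t * Z f) \<partial>M)"
      by (intro Bochner_Integration.integral_cong) (auto simp: cos_add cos_diff field_simps)
    also have "\<dots> = (1/2) * (\<integral>f. cos (?Y f + (- t) * Z f) \<partial>M) - (1/2) * (\<integral>f. cos (?Y f + t * Z f) \<partial>M)"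
      using bi[of t] bi[of "- t"] by (subst Bochner_Integration.integral_diff) auto
    also have "\<dots> = 0" by (simp only: clf_gaussian(4)[OF C] var) simp
    finally show "(\<integral>f. sin (t * Z f) * sin (?Y f) \<partial>M) = 0" .
  next
    show "integrable M (\<lambda>f. sin (t * Z f))" by (auto intro!: M.integrable_const_bound[of _ 1])
    show "integrable M (\<lambda>f. sin (t * Z f) * ?h f)"
      by (rule Bochner_Integration.integrable_bound[OF hi]) (auto simp: abs_mult intro!: AE_I2 mult_left_le_one_le)
  qed (use Y clf_measurable in auto)
  \<comment> \<open>The difference quotients of the sine at 0, along \<open>t = 1 / Suc j\<close>;
    they are dominated by the absolute value of \<open>z\<close>.\<close>
  have lim: "(\<lambda>j. real (Suc j) * sin (1 / real (Suc j) * z)) \<longlonglongrightarrow> z" for z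
  proof -
    have "(\<lambda>j. 1 / real (Suc j) * z) \<longlonglongrightarrow> 0 * z"
      by (intro tendsto_mult tendsto_const LIMSEQ_Suc[OF lim_1_over_n])
    then have "(\<lambda>j. sinc (1 / real (Suc j) * z)) \<longlonglongrightarrow> sinc 0"
      by (intro isCont_tendsto_compose[OF isCont_sinc]) simp
    then have "(\<lambda>j. z * sinc (1 / real (Suc j) * z)) \<longlonglongrightarrow> z * 1"
      by (intro tendsto_mult tendsto_const) simp
    moreover have "z * sinc (1 / real (Suc j) * z) = real (Suc j) * sin (1 / real (Suc j) * z)" for j
      by (cases "z = 0") (auto simp: field_simps)
    ultimately show ?thesis by simp
  qed
  have "(\<lambda>j. \<integral>f. real (Suc j) * sin (1 / real (Suc j) * Z f) * ?h f \<partial>M) \<longlonglongrightarrow> (\<integral>f. Z f * ?h f \<partial>M)"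
  proof (rule integral_dominated_convergence[where w = "\<lambda>f. \<bar>Z f * ?h f\<bar>"])
    show "integrable M (\<lambda>f. \<bar>Z f * ?h f\<bar>)" using sqint_mult_integrable[OF sZ h2] by simp
    show "AE f in M. (\<lambda>j. real (Suc j) * sin (1 / real (Suc j) * Z f) * ?h f) \<longlonglongrightarrow> Z f * ?h f"
      by (intro AE_I2 tendsto_mult lim tendsto_const)
    show "AE f in M. norm (real (Suc j) * sin (1 / real (Suc j) * Z f) * ?h f) \<le> \<bar>Z f * ?h f\<bar>" for j
    proof (rule AE_I2)
      fix f
      have "real (Suc j) * \<bar>sin (1 / real (Suc j) * Z f)\<bar> \<le> real (Suc j) * \<bar>1 / real (Suc j) * Z f\<bar>"
        by (intro mult_left_mono abs_sin_x_le_abs_x) auto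
      then have "real (Suc j) * \<bar>sin (1 / real (Suc j) * Z f)\<bar> \<le> \<bar>Z f\<bar>" by (simp add: abs_mult)
      then show "norm (real (Suc j) * sin (1 / real (Suc j) * Z f) * ?h f) \<le> \<bar>Z f * ?h f\<bar>"
        unfolding real_norm_def abs_mult by (intro mult_right_mono) auto
    qed
  qed measurable
  moreover have "(\<integral>f. real (Suc j) * sin (1 / real (Suc j) * Z f) * ?h f \<partial>M) = 0" for j
    using 0[of "1 / real (Suc j)"] by (simp only: mult.assoc integral_mult_right_zero mult_zero_right)
  ultimately have "(\<lambda>j. 0) \<longlonglongrightarrow> (\<integral>f. Z f * ?h f \<partial>M)" by simp
  then show ?thesis unfolding ip_def using LIMSEQ_unique[OF _ tendsto_const] by blast
qed

end

section \<open>From an algorithm to a subspace\<close>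

lemma proj_minimal:
  assumes e: "onsys P J e" and f: "sqint P f" and u: "sqint P u" and uc: "AE x in P. u x = (\<Sum>i\<in>J. c i * e i x)"
  shows "ip P (\<lambda>x. f x - proj P J e f x) (\<lambda>x. f x - proj P J e f x) \<le> ip P (\<lambda>x. f x - u x) (\<lambda>x. f x - u x)"
proof -
  let ?w = "\<lambda>x. \<Sum>i\<in>J. c i * e i x"
  have w: "sqint P ?w" using e by (auto simp: onsys_def)
  have "ip P (\<lambda>x. f x - u x) (\<lambda>x. f x - u x) = ip P (\<lambda>x. f x - ?w x) (\<lambda>x. f x - ?w x)"
    unfolding ip_def using f u w uc by (intro integral_cong_AE) (auto simp: sqint_def)
  then show ?thesis
    using proj_pythagoras[OF e f, of c] by (simp add: sum_nonneg)
qed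

text \<open>The kernel is built from fixed representatives \<open>e i\<close>, and its operator sees
  its argument through integrals only, so the identities hold at every point.\<close>

lemma proj_kernel_of_onsys:
  assumes e: "onsys P J e"
  shows "proj_kernel P (\<lambda>x y. \<Sum>i\<in>J. e i x * e i y) (real (card J))"
    and "sqint P f \<Longrightarrow> kop P (\<lambda>x y. \<Sum>i\<in>J. e i x * e i y) f = proj P J e f"
proof -
  let ?k = "\<lambda>x y. \<Sum>i\<in>J. e i x * e i y"
  have [simp]: "finite J" and se: "\<And>i. i \<in> J \<Longrightarrow> sqint P (e i)"
    and oe: "\<And>i j. i \<in> J \<Longrightarrow> j \<in> J \<Longrightarrow> ip P (e i) (e j) = (if i = j then 1 else 0)"
    using e by (auto simp: onsys_def)
  have em: "e i \<in> borel_measurable P" if "i \<in> J" for i using se[OF that] by (simp add: sqint_def)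
  have sk: "sqint P (?k x)" for x using se by auto
  show K: "kop P ?k f = proj P J e f" if f: "sqint P f" for f
  proof
    fix x
    have "kop P ?k f x = (\<Sum>i\<in>J. e i x * ip P (e i) f)"
      unfolding kop_def using se f by (subst ip_sum_left) auto
    then show "kop P ?k f x = proj P J e f x"
      by (simp add: proj_def ip_commute[of P f] mult.commute)
  qed
  have "(\<lambda>z. ?k (fst z) (snd z)) \<in> borel_measurable (P \<Otimes>\<^sub>M P)"
  proof (rule borel_measurable_sum)
    fix i assume "i \<in> J"
    then have [measurable]: "e i \<in> borel_measurable P" by (rule em)
    show "(\<lambda>z. e i (fst z) * e i (snd z)) \<in> borel_measurable (P \<Otimes>\<^sub>M P)" by measurable
  qed
  moreover have "ip P (?k x) (?k y) = ?k x y" for x y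
    by (rule ip_onsys_comb_comb[OF e])
  moreover have "integrable P (\<lambda>x. ?k x x)" "(\<integral>x. ?k x x \<partial>P) = real (card J)"
  proof -
    have i: "integrable P (\<lambda>x. e i x * e i x)" if "i \<in> J" for i
      using sqint_mult_integrable[OF se[OF that] se[OF that]] .
    then show "integrable P (\<lambda>x. ?k x x)" by auto
    have "(\<integral>x. ?k x x \<partial>P) = (\<Sum>i\<in>J. ip P (e i) (e i))"
      unfolding ip_def by (rule Bochner_Integration.integral_sum) (rule i)
    then show "(\<integral>x. ?k x x \<partial>P) = real (card J)" using oe by simp
  qed
  moreover have "sqint P (kop P ?k f) \<and> kop P ?k (kop P ?k f) = kop P ?k f \<and>
        ip P f (kop P ?k f) = ip P (kop P ?k f) (kop P ?k f)" if f: "sqint P f" for f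
  proof -
    have sp: "sqint P (proj P J e f)" using e by auto
    have "proj P J e (proj P J e f) = proj P J e f"
      using ip_onsys_comb[OF e] by (auto simp: proj_def fun_eq_iff intro!: sum.cong)
    moreover have "ip P (\<lambda>x. f x - proj P J e f x) (proj P J e f) = 0"
      using ip_minus_proj_comb[OF e f, of "\<lambda>i. ip P f (e i)"] by (simp add: proj_def)
    then have "ip P f (proj P J e f) = ip P (proj P J e f) (proj P J e f)"
      using ip_diff_left[OF f sp sp] by simp
    ultimately show ?thesis using K[OF f] K[OF sp] sp by simp
  qed
  ultimately show "proj_kernel P ?k (real (card J))"
    unfolding proj_kernel_def using sk by blast
qed

context avg_app
begin

text \<open>Each \<open>f\<close> is replaced by the first member of a dense sequence within
  distance \<open>1 / Suc n\<close>. The index is a measurable function of \<open>f\<close> with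
  countably many values, so the approximant is jointly measurable, and bounded evaluations turn
  convergence in norm into convergence at every point.\<close>

lemma joint_measurable: "(\<lambda>z. (fst z) (snd z)) \<in> borel_measurable (M \<Otimes>\<^sub>M P)"
proof -
  obtain s :: "nat \<Rightarrow> fn" where sF: "\<And>n. s n \<in> F d"
    and dense: "\<And>f e. f \<in> F d \<Longrightarrow> e > 0 \<Longrightarrow> \<exists>n. N d (\<lambda>x. f x - s n x) < e"
    using dense_sequence by blast
  define I where "I = (\<lambda>n f. LEAST i. N d (\<lambda>x. f x - s i x) < 1 / real (Suc n))"
  have near: "N d (\<lambda>x. f x - s (I n f) x) < 1 / real (Suc n)" if "f \<in> F d" for n f
    unfolding I_def by (rule LeastI_ex) (rule dense[OF that], simp)
  have op: "nopen (F d) (N d) {f \<in> F d. N d (\<lambda>x. f x - s i x) < r}" for i r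
    unfolding nopen_def
  proof (intro conjI ballI)
    fix f assume f: "f \<in> {f \<in> F d. N d (\<lambda>x. f x - s i x) < r}"
    show "\<exists>r'>0. \<forall>g\<in>F d. N d (\<lambda>x. g x - f x) < r' \<longrightarrow> g \<in> {f \<in> F d. N d (\<lambda>x. f x - s i x) < r}"
    proof (intro exI[of _ "r - N d (\<lambda>x. f x - s i x)"] conjI ballI impI)
      fix g assume "g \<in> F d" "N d (\<lambda>x. g x - f x) < r - N d (\<lambda>x. f x - s i x)"
      then show "g \<in> {f \<in> F d. N d (\<lambda>x. f x - s i x) < r}"
        using N_triangle[of g f "s i"] f sF by auto
    qed (use f in auto)
  qed auto
  have Im: "I n \<in> measurable M (count_space UNIV)" for n
    unfolding I_def
  proof (rule measurable_Least)
    fix i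
    have "{f \<in> space M. N d (\<lambda>x. f x - s i x) < 1 / real (Suc n)} \<in> sets M"
      using nopen_in_sets[OF op] unfolding space_M sets_M .
    then show "(\<lambda>f. N d (\<lambda>x. f x - s i x) < 1 / real (Suc n)) \<in> measurable M (count_space UNIV)"
      by (simp add: pred_def)
  qed
  show ?thesis
  proof (rule borel_measurable_LIMSEQ_real)
    show "(\<lambda>z. s (I n (fst z)) (snd z)) \<in> borel_measurable (M \<Otimes>\<^sub>M P)" for n
    proof (rule measurable_compose_countable[where f = "\<lambda>i z. s i (snd z)"])
      show "(\<lambda>z. s i (snd z)) \<in> borel_measurable (M \<Otimes>\<^sub>M P)" for i
        using F_sqint[OF sF[of i]] by (auto simp: sqint_def intro: measurable_compose[OF measurable_snd])
      show "(\<lambda>z. I n (fst z)) \<in> measurable (M \<Otimes>\<^sub>M P) (count_space UNIV)"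
        by (rule measurable_compose[OF measurable_fst Im])
    qed
  next
    fix z assume "z \<in> space (M \<Otimes>\<^sub>M P)"
    then have f: "fst z \<in> F d" by (auto simp: space_pair_measure space_M)
    obtain c where c: "\<And>g. g \<in> F d \<Longrightarrow> \<bar>g (snd z)\<bar> \<le> c * N d g"
      using clf_eval'[of "snd z"] unfolding cont_lin_fun_def by blast
    show "(\<lambda>n. s (I n (fst z)) (snd z)) \<longlonglongrightarrow> fst z (snd z)"
    proof (rule LIM_zero_cancel, rule Lim_null_comparison)
      have "\<bar>s (I n (fst z)) (snd z) - fst z (snd z)\<bar> \<le> \<bar>c\<bar> * (1 / real (Suc n))" for n
      proof -
        have "\<bar>fst z (snd z) - s (I n (fst z)) (snd z)\<bar> \<le> c * N d (\<lambda>x. fst z x - s (I n (fst z)) x)"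
          using c[OF F_diff[OF f sF]] .
        also have "\<dots> \<le> \<bar>c\<bar> * (1 / real (Suc n))"
          using near[OF f, of n] N_nonneg[OF F_diff[OF f sF]] by (intro mult_mono) auto
        finally show ?thesis by (simp add: abs_minus_commute)
      qed
      then show "\<forall>\<^sub>F n in sequentially. norm (s (I n (fst z)) (snd z) - fst z (snd z)) \<le> \<bar>c\<bar> * (1 / real (Suc n))"
        by simp
      have "(\<lambda>n. \<bar>c\<bar> * (1 / real (Suc n))) \<longlonglongrightarrow> \<bar>c\<bar> * 0"
        by (intro tendsto_mult tendsto_const LIMSEQ_Suc[OF lim_1_over_n])
      then show "(\<lambda>n. \<bar>c\<bar> * (1 / real (Suc n))) \<longlonglongrightarrow> 0" by simp
    qed
  qed
qed

lemma rfun_id: "rfun M P (\<lambda>f. f)"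
  using joint_measurable F_sqint by (simp add: rfun_def space_M)

lemmas base_measures = M.sigma_finite_measure_axioms P.sigma_finite_measure_axioms D_space AE_D

lemma norm_sq_measurable: "(\<lambda>f. ip P f f) \<in> borel_measurable M"
  by (rule ip_self_measurable[OF base_measures rfun_id])

text \<open>Cauchy-Schwarz bounds the mixed moment by the fourth moments of the single evaluations,
  so the joint law of \<open>f x\<close> and \<open>f y\<close> does not enter.\<close>

lemma eval_sq_moment: "ip M (\<lambda>f. (f x)\<^sup>2) (\<lambda>f. (f y)\<^sup>2) \<le> 3 * (ip M (\<lambda>f. f x) (\<lambda>f. f x) * ip M (\<lambda>f. f y) (\<lambda>f. f y))"
proof (rule power2_le_imp_le)
  have "(ip M (\<lambda>f. (f x)\<^sup>2) (\<lambda>f. (f y)\<^sup>2))\<^sup>2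
      \<le> ip M (\<lambda>f. (f x)\<^sup>2) (\<lambda>f. (f x)\<^sup>2) * ip M (\<lambda>f. (f y)\<^sup>2) (\<lambda>f. (f y)\<^sup>2)"
    by (rule ip_Cauchy_Schwarz) (rule clf_gaussian(2)[OF clf_eval'])+
  also have "\<dots> = (3 * (ip M (\<lambda>f. f x) (\<lambda>f. f x) * ip M (\<lambda>f. f y) (\<lambda>f. f y)))\<^sup>2"
    unfolding clf_gaussian(3)[OF clf_eval'] by (simp add: power_mult_distrib)
  finally show "(ip M (\<lambda>f. (f x)\<^sup>2) (\<lambda>f. (f y)\<^sup>2))\<^sup>2 \<le> \<dots>" .
qed simp

text \<open>A weak form of Fernique's theorem. The fourth moments of Gaussian variables give
  \<open>E S\<^sup>2 \<le> 3 (E S)\<^sup>2\<close> for the truncated squared norms \<open>S\<close>, so by the Paley-Zygmund argument an unbounded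
  \<open>E S\<close> would force the norm to be infinite with positive probability.\<close>

lemma second_moment_finite: "mean_sq M P (\<lambda>f. f) < \<infinity>"
proof -
  interpret Q: pair_sigma_finite M P
    by (simp add: pair_sigma_finite_def base_measures)
  define v where "v = (\<lambda>x. ip M (\<lambda>f. f x) (\<lambda>f. f x))"
  have v0: "0 \<le> v x" for x by (simp add: v_def)
  note joint_measurable[measurable]
  have [measurable]: "(\<lambda>z. (snd z) (fst z)) \<in> borel_measurable (P \<Otimes>\<^sub>M M)"
    by (rule measurable_joint[of "\<lambda>f. f" M P, OF joint_measurable]) measurable
  have vm[measurable]: "v \<in> borel_measurable P"
    unfolding v_def ip_def by (rule M.borel_measurable_lebesgue_integral) (simp add: split_beta')
  have ev: "(\<integral>\<^sup>+f. ennreal ((f x)\<^sup>2) \<partial>M) = ennreal (v x)" for x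
    unfolding v_def by (rule nn_integral_ip[OF clf_gaussian(1)[OF clf_eval']])
  \<comment> \<open>Restricting to points of variance at most \<open>n\<close> makes the truncated
    mean \<open>s n\<close> finite, so that the inequality derived for it below can be
    solved.\<close>
  define A where "A = (\<lambda>n::nat. {x \<in> space P. v x \<le> real n})"
  have Am[measurable]: "A n \<in> sets P" for n unfolding A_def by measurable
  define u where "u = (\<lambda>n f x. ennreal (indicator (A n) x * (f x)\<^sup>2))"
  define S where "S = (\<lambda>n f. \<integral>\<^sup>+x. u n f x \<partial>P)"
  define s where "s = (\<lambda>n. \<integral>\<^sup>+x. ennreal (indicator (A n) x * v x) \<partial>P)"
  have um[measurable]: "(\<lambda>z. u n (fst z) (snd z)) \<in> borel_measurable (M \<Otimes>\<^sub>M P)" for n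
    unfolding u_def by measurable
  have um'[measurable]: "(\<lambda>z. u n (snd z) (fst z)) \<in> borel_measurable (P \<Otimes>\<^sub>M M)" for n
    unfolding u_def by measurable
  have Sm[measurable]: "S n \<in> borel_measurable M" for n
    unfolding S_def using P.borel_measurable_nn_integral[of "u n" M] um[of n] by (simp add: split_beta')
  have ux: "(\<lambda>f. u n f x) \<in> borel_measurable M" for n x
  proof -
    have [measurable]: "(\<lambda>f. f x) \<in> borel_measurable M" by (rule clf_measurable[OF clf_eval'])
    show ?thesis unfolding u_def by measurable
  qed
  have uf: "u n f \<in> borel_measurable P" if "f \<in> space M" for n f
  proof -
    have [measurable]: "f \<in> borel_measurable P" using that F_sqint by (simp add: space_M sqint_def)
    show ?thesis unfolding u_def by measurable
  qed
  have ES: "(\<integral>\<^sup>+f. S n f \<partial>M) = s n" for n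
  proof -
    have "(\<integral>\<^sup>+f. S n f \<partial>M) = (\<integral>\<^sup>+x. (\<integral>\<^sup>+f. u n f x \<partial>M) \<partial>P)"
      unfolding S_def by (rule Q.Fubini'[symmetric]) (simp add: split_beta')
    also have "\<dots> = s n"
      unfolding s_def
    proof (rule nn_integral_cong)
      fix x
      have [measurable]: "(\<lambda>f. f x) \<in> borel_measurable M" by (rule clf_measurable[OF clf_eval'])
      show "(\<integral>\<^sup>+f. u n f x \<partial>M) = ennreal (indicator (A n) x * v x)"
        using v0 by (simp add: u_def ennreal_mult nn_integral_cmult ev)
    qed
    finally show ?thesis .
  qed
  have s_fin: "s n < \<infinity>" for n
  proof -
    have "s n \<le> (\<integral>\<^sup>+x. ennreal (real n) \<partial>P)"
      unfolding s_def by (intro nn_integral_mono ennreal_leI) (auto simp: A_def indicator_def)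
    then show ?thesis by (simp add: P.emeasure_space_1 le_less_trans)
  qed
  have uu: "(\<integral>\<^sup>+f. u n f x * u n f y \<partial>M) \<le> 3 * (ennreal (indicator (A n) x * v x) * ennreal (indicator (A n) y * v y))" for n x y
  proof -
    let ?i = "indicator (A n) x * indicator (A n) y :: real"
    have [measurable]: "(\<lambda>f. f z) \<in> borel_measurable M" for z by (rule clf_measurable[OF clf_eval'])
    have int: "integrable M (\<lambda>f. (f x)\<^sup>2 * (f y)\<^sup>2)"
      by (rule sqint_mult_integrable) (rule clf_gaussian(2)[OF clf_eval'])+
    have "(\<integral>\<^sup>+f. u n f x * u n f y \<partial>M) = (\<integral>\<^sup>+f. ennreal ?i * ennreal ((f x)\<^sup>2 * (f y)\<^sup>2) \<partial>M)"
      by (rule nn_integral_cong) (simp add: u_def ennreal_mult[symmetric] ac_simps)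
    also have "\<dots> = ennreal ?i * (\<integral>\<^sup>+f. ennreal ((f x)\<^sup>2 * (f y)\<^sup>2) \<partial>M)"
      by (rule nn_integral_cmult) measurable
    also have "(\<integral>\<^sup>+f. ennreal ((f x)\<^sup>2 * (f y)\<^sup>2) \<partial>M) = ennreal (ip M (\<lambda>f. (f x)\<^sup>2) (\<lambda>f. (f y)\<^sup>2))"
      unfolding ip_def by (rule nn_integral_eq_integral[OF int]) auto
    also have "\<dots> \<le> ennreal (3 * (v x * v y))"
      unfolding v_def by (intro ennreal_leI eval_sq_moment)
    also have "ennreal ?i * ennreal (3 * (v x * v y)) = ennreal (3 * ((indicator (A n) x * v x) * (indicator (A n) y * v y)))"
      using v0 by (subst ennreal_mult[symmetric]) (auto simp: ac_simps)
    also have "\<dots> = 3 * (ennreal (indicator (A n) x * v x) * ennreal (indicator (A n) y * v y))"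
      using v0 by (simp add: ennreal_mult)
    finally show ?thesis by (simp add: mult_left_mono)
  qed
  have ES2: "(\<integral>\<^sup>+f. S n f * S n f \<partial>M) \<le> 3 * (s n * s n)" for n
  proof -
    \<comment> \<open>The square of the integral becomes a double integral over pairs of points, and
      Tonelli moves the mean over \<open>f\<close> inside, where the moment bound applies.\<close>
    have "(\<integral>\<^sup>+f. S n f * S n f \<partial>M) = (\<integral>\<^sup>+f. (\<integral>\<^sup>+x. u n f x * S n f \<partial>P) \<partial>M)"
      by (rule nn_integral_cong) (simp add: S_def nn_integral_multc uf)
    also have "\<dots> = (\<integral>\<^sup>+x. (\<integral>\<^sup>+f. u n f x * S n f \<partial>M) \<partial>P)"
      by (rule Q.Fubini'[symmetric]) (simp add: split_beta')
    also have "\<dots> = (\<integral>\<^sup>+x. (\<integral>\<^sup>+f. (\<integral>\<^sup>+y. u n f x * u n f y \<partial>P) \<partial>M) \<partial>P)"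
      by (intro nn_integral_cong) (simp add: S_def nn_integral_cmult uf)
    also have "\<dots> = (\<integral>\<^sup>+x. (\<integral>\<^sup>+y. (\<integral>\<^sup>+f. u n f x * u n f y \<partial>M) \<partial>P) \<partial>P)"
    proof (rule nn_integral_cong)
      fix x
      have [measurable]: "(\<lambda>f. u n f x) \<in> borel_measurable M" by (rule ux)
      show "(\<integral>\<^sup>+f. (\<integral>\<^sup>+y. u n f x * u n f y \<partial>P) \<partial>M) = (\<integral>\<^sup>+y. (\<integral>\<^sup>+f. u n f x * u n f y \<partial>M) \<partial>P)"
        by (rule Q.Fubini'[symmetric]) (simp add: split_beta')
    qed
    also have "\<dots> \<le> (\<integral>\<^sup>+x. (\<integral>\<^sup>+y. 3 * (ennreal (indicator (A n) x * v x) * ennreal (indicator (A n) y * v y)) \<partial>P) \<partial>P)"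
      by (intro nn_integral_mono uu)
    also have "\<dots> = 3 * (s n * s n)"
      by (simp add: nn_integral_cmult nn_integral_multc s_def)
    finally show ?thesis .
  qed
  define B where "B = (\<lambda>T::nat. {f \<in> space M. real T \<le> ip P f f})"
  have Bm[measurable]: "B T \<in> sets M" for T
    unfolding B_def using norm_sq_measurable by measurable
  have "(\<lambda>T. measure M (B T)) \<longlonglongrightarrow> measure M (\<Inter>T. B T)"
  proof (rule M.finite_Lim_measure_decseq)
    show "range B \<subseteq> sets M" by auto
    show "decseq B" by (auto simp: decseq_def B_def)
  qed
  \<comment> \<open>Every element of the space has finite norm in G, so no \<open>f\<close> lies in
    all the events.\<close>
  moreover have "(\<Inter>T. B T) = {}"
  proof -
    have "f \<notin> (\<Inter>T. B T)" for f
    proof -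
      obtain T :: nat where "ip P f f < real T" using reals_Archimedean2 by blast
      then have "f \<notin> B T" by (simp add: B_def)
      then show ?thesis by blast
    qed
    then show ?thesis by blast
  qed
  ultimately have "(\<lambda>T. measure M (B T)) \<longlonglongrightarrow> 0" by simp
  then have "\<forall>\<^sub>F T in sequentially. measure M (B T) < 1 / 12"
    by (rule order_tendstoD) simp
  then obtain T where T: "measure M (B T) < 1 / 12"
    by (auto simp: eventually_sequentially)
  have s_le: "s n \<le> ennreal (2 * real T)" for n
  proof (cases "s n = 0")
    case False
    define r where "r = enn2real (s n)"
    have sr: "s n = ennreal r" using s_fin[of n] by (simp add: r_def)
    have r: "r > 0" using False sr by (cases "r \<le> 0") (auto simp: ennreal_neg)
    \<comment> \<open>Outside \<open>B T\<close> the squared norm is below \<open>T\<close>. On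
      \<open>B T\<close>, \<open>q \<le> q\<^sup>2 / (12 * r) + 3 * r\<close> follows from the
      square of \<open>q - 6 * r\<close>. After taking means, the second moment bound and the
      probability below \<open>1 / 12\<close> contribute \<open>r / 4\<close> each, hence
      \<open>r \<le> T + r / 2\<close> with \<open>T\<close> independent of
      \<open>n\<close>.\<close>
    have pt: "S n f \<le> ennreal (real T) + (ennreal (1 / (12 * r)) * (S n f * S n f) + ennreal (3 * r) * indicator (B T) f)"
      if f: "f \<in> space M" for f
    proof -
      have "S n f \<le> (\<integral>\<^sup>+x. ennreal ((f x)\<^sup>2) \<partial>P)"
        unfolding S_def u_def by (intro nn_integral_mono ennreal_leI) (auto simp: indicator_def)
      also have "\<dots> = ennreal (ip P f f)"
        using f F_sqint by (intro nn_integral_ip) (simp add: space_M)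
      finally have le: "S n f \<le> ennreal (ip P f f)" .
      define q where "q = enn2real (S n f)"
      have Sq: "S n f = ennreal q" using le by (simp add: q_def le_less_trans)
      have q0: "0 \<le> q" by (simp add: q_def)
      show ?thesis
      proof (cases "f \<in> B T")
        case True
        have "0 \<le> (q - 6 * r)\<^sup>2" by simp
        then have "q * (12 * r) \<le> q * q + 3 * r * (12 * r)" by (simp add: power2_eq_square algebra_simps)
        then have "q \<le> (q * q + 3 * r * (12 * r)) / (12 * r)" using r by (simp add: pos_le_divide_eq)
        also have "\<dots> = 1 / (12 * r) * (q * q) + 3 * r" using r by (simp add: add_divide_distrib)
        finally have "q \<le> real T + (1 / (12 * r) * (q * q) + 3 * r)" by simp
        then have "ennreal q \<le> ennreal (real T + (1 / (12 * r) * (q * q) + 3 * r))" by (rule ennreal_leI)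
        then show ?thesis using True r q0
          by (simp add: Sq ennreal_mult[symmetric] ennreal_plus[symmetric] del: ennreal_plus)
      next
        case False
        then have "ip P f f \<le> real T" using f by (simp add: B_def)
        then have "S n f \<le> ennreal (real T)" using le by (meson ennreal_leI order_trans)
        then show ?thesis by (simp add: add_increasing2)
      qed
    qed
    have "s n \<le> (\<integral>\<^sup>+f. ennreal (real T) + (ennreal (1 / (12 * r)) * (S n f * S n f) + ennreal (3 * r) * indicator (B T) f) \<partial>M)"
      unfolding ES[symmetric] by (rule nn_integral_mono) (rule pt)
    also have "\<dots> = ennreal (real T) + (ennreal (1 / (12 * r)) * (\<integral>\<^sup>+f. S n f * S n f \<partial>M) + ennreal (3 * r) * emeasure M (B T))"
      by (simp add: nn_integral_add nn_integral_cmult M.emeasure_space_1)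
    also have "\<dots> \<le> ennreal (real T) + (ennreal (1 / (12 * r)) * (3 * (s n * s n)) + ennreal (3 * r) * ennreal (1 / 12))"
      using ES2 T by (intro add_mono mult_left_mono order_refl) (auto simp: M.emeasure_eq_measure intro!: ennreal_leI)
    also have "\<dots> = ennreal (real T + (1 / (12 * r) * (3 * (r * r)) + 3 * r * (1 / 12)))"
    proof -
      have 3: "3 * (s n * s n) = ennreal (3 * (r * r))"
        using r unfolding sr by (simp add: ennreal_mult)
      show ?thesis
        using r unfolding 3 by (simp add: ennreal_mult[symmetric] ennreal_plus[symmetric] del: ennreal_plus)
    qed
    also have "real T + (1 / (12 * r) * (3 * (r * r)) + 3 * r * (1 / 12)) = real T + r / 2"
      using r by (simp add: field_simps)
    finally have "r \<le> real T + r / 2" using r unfolding sr by (subst (asm) ennreal_le_iff) auto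
    then show ?thesis unfolding sr by (intro ennreal_leI) simp
  qed simp
  have "mean_sq M P (\<lambda>f. f) = (\<integral>\<^sup>+x. ennreal (v x) \<partial>P)"
    using mean_sq_swap(1)[OF base_measures rfun_id] by (simp add: ev)
  also have "\<dots> = (\<integral>\<^sup>+x. (SUP n. ennreal (indicator (A n) x * v x)) \<partial>P)"
  proof (rule nn_integral_cong)
    fix x assume x: "x \<in> space P"
    obtain n :: nat where "v x \<le> real n" using real_arch_simple by blast
    then have "x \<in> A n" using x by (simp add: A_def)
    then have "ennreal (v x) = ennreal (indicator (A n) x * v x)" by simp
    also have "\<dots> \<le> (SUP n. ennreal (indicator (A n) x * v x))" by (rule SUP_upper) simp
    finally show "ennreal (v x) = (SUP n. ennreal (indicator (A n) x * v x))"
      using v0[of x] by (intro antisym SUP_least ennreal_leI) (auto simp: indicator_def)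
  qed
  also have "\<dots> = (SUP n. s n)"
    unfolding s_def using v0
    by (intro nn_integral_monotone_convergence_SUP)
      (auto simp: incseq_def le_fun_def A_def indicator_def intro!: ennreal_leI)
  also have "\<dots> \<le> ennreal (2 * real T)" by (rule SUP_least) (rule s_le)
  finally show ?thesis by (rule le_less_trans) simp
qed

text \<open>Orthonormalising longer and longer pieces of a dense sequence makes the projection error
  of every single \<open>f\<close> tend to 0. It is dominated by the squared norm, whose mean is
  finite, so the mean error tends to 0 as well. This takes the place of a spectral decomposition of
  the covariance.\<close>

lemma finite_rank_approximation:
  assumes \<eta>: "\<eta> > 0"
  shows "\<exists>(J :: nat set) e. onsys P J e \<and> mean_sq M P (\<lambda>f x. f x - proj P J e f x) \<le> ennreal \<eta>"
proof -
  obtain s :: "nat \<Rightarrow> fn" where sF: "\<And>n. s n \<in> F d"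
    and dense: "\<And>f e. f \<in> F d \<Longrightarrow> e > 0 \<Longrightarrow> \<exists>n. N d (\<lambda>x. f x - s n x) < e"
    using dense_sequence by blast
  have "\<exists>(J :: nat set) e. onsys P J e \<and> (\<forall>i<n. AE x in P. s i x = proj P J e (s i) x)" for n
  proof -
    obtain A J where "J \<subseteq> {..<n} \<and> onsys P J (\<lambda>j x. \<Sum>i<n. A j i * s i x) \<and>
      (\<forall>i<n. AE x in P. s i x = proj P J (\<lambda>j x. \<Sum>i<n. A j i * s i x) (s i) x)"
      using Gram_Schmidt[of n P s, OF F_sqint[OF sF]] by (elim exE) (rule that)
    note * = conjunct2[OF this]
    show ?thesis by (rule exI[of _ J], rule exI[of _ "\<lambda>j x. \<Sum>i<n. A j i * s i x"], rule *)
  qed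
  then obtain J :: "nat \<Rightarrow> nat set" and e where on: "\<And>n. onsys P (J n) (e n)"
    and rep: "\<And>n i. i < n \<Longrightarrow> AE x in P. s i x = proj P (J n) (e n) (s i) x"
    by metis
  define R where "R = (\<lambda>n f. ip P (\<lambda>x. f x - proj P (J n) (e n) f x) (\<lambda>x. f x - proj P (J n) (e n) f x))"
  have R_eq: "R n f = ip P f f - (\<Sum>i\<in>J n. (ip P f (e n i))\<^sup>2)" if "f \<in> F d" for n f
    using Bessel[OF on[of n] F_sqint[OF that]] by (simp add: R_def)
  have R_le: "R n f \<le> ip P f f" if "f \<in> F d" for n f
    using R_eq[OF that, of n] by (simp add: sum_nonneg)
  have R_lim: "(\<lambda>n. R n f) \<longlonglongrightarrow> 0" if f: "f \<in> F d" for f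
  proof (rule LIMSEQ_I)
    fix r :: real assume r: "r > 0"
    obtain c where c: "\<And>f. f \<in> F d \<Longrightarrow> Gnorm D \<rho> d f \<le> c * N d f" using embed by blast
    obtain i where i: "N d (\<lambda>x. f x - s i x) < sqrt r / (\<bar>c\<bar> + 1)"
      using dense[OF f, of "sqrt r / (\<bar>c\<bar> + 1)"] r by auto
    have h: "(\<lambda>x. f x - s i x) \<in> F d" by (rule F_diff[OF f sF])
    have "sqrt (ip P (\<lambda>x. f x - s i x) (\<lambda>x. f x - s i x)) \<le> c * N d (\<lambda>x. f x - s i x)"
      using c[OF h] by (simp add: Gnorm_ip F_sqint[OF h])
    also have "\<dots> \<le> (\<bar>c\<bar> + 1) * N d (\<lambda>x. f x - s i x)"
      using N_nonneg[OF h] by (intro mult_right_mono) auto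
    also have "\<dots> < sqrt r" using i by (simp add: field_simps)
    finally have small: "ip P (\<lambda>x. f x - s i x) (\<lambda>x. f x - s i x) < r" by simp
    \<comment> \<open>The \<open>n\<close>-th system represents \<open>s i\<close> for
      \<open>i < n\<close> only, hence the index \<open>Suc i\<close>.\<close>
    have "norm (R n f - 0) < r" if n: "n \<ge> Suc i" for n
    proof -
      have "R n f \<le> ip P (\<lambda>x. f x - s i x) (\<lambda>x. f x - s i x)"
        unfolding R_def
        by (rule proj_minimal[OF on F_sqint[OF f] F_sqint[OF sF], where c = "\<lambda>j. ip P (s i) (e n j)"])
          (use rep[of i n] n in \<open>simp add: proj_def\<close>)
      moreover have "0 \<le> R n f" by (simp add: R_def)
      ultimately show ?thesis using small by simp
    qed
    then show "\<exists>no. \<forall>n\<ge>no. norm (R n f - 0) < r" by blast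
  qed
  have Rm: "R n \<in> borel_measurable M" for n
  proof -
    have "(\<lambda>f. ip P f f - (\<Sum>i\<in>J n. (ip P f (e n i))\<^sup>2)) \<in> borel_measurable M"
      using norm_sq_measurable on[of n]
      by (intro borel_measurable_diff borel_measurable_sum borel_measurable_power clf_measurable[OF clf_ip])
        (auto simp: onsys_def)
    then show ?thesis
      by (subst measurable_cong[of M _ "\<lambda>f. ip P f f - (\<Sum>i\<in>J n. (ip P f (e n i))\<^sup>2)"])
        (auto simp: R_eq space_M)
  qed
  have "(\<lambda>n. \<integral>\<^sup>+f. ennreal (R n f) \<partial>M) \<longlonglongrightarrow> (\<integral>\<^sup>+f. 0 \<partial>M)"
  proof (rule nn_integral_dominated_convergence[where w = "\<lambda>f. ennreal (ip P f f)"])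
    show "(\<integral>\<^sup>+f. ennreal (ip P f f) \<partial>M) < \<infinity>"
      using second_moment_finite mean_sq_eq[OF rfun_id] by simp
    show "AE f in M. ennreal (R n f) \<le> ennreal (ip P f f)" for n
      by (rule AE_I2) (simp add: space_M ennreal_leI R_le)
    show "AE f in M. (\<lambda>n. ennreal (R n f)) \<longlonglongrightarrow> 0"
      by (rule AE_I2) (use R_lim in \<open>auto simp: space_M simp flip: ennreal_0 intro!: tendsto_ennrealI\<close>)
  qed (use Rm norm_sq_measurable in auto)
  then have "\<forall>\<^sub>F n in sequentially. (\<integral>\<^sup>+f. ennreal (R n f) \<partial>M) < ennreal \<eta>"
    using \<eta> by (intro order_tendstoD(2)[of _ 0]) (auto simp: ennreal_zero_less_mult_iff)
  then obtain n where n: "(\<integral>\<^sup>+f. ennreal (R n f) \<partial>M) < ennreal \<eta>"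
    by (auto simp: eventually_sequentially)
  have "mean_sq M P (\<lambda>f x. f x - proj P (J n) (e n) f x) = (\<integral>\<^sup>+f. ennreal (R n f) \<partial>M)"
    unfolding mean_sq_def R_def
    by (rule nn_integral_cong, rule nn_integral_ip) (auto simp: space_M F_sqint on intro!: sqint_diff)
  then show ?thesis using n on[of n] by (intro exI[of _ "J n"] exI[of _ "e n"]) simp
qed

text \<open>If the right side is finite, \<open>h\<close> of the data is the difference of two
  square integrable variables and orthogonal to \<open>Z\<close>, so subtracting it only adds its
  own second moment. In other words, the best prediction of \<open>Z\<close> from the data is
  0.\<close>

lemma gaussian_residual_le:
  fixes n :: nat
  assumes Y: "\<And>i. i < n \<Longrightarrow> clf (Y i)" and Z: "clf Z" and ZY: "\<And>i. i < n \<Longrightarrow> ip M Z (Y i) = 0"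
    and h[measurable]: "h \<in> borel_measurable (PiM {..<n} (\<lambda>_. borel))"
  shows "(\<integral>\<^sup>+f. ennreal ((Z f)\<^sup>2) \<partial>M) \<le> (\<integral>\<^sup>+f. ennreal ((Z f - h (\<lambda>i\<in>{..<n}. Y i f))\<^sup>2) \<partial>M)"
proof (cases "(\<integral>\<^sup>+f. ennreal ((Z f - h (\<lambda>i\<in>{..<n}. Y i f))\<^sup>2) \<partial>M) = \<infinity>")
  case False
  let ?h = "\<lambda>f. h (\<lambda>i\<in>{..<n}. Y i f)"
  have sZ: "sqint M Z" by (rule clf_gaussian(1)[OF Z])
  have [measurable]: "Z \<in> borel_measurable M" by (rule clf_measurable[OF Z])
  have [measurable]: "(\<lambda>f. \<lambda>i\<in>{..<n}. Y i f) \<in> measurable M (PiM {..<n} (\<lambda>_. borel))"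
    by (rule measurable_restrict) (use Y clf_measurable in auto)
  have sZh: "sqint M (\<lambda>f. Z f - ?h f)"
    using False by (auto simp: sqint_iff_nn_integral less_top)
  have "sqint M (\<lambda>f. Z f - (Z f - ?h f))" by (rule sqint_diff[OF sZ sZh])
  then have sh: "sqint M ?h" by simp
  have "ip M Z ?h = 0" by (rule gaussian_uncorrelated[OF Y Z ZY h sh])
  then have "ip M Z Z \<le> ip M (\<lambda>f. Z f - ?h f) (\<lambda>f. Z f - ?h f)"
    using ip_diff_self[OF sZ sh] by simp
  then show ?thesis by (simp add: nn_integral_ip sZ sZh ennreal_leI)
qed simp

text \<open>Along a finite system \<open>b\<close> capturing \<open>f\<close> up to \<eta>, each
  coefficient is its projection onto the span of the data plus a remainder \<open>Z l\<close>
  uncorrelated with the data. No function of the data can reduce the remainders, so their total mean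
  square is at most the error of \<phi>. Keeping only the projections gives approximants in the span
  of \<open>n\<close> fixed functions, and the orthogonal projection of \<open>f\<close> onto this
  span is at least as good.\<close>

lemma kernel_of_algorithm:
  assumes L: "\<forall>i<n. L i \<in> Lall F N d"
    and \<phi>: "\<phi> \<in> measurable (PiM {..<n} (\<lambda>_. borel)) (borel_of (G_set D \<rho> d) (Gnorm D \<rho> d))"
    and \<eta>: "\<eta> > 0"
  shows "\<exists>m k. m \<le> n \<and> proj_kernel P k (real m) \<and>
    mean_sq M P (\<lambda>f y. f y - kop P k f y) \<le> alg_err2 D \<rho> \<mu> d n L \<phi> + ennreal \<eta>"
proof -
  have clf: "clf (L i)" if "i < n" for i using L that by (simp add: Lall_def)
  obtain J :: "nat set" and b where b: "onsys P J b"
    and approx: "mean_sq M P (\<lambda>f x. f x - proj P J b f x) \<le> ennreal \<eta>"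
    using finite_rank_approximation[OF \<eta>] by blast
  have [simp]: "finite J" using b by (simp add: onsys_def)
  obtain A K where K: "K \<subseteq> {..<n}" and on: "onsys M K (\<lambda>j f. \<Sum>i<n. A j i * L i f)"
    and rep: "\<forall>i<n. AE f in M. L i f = proj M K (\<lambda>j f. \<Sum>i<n. A j i * L i f) (L i) f"
    using Gram_Schmidt[of n M L] clf clf_gaussian(1) by blast
  define L' where "L' = (\<lambda>j f. \<Sum>i<n. A j i * L i f)"
  have on': "onsys M K L'" using on by (simp add: L'_def)
  have [simp]: "finite K" using on' by (simp add: onsys_def)
  have clf': "clf (L' j)" for j unfolding L'_def by (rule clf_sum) (use clf in auto)
  define g where "g = (\<lambda>l f. ip P f (b l))"
  have clg: "clf (g l)" if "l \<in> J" for l unfolding g_def by (rule clf_ip) (use b that in \<open>simp add: onsys_def\<close>)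
  \<comment> \<open>Extended by 0 outside \<open>K\<close>, so that sums can run over all
    \<open>j < n\<close>.\<close>
  define c where "c = (\<lambda>j l. if j \<in> K then ip M (g l) (L' j) else 0)"
  define Z where "Z = (\<lambda>l f. g l f - (\<Sum>j<n. c j l * L' j f))"
  have Zproj: "Z l f = g l f - proj M K L' (g l) f" for l f
  proof -
    have "(\<Sum>j<n. c j l * L' j f) = (\<Sum>j\<in>K. c j l * L' j f)"
      using K by (intro sum.mono_neutral_right) (auto simp: c_def)
    then show ?thesis by (simp add: Z_def proj_def c_def)
  qed
  have clZ: "clf (Z l)" if "l \<in> J" for l
    using clf_lincomb[OF clg[OF that] clf_sum[of "{..<n}" L' "\<lambda>j. c j l"], of 1 "-1"] clf' by (simp add: Z_def[abs_def])
  have ZL: "ip M (Z l) (L i) = 0" if l: "l \<in> J" and i: "i < n" for l i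
  proof -
    \<comment> \<open>\<open>L i\<close> agrees almost everywhere with a combination of the
      \<open>L' j\<close>, and \<open>Z l\<close> is orthogonal to these by construction.\<close>
    have "ip M (Z l) (L i) = ip M (proj M K L' (L i)) (Z l)"
      using rep i clf_measurable[OF clf[OF i]] clf_measurable[OF clZ[OF l]] sqint_proj[OF on', of "L i"]
      by (subst ip_commute) (intro ip_cong_AE, auto simp: L'_def sqint_def)
    also have "\<dots> = ip M (Z l) (\<lambda>f. \<Sum>j\<in>K. ip M (L i) (L' j) * L' j f)"
      by (simp add: ip_commute[of M _ "Z l"] proj_def)
    also have "\<dots> = 0"
      using ip_minus_proj_comb[OF on' clf_gaussian(1)[OF clg[OF l]]] by (simp add: Zproj[abs_def])
    finally show ?thesis .
  qed
  \<comment> \<open>Coefficient \<open>l\<close> of the output of \<phi> minus the linear estimate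
    already subtracted in \<open>Z l\<close>. Thus \<open>Z l f - h l (?Y f)\<close> is the
    coefficient of the actual error along \<open>b l\<close>, and Bessel's inequality bounds the sum
    of squares by the error.\<close>
  define h where "h = (\<lambda>l y. ip P (\<phi> y) (b l) - (\<Sum>j<n. c j l * (\<Sum>i<n. A j i * y i)))"
  let ?Y = "\<lambda>f. \<lambda>i\<in>{..<n}. L i f"
  have hm: "h l \<in> borel_measurable (PiM {..<n} (\<lambda>_. borel))" if "l \<in> J" for l
  proof -
    have [measurable]: "(\<lambda>y. ip P (\<phi> y) (b l)) \<in> borel_measurable (PiM {..<n} (\<lambda>_. borel))"
      by (rule measurable_compose[OF \<phi> G_ip_measurable]) (use b that in \<open>simp add: onsys_def\<close>)
    show ?thesis unfolding h_def by measurable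
  qed
  have \<phi>sq: "sqint P (\<phi> (?Y f))" for f
  proof -
    have "?Y f \<in> space (PiM {..<n} (\<lambda>_. borel))" by (simp add: space_PiM)
    then have "\<phi> (?Y f) \<in> space (borel_of (G_set D \<rho> d) (Gnorm D \<rho> d))"
      using measurable_space[OF \<phi>] by blast
    then show ?thesis by (simp add: space_borel_of G_set_iff)
  qed
  have nsum: "(\<integral>\<^sup>+f. ennreal (\<Sum>l\<in>J. (W l f)\<^sup>2) \<partial>M) = (\<Sum>l\<in>J. \<integral>\<^sup>+f. ennreal ((W l f)\<^sup>2) \<partial>M)"
    if "\<And>l. l \<in> J \<Longrightarrow> W l \<in> borel_measurable M" for W :: "nat \<Rightarrow> fn \<Rightarrow> real"
  proof -
    have "(\<integral>\<^sup>+f. (\<Sum>l\<in>J. ennreal ((W l f)\<^sup>2)) \<partial>M) = (\<Sum>l\<in>J. \<integral>\<^sup>+f. ennreal ((W l f)\<^sup>2) \<partial>M)"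
    proof (rule nn_integral_sum)
      fix l assume "l \<in> J"
      then have [measurable]: "W l \<in> borel_measurable M" by (rule that)
      show "(\<lambda>f. ennreal ((W l f)\<^sup>2)) \<in> borel_measurable M" by measurable
    qed
    then show ?thesis by (simp add: sum_ennreal)
  qed
  have "(\<integral>\<^sup>+f. ennreal (\<Sum>l\<in>J. (Z l f)\<^sup>2) \<partial>M) = (\<Sum>l\<in>J. \<integral>\<^sup>+f. ennreal ((Z l f)\<^sup>2) \<partial>M)"
    by (rule nsum) (rule clf_measurable[OF clZ])
  also have "\<dots> \<le> (\<Sum>l\<in>J. \<integral>\<^sup>+f. ennreal ((Z l f - h l (?Y f))\<^sup>2) \<partial>M)"
    by (intro sum_mono gaussian_residual_le) (use clf clZ ZL hm in auto)
  also have "\<dots> = (\<integral>\<^sup>+f. ennreal (\<Sum>l\<in>J. (Z l f - h l (?Y f))\<^sup>2) \<partial>M)"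
  proof -
    have [measurable]: "?Y \<in> measurable M (PiM {..<n} (\<lambda>_. borel))"
      by (rule measurable_restrict) (use clf clf_measurable in auto)
    have "(\<lambda>f. h l (?Y f)) \<in> borel_measurable M" if "l \<in> J" for l
      using measurable_compose[OF _ hm[OF that]] by measurable
    then have "(\<lambda>f. Z l f - h l (?Y f)) \<in> borel_measurable M" if "l \<in> J" for l
      using clf_measurable[OF clZ[OF that]] that by (intro borel_measurable_diff)
    then show ?thesis by (rule nsum[symmetric])
  qed
  also have "\<dots> \<le> alg_err2 D \<rho> \<mu> d n L \<phi>"
    unfolding alg_err2_def
  proof (rule nn_integral_mono)
    fix f assume "f \<in> space M"
    then have f: "sqint P f" using F_sqint by (simp add: space_M)
    let ?r = "\<lambda>x. f x - \<phi> (?Y f) x"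
    have r: "sqint P ?r" using f \<phi>sq by blast
    have "Z l f - h l (?Y f) = ip P ?r (b l)" if l: "l \<in> J" for l
    proof -
      have "(\<Sum>i<n. A j i * ?Y f i) = L' j f" for j by (simp add: L'_def)
      then show ?thesis
        using f \<phi>sq b l by (simp add: Z_def h_def g_def ip_diff_left onsys_def)
    qed
    then have "(\<Sum>l\<in>J. (Z l f - h l (?Y f))\<^sup>2) = (\<Sum>l\<in>J. (ip P ?r (b l))\<^sup>2)" by simp
    also have "\<dots> \<le> ip P ?r ?r" by (rule Bessel_ineq[OF b r])
    finally show "ennreal (\<Sum>l\<in>J. (Z l f - h l (?Y f))\<^sup>2) \<le> Gnorm2 D \<rho> d ?r"
      by (simp add: Gnorm2_ip[OF r] ennreal_leI)
  qed
  finally have low: "(\<integral>\<^sup>+f. ennreal (\<Sum>l\<in>J. (Z l f)\<^sup>2) \<partial>M) \<le> alg_err2 D \<rho> \<mu> d n L \<phi>" .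
  \<comment> \<open>The function that multiplies the datum \<open>L' j f\<close> in the linear
    estimate. These \<open>n\<close> functions span the desired subspace, whose dimension may be
    smaller than \<open>n\<close>.\<close>
  define k where "k = (\<lambda>j x. \<Sum>l\<in>J. c j l * b l x)"
  have sk: "sqint P (k j)" for j unfolding k_def using b by (auto simp: onsys_def)
  obtain A' J' where J': "J' \<subseteq> {..<n}" and on2: "onsys P J' (\<lambda>j x. \<Sum>i<n. A' j i * k i x)"
    and rep2: "\<forall>i<n. AE x in P. k i x = proj P J' (\<lambda>j x. \<Sum>i<n. A' j i * k i x) (k i) x"
    using Gram_Schmidt[of n P k] sk by blast
  define e where "e = (\<lambda>j x. \<Sum>i<n. A' j i * k i x)"
  have one: "onsys P J' e" using on2 by (simp add: e_def)
  let ?k = "\<lambda>x y. \<Sum>i\<in>J'. e i x * e i y"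
  have "mean_sq M P (\<lambda>f y. f y - kop P ?k f y)
      \<le> (\<integral>\<^sup>+f. (\<integral>\<^sup>+x. ennreal ((f x - proj P J b f x)\<^sup>2) \<partial>P) + ennreal (\<Sum>l\<in>J. (Z l f)\<^sup>2) \<partial>M)"
    unfolding mean_sq_def
  proof (rule nn_integral_mono)
    fix f assume "f \<in> space M"
    then have f: "sqint P f" using F_sqint by (simp add: space_M)
    \<comment> \<open>The linear estimate of \<open>f\<close>: for every \<open>f\<close> a
      combination of the \<open>k j\<close>, hence almost everywhere one of the
      \<open>e i\<close>.\<close>
    let ?u = "\<lambda>x. \<Sum>l\<in>J. (\<Sum>j<n. c j l * L' j f) * b l x"
    have u: "sqint P ?u" using b by (auto simp: onsys_def)
    have uk: "?u x = (\<Sum>j<n. L' j f * k j x)" for x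
      unfolding k_def sum_distrib_left sum_distrib_right
      by (subst sum.swap) (simp add: ac_simps)
    have "AE x in P. \<forall>i<n. k i x = proj P J' e (k i) x"
      using rep2 by (simp add: AE_all_countable e_def)
    then have ue: "AE x in P. ?u x = (\<Sum>i\<in>J'. (\<Sum>j<n. L' j f * ip P (k j) (e i)) * e i x)"
    proof eventually_elim
      case (elim x)
      have "?u x = (\<Sum>j<n. L' j f * proj P J' e (k j) x)"
        unfolding uk using elim by (intro sum.cong) auto
      also have "\<dots> = (\<Sum>i\<in>J'. (\<Sum>j<n. L' j f * ip P (k j) (e i)) * e i x)"
        unfolding proj_def sum_distrib_left sum_distrib_right
        by (subst sum.swap) (simp add: ac_simps)
      finally show ?case .
    qed
    have r: "sqint P (\<lambda>x. f x - proj P J' e f x)" using f one by blast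
    have rb: "sqint P (\<lambda>x. f x - proj P J b f x)" using f b by blast
    have "ip P (\<lambda>x. f x - proj P J' e f x) (\<lambda>x. f x - proj P J' e f x) \<le> ip P (\<lambda>x. f x - ?u x) (\<lambda>x. f x - ?u x)"
      by (rule proj_minimal[OF one f u ue])
    also have "\<dots> = ip P (\<lambda>x. f x - proj P J b f x) (\<lambda>x. f x - proj P J b f x) + (\<Sum>l\<in>J. (Z l f)\<^sup>2)"
      by (subst proj_pythagoras[OF b f]) (simp add: Z_def g_def)
    finally have "ennreal (ip P (\<lambda>x. f x - proj P J' e f x) (\<lambda>x. f x - proj P J' e f x))
        \<le> ennreal (ip P (\<lambda>x. f x - proj P J b f x) (\<lambda>x. f x - proj P J b f x)) + ennreal (\<Sum>l\<in>J. (Z l f)\<^sup>2)"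
      by (simp add: ennreal_plus[symmetric] sum_nonneg ennreal_leI del: ennreal_plus)
    then show "(\<integral>\<^sup>+x. ennreal ((f x - kop P ?k f x)\<^sup>2) \<partial>P)
        \<le> (\<integral>\<^sup>+x. ennreal ((f x - proj P J b f x)\<^sup>2) \<partial>P) + ennreal (\<Sum>l\<in>J. (Z l f)\<^sup>2)"
      by (simp only: proj_kernel_of_onsys(2)[OF one f] nn_integral_ip[OF r] nn_integral_ip[OF rb])
  qed
  also have "\<dots> = mean_sq M P (\<lambda>f x. f x - proj P J b f x) + (\<integral>\<^sup>+f. ennreal (\<Sum>l\<in>J. (Z l f)\<^sup>2) \<partial>M)"
    unfolding mean_sq_def
  proof (rule nn_integral_add)
    have "rfun M P (\<lambda>f y. f y - kop P (\<lambda>x y. \<Sum>i\<in>J. b i x * b i y) f y)"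
      by (rule rfun_kop(2)[OF base_measures proj_kernel_of_onsys(1)[OF b] rfun_id])
    then have "(\<lambda>f. ip P (\<lambda>y. f y - kop P (\<lambda>x y. \<Sum>i\<in>J. b i x * b i y) f y) (\<lambda>y. f y - kop P (\<lambda>x y. \<Sum>i\<in>J. b i x * b i y) f y)) \<in> borel_measurable M"
      by (rule ip_self_measurable[OF base_measures])
    then have "(\<lambda>f. ennreal (ip P (\<lambda>y. f y - kop P (\<lambda>x y. \<Sum>i\<in>J. b i x * b i y) f y) (\<lambda>y. f y - kop P (\<lambda>x y. \<Sum>i\<in>J. b i x * b i y) f y))) \<in> borel_measurable M"
      by measurable
    moreover have "ennreal (ip P (\<lambda>y. f y - kop P (\<lambda>x y. \<Sum>i\<in>J. b i x * b i y) f y) (\<lambda>y. f y - kop P (\<lambda>x y. \<Sum>i\<in>J. b i x * b i y) f y))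
        = (\<integral>\<^sup>+x. ennreal ((f x - proj P J b f x)\<^sup>2) \<partial>P)" if "f \<in> space M" for f
    proof -
      have f: "sqint P f" using F_sqint that by (simp add: space_M)
      have rb: "sqint P (\<lambda>x. f x - proj P J b f x)" using f b by blast
      show ?thesis by (simp only: proj_kernel_of_onsys(2)[OF b f] nn_integral_ip[OF rb])
    qed
    ultimately show "(\<lambda>f. \<integral>\<^sup>+x. ennreal ((f x - proj P J b f x)\<^sup>2) \<partial>P) \<in> borel_measurable M"
      by (subst (asm) measurable_cong) auto
    show "(\<lambda>f. ennreal (\<Sum>l\<in>J. (Z l f)\<^sup>2)) \<in> borel_measurable M"
      using clZ clf_measurable by (intro measurable_compose[OF _ measurable_ennreal] borel_measurable_sum borel_measurable_power) auto
  qed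
  also have "\<dots> \<le> ennreal \<eta> + alg_err2 D \<rho> \<mu> d n L \<phi>"
    by (rule add_mono[OF approx low])
  finally have "mean_sq M P (\<lambda>f y. f y - kop P ?k f y) \<le> alg_err2 D \<rho> \<mu> d n L \<phi> + ennreal \<eta>"
    by (simp only: add.commute)
  moreover have "card J' \<le> n" using card_mono[OF _ J'] by simp
  ultimately show ?thesis using proj_kernel_of_onsys(1)[OF one] by blast
qed

end

section \<open>From a subspace to function values\<close>

lemma ip_sum_sum:
  assumes "\<And>i. i < (n::nat) \<Longrightarrow> sqint P (a i)"
  shows "ip P (\<lambda>x. \<Sum>i<n. c i * a i x) (\<lambda>x. \<Sum>i<n. c i * a i x) = (\<Sum>i<n. \<Sum>j<n. c i * (c j * ip P (a i) (a j)))"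
proof -
  have "ip P (\<lambda>x. \<Sum>i<n. c i * a i x) (\<lambda>x. \<Sum>i<n. c i * a i x)
      = (\<Sum>i<n. ip P (\<lambda>x. c i * a i x) (\<lambda>x. \<Sum>i<n. c i * a i x))"
    using assms by (subst ip_sum_left) auto
  also have "\<dots> = (\<Sum>i<n. \<Sum>j<n. ip P (\<lambda>x. c i * a i x) (\<lambda>x. c j * a j x))"
    using assms by (intro sum.cong refl ip_sum_right) auto
  finally show ?thesis by simp
qed

context avg_app
begin

text \<open>The map is continuous from sequences with the product topology into G, so preimages of
  norm open sets are open.\<close>

lemma linear_combination_measurable:
  fixes n :: nat
  assumes a: "\<And>i. i < n \<Longrightarrow> sqint P (a i)"
  shows "(\<lambda>y x. \<Sum>i<n. y i * a i x) \<in> measurable (PiM {..<n} (\<lambda>_. borel)) (borel_of (G_set D \<rho> d) (Gnorm D \<rho> d))"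
proof -
  let ?G = "G_set D \<rho> d" and ?N = "Gnorm D \<rho> d"
  define \<Theta> where "\<Theta> = (\<lambda>(y :: nat \<Rightarrow> real) x. \<Sum>i<n. y i * a i x)"
  have \<Theta>sq: "sqint P (\<Theta> y)" for y unfolding \<Theta>_def using a by auto
  have op: "open {y. \<Theta> y \<in> U}" if U: "nopen ?G ?N U" for U
  proof (subst open_subopen, intro ballI)
    fix y assume "y \<in> {y. \<Theta> y \<in> U}"
    then obtain r where r: "r > 0" "\<And>g. g \<in> ?G \<Longrightarrow> ?N (\<lambda>x. g x - \<Theta> y x) < r \<Longrightarrow> g \<in> U"
      using U unfolding nopen_def by blast
    \<comment> \<open>Squared distance in G between the images of \<open>y'\<close> and
      \<open>y\<close>, a quadratic form in the Gram matrix of the \<open>a i\<close>; it involves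
      finitely many coordinates and is therefore continuous.\<close>
    define q where "q = (\<lambda>y'. \<Sum>i<n. \<Sum>j<n. (y' i - y i) * ((y' j - y j) * ip P (a i) (a j)))"
    have "continuous_on UNIV q"
      unfolding q_def by (intro continuous_intros continuous_on_product_coordinates)
    then have "open {y'. q y' < r\<^sup>2}" by (intro open_Collect_less continuous_intros)
    moreover have "y \<in> {y'. q y' < r\<^sup>2}" using r by (simp add: q_def)
    moreover have "\<Theta> y' \<in> U" if "q y' < r\<^sup>2" for y'
    proof (rule r(2))
      show "\<Theta> y' \<in> ?G" by (simp add: G_set_iff \<Theta>sq)
      have "(\<lambda>x. \<Theta> y' x - \<Theta> y x) = (\<lambda>x. \<Sum>i<n. (y' i - y i) * a i x)"
        by (simp add: \<Theta>_def left_diff_distrib sum_subtractf)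
      then have "ip P (\<lambda>x. \<Theta> y' x - \<Theta> y x) (\<lambda>x. \<Theta> y' x - \<Theta> y x) = q y'"
        by (simp only: ip_sum_sum[of n P a, OF a]) (simp add: q_def)
      then show "?N (\<lambda>x. \<Theta> y' x - \<Theta> y x) < r"
        using that r(1) by (subst Gnorm_ip) (auto intro!: sqint_diff \<Theta>sq real_less_lsqrt)
    qed
    ultimately show "\<exists>T. open T \<and> y \<in> T \<and> T \<subseteq> {y. \<Theta> y \<in> U}" by blast
  qed
  have \<Theta>m: "\<Theta> \<in> measurable borel (borel_of ?G ?N)"
  proof (rule measurable_sigma_sets[OF sets_borel_of])
    show "{U. nopen ?G ?N U} \<subseteq> Pow ?G" by (auto simp: nopen_def)
    show "\<Theta> \<in> space borel \<rightarrow> ?G" by (simp add: G_set_iff \<Theta>sq)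
    show "\<Theta> -` U \<inter> space borel \<in> sets borel" if "U \<in> {U. nopen ?G ?N U}" for U
      using op[of U] that by (simp add: vimage_def borel_open)
  qed
  \<comment> \<open>Extension by zero leads from vectors indexed by \<open>{..<n}\<close> to full
    sequences, whose product and Borel sigma-algebras agree.\<close>
  have "(\<lambda>y i. if i < n then y i else 0) \<in> measurable (PiM {..<n} (\<lambda>_. borel)) (PiM UNIV (\<lambda>_::nat. borel :: real measure))"
  proof (rule measurable_PiM_single')
    fix i :: nat
    show "(\<lambda>y. if i < n then y i else 0) \<in> measurable (PiM {..<n} (\<lambda>_. borel)) (borel :: real measure)"
      by (cases "i < n") simp_all
  qed simp
  then have "(\<lambda>y i. if i < n then y i else 0) \<in> measurable (PiM {..<n} (\<lambda>_. borel)) (borel :: (nat \<Rightarrow> real) measure)"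
    using measurable_cong_sets[OF refl sets_PiM_equal_borel] by blast
  from measurable_compose[OF this \<Theta>m] show ?thesis
    by (simp add: \<Theta>_def)
qed

lemma avg_err2_std_le:
  assumes "reduces (D d) (krange P k) n (\<lambda>f. f) H'"
  shows "avg_err2 D \<rho> \<mu> (Lstd D) n d \<le> mean_sq M P H'"
proof -
  have "reduces (D d) {a. sqint P a} n (\<lambda>f. f) H'"
    by (rule reduces_mono[OF assms]) (auto simp: krange_def)
  then have "\<exists>x a. (\<forall>i<n. x i \<in> D d \<and> a i \<in> {a. sqint P a}) \<and> H' = (\<lambda>f y. f y - (\<Sum>i<n. f (x i) * a i y))"
    by (rule reduces_linear_algorithm) auto
  then obtain x a where x: "\<And>i. i < n \<Longrightarrow> x i \<in> D d" and a: "\<And>i. i < n \<Longrightarrow> sqint P (a i)"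
    and H': "H' = (\<lambda>f y. f y - (\<Sum>i<n. f (x i) * a i y))" by blast
  show ?thesis
  \<comment> \<open>Without information the error is by definition that of the zero algorithm, and
    here \<open>H'\<close> is \<open>f\<close> itself.\<close>
  proof (cases "n = 0")
    case True
    then show ?thesis by (simp add: avg_err2_def H' mean_sq_def Gnorm2_def[abs_def])
  next
    case False
    let ?L = "\<lambda>i f. f (x i) :: real" and ?\<phi> = "\<lambda>y z. \<Sum>i<n. y i * a i z"
    have "avg_err2 D \<rho> \<mu> (Lstd D) n d \<le> alg_err2 D \<rho> \<mu> d n ?L ?\<phi>"
      unfolding avg_err2_def if_not_P[OF False]
      by (rule INF_lower2[of "(?L, ?\<phi>)"])
        (use x linear_combination_measurable[OF a] in \<open>auto simp: Lstd_def\<close>)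
    also have "\<dots> = mean_sq M P H'"
      by (simp add: alg_err2_def mean_sq_def Gnorm2_def H')
    finally show ?thesis .
  qed
qed

lemma avg_err2_all_le_std: "avg_err2 D \<rho> \<mu> (Lall F N) n d \<le> avg_err2 D \<rho> \<mu> (Lstd D) n d"
proof (cases "n = 0")
  case False
  have "Lstd D d \<subseteq> Lall F N d"
    using clf_eval by (auto simp: Lstd_def Lall_def)
  then show ?thesis
    unfolding avg_err2_def if_not_P[OF False] by (intro INF_superset_mono) auto
qed (simp add: avg_err2_def)

text \<open>Half of \<open>\<kappa> * e\<^sup>2\<close> pays for an infimum that need not be
  attained, the other half for the finite rank approximation; sampling then contributes the factor
  \<open>1 + 2 * \<kappa>\<close>. For \<open>n = 0\<close> both classes use the zero algorithm, and
  no samples are taken.\<close>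

lemma avg_err2_std_le_all:
  assumes all: "avg_err2 D \<rho> \<mu> (Lall F N) n d \<le> ennreal (e\<^sup>2)" and e: "e > 0" and \<kappa>: "0 < \<kappa>" "\<kappa> \<le> 1"
  shows "\<exists>n'. avg_err2 D \<rho> \<mu> (Lstd D) n' d \<le> ennreal ((1 + 2 * \<kappa>) * ((1 + \<kappa>) * e\<^sup>2)) \<and>
    real n' \<le> (2 + 3 / \<kappa>\<^sup>2) * real n powr (1 + \<kappa>)"
proof (cases "n = 0")
  case True
  have "e\<^sup>2 \<le> (1 + 2 * \<kappa>) * ((1 + \<kappa>) * e\<^sup>2)"
  proof -
    have "1 * (1 * e\<^sup>2) \<le> (1 + 2 * \<kappa>) * ((1 + \<kappa>) * e\<^sup>2)"
      using \<kappa> by (intro mult_mono) auto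
    then show ?thesis by simp
  qed
  then have "avg_err2 D \<rho> \<mu> (Lall F N) 0 d \<le> ennreal ((1 + 2 * \<kappa>) * ((1 + \<kappa>) * e\<^sup>2))"
    using all True by (meson ennreal_leI order_trans)
  then show ?thesis using True by (intro exI[of _ 0]) (simp add: avg_err2_def)
next
  case False
  define \<eta> where "\<eta> = \<kappa> * e\<^sup>2 / 2"
  have \<eta>: "\<eta> > 0" using \<kappa> e by (simp add: \<eta>_def)
  have "avg_err2 D \<rho> \<mu> (Lall F N) n d < ennreal (e\<^sup>2 + \<eta>)"
    using all by (rule le_less_trans) (use \<eta> in \<open>simp add: ennreal_less_iff del: ennreal_plus\<close>)
  then obtain L \<phi> where L: "\<forall>i<n. L i \<in> Lall F N d"
    and \<phi>: "\<phi> \<in> measurable (PiM {..<n} (\<lambda>_. borel)) (borel_of (G_set D \<rho> d) (Gnorm D \<rho> d))"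
    and err: "alg_err2 D \<rho> \<mu> d n L \<phi> < ennreal (e\<^sup>2 + \<eta>)"
    unfolding avg_err2_def if_not_P[OF False] INF_less_iff by auto
  obtain m k where m: "m \<le> n" and k: "proj_kernel P k (real m)"
    and res: "mean_sq M P (\<lambda>f y. f y - kop P k f y) \<le> alg_err2 D \<rho> \<mu> d n L \<phi> + ennreal \<eta>"
    using kernel_of_algorithm[OF L \<phi> \<eta>] by blast
  have "alg_err2 D \<rho> \<mu> d n L \<phi> + ennreal \<eta> \<le> ennreal (e\<^sup>2 + \<eta>) + ennreal \<eta>"
    using err by (intro add_right_mono) simp
  also have "\<dots> = ennreal ((1 + \<kappa>) * e\<^sup>2)"
    using \<eta> by (simp add: ennreal_plus[symmetric] \<eta>_def distrib_right del: ennreal_plus)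
  finally have res': "mean_sq M P (\<lambda>f y. f y - kop P k f y) \<le> ennreal ((1 + \<kappa>) * e\<^sup>2)"
    using res by (rule order_trans[rotated])
  then have fin: "mean_sq M P (\<lambda>f y. f y - kop P k f y) < \<infinity>" by (rule le_less_trans) simp
  have "\<exists>n' H'. reduces (D d) (krange P k) n' (\<lambda>f. f) H' \<and>
      mean_sq M P H' \<le> ennreal (1 + 2 * \<kappa>) * mean_sq M P (\<lambda>f y. f y - kop P k f y) \<and>
      real n' \<le> (2 + 3 / \<kappa>\<^sup>2) * real n powr (1 + \<kappa>)"
  \<comment> \<open>The Kaczmarz steps require positive dimension; in dimension 0, interpolation at
    no points already has the factor 1.\<close>
  proof (cases "m = 0")
    case True
    obtain H' where H': "reduces (D d) (krange P k) m (\<lambda>f. f) H'"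
      "mean_sq M P H' \<le> ennreal (real m + 1) * mean_sq M P (\<lambda>f y. f y - kop P k f y)"
      using stable_interpolation[OF base_measures k rfun_id fin] by blast
    have "ennreal (real m + 1) * mean_sq M P (\<lambda>f y. f y - kop P k f y)
        \<le> ennreal (1 + 2 * \<kappa>) * mean_sq M P (\<lambda>f y. f y - kop P k f y)"
      using True \<kappa> by (intro mult_right_mono ennreal_leI) auto
    then have "mean_sq M P H' \<le> ennreal (1 + 2 * \<kappa>) * mean_sq M P (\<lambda>f y. f y - kop P k f y)"
      using H'(2) by (rule order_trans[rotated])
    then show ?thesis using H'(1) True by (intro exI[of _ 0] exI[of _ H']) simp
  next
    case False
    then have m1: "1 \<le> m" by simp
    obtain j where j: "(1 - \<kappa> / real m) ^ j * (real m + 1) \<le> \<kappa>"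
      and cnt: "real (j + m) \<le> (2 + 3 / \<kappa>\<^sup>2) * real n powr (1 + \<kappa>)"
      using sample_count[OF \<kappa> m1 m] by blast
    show ?thesis
      using sampling_reduction[OF base_measures k m1 rfun_id \<kappa> fin j] cnt by blast
  qed
  then obtain n' H' where H': "reduces (D d) (krange P k) n' (\<lambda>f. f) H'"
    and le: "mean_sq M P H' \<le> ennreal (1 + 2 * \<kappa>) * mean_sq M P (\<lambda>f y. f y - kop P k f y)"
    and n': "real n' \<le> (2 + 3 / \<kappa>\<^sup>2) * real n powr (1 + \<kappa>)" by blast
  have "avg_err2 D \<rho> \<mu> (Lstd D) n' d \<le> mean_sq M P H'" by (rule avg_err2_std_le[OF H'])
  also have "\<dots> \<le> ennreal (1 + 2 * \<kappa>) * ennreal ((1 + \<kappa>) * e\<^sup>2)"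
    using le res' by (meson mult_left_mono order_trans zero_le)
  also have "\<dots> = ennreal ((1 + 2 * \<kappa>) * ((1 + \<kappa>) * e\<^sup>2))"
    using \<kappa> by (intro ennreal_mult[symmetric]) auto
  finally show ?thesis using n' by blast
qed

end

section \<open>Information complexity and exponents\<close>

lemma nABS_eq_enat:
  "nABS D \<rho> \<mu> \<Lambda> \<epsilon> d = enat m \<Longrightarrow> avg_err2 D \<rho> \<mu> \<Lambda> m d \<le> ennreal (\<epsilon>\<^sup>2)"
  unfolding nABS_def by (auto split: if_splits intro: LeastI)

lemma nABS_le:
  "avg_err2 D \<rho> \<mu> \<Lambda> n d \<le> ennreal (\<epsilon>\<^sup>2) \<Longrightarrow> \<exists>m\<le>n. nABS D \<rho> \<mu> \<Lambda> \<epsilon> d = enat m"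
  unfolding nABS_def by (auto intro: Least_le)

lemma qpt_bound_all_of_std:
  assumes "avg_app_setting D \<rho> F N \<mu>" "qpt_bound D \<rho> \<mu> (Lstd D) C t"
  shows "qpt_bound D \<rho> \<mu> (Lall F N) C t"
  unfolding qpt_bound_def
proof (intro allI impI)
  fix d :: nat and \<epsilon> :: real assume d: "1 \<le> d" and \<epsilon>: "0 < \<epsilon> \<and> \<epsilon> < 1"
  interpret avg_app D \<rho> F N \<mu> d using assms(1) d by unfold_locales
  obtain m where m: "nABS D \<rho> \<mu> (Lstd D) \<epsilon> d = enat m"
    "real m \<le> C * exp (t * (1 + ln (real d)) * (1 + ln (1 / \<epsilon>)))"
    using assms(2) d \<epsilon> unfolding qpt_bound_def by blast
  obtain m' where "m' \<le> m" "nABS D \<rho> \<mu> (Lall F N) \<epsilon> d = enat m'"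
    using nABS_le[OF order_trans[OF avg_err2_all_le_std nABS_eq_enat[OF m(1)]]] by blast
  then show "\<exists>m. nABS D \<rho> \<mu> (Lall F N) \<epsilon> d = enat m \<and> real m \<le> C * exp (t * (1 + ln (real d)) * (1 + ln (1 / \<epsilon>)))"
    using m(2) by (intro exI[of _ m']) auto
qed

text \<open>The power \<open>1 + \<kappa>\<close> of the count multiplies the exponent by
  \<open>1 + \<kappa>\<close> and turns the constant into \<open>C'\<close>. The smaller accuracy
  \<open>e\<close> multiplies \<open>1 + ln (1 / \<epsilon>)\<close> by at most
  \<open>1 + 2 * \<kappa>\<close>. The product of both factors tends to 1 with \<kappa>, so the loss
  stays below \<delta>.\<close>

lemma qpt_bound_std_of_all:
  assumes S: "avg_app_setting D \<rho> F N \<mu>" and Q: "qpt_bound D \<rho> \<mu> (Lall F N) C t"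
    and C: "C > 0" and t: "t \<ge> 0" and \<delta>: "\<delta> > 0"
  shows "\<exists>C'>0. qpt_bound D \<rho> \<mu> (Lstd D) C' (t + \<delta>)"
proof -
  \<comment> \<open>The 5 comes from
    \<open>(1 + \<kappa>) * (1 + 2 * \<kappa>) \<le> 1 + 5 * \<kappa>\<close>, valid for \<kappa> at
    most 1; \<open>t + 1\<close> keeps the denominator positive when \<open>t\<close> is 0.\<close>
  define \<kappa> where "\<kappa> = min 1 (\<delta> / (5 * (t + 1)))"
  have \<kappa>: "0 < \<kappa>" "\<kappa> \<le> 1" using \<delta> t by (auto simp: \<kappa>_def)
  have "\<kappa> \<le> \<delta> / (5 * (t + 1))" by (simp add: \<kappa>_def)
  then have "\<kappa> * (5 * (t + 1)) \<le> \<delta>" using t by (simp add: pos_le_divide_eq)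
  then have \<kappa>t: "t * (5 * \<kappa>) \<le> \<delta>" using \<kappa> by (simp add: algebra_simps)
  have "(1 + \<kappa>) * (1 + 2 * \<kappa>) \<le> 1 + 5 * \<kappa>"
    using \<kappa> mult_left_mono[of \<kappa> 1 \<kappa>] by (simp add: algebra_simps)
  then have "t * ((1 + \<kappa>) * (1 + 2 * \<kappa>)) \<le> t * (1 + 5 * \<kappa>)" using t by (rule mult_left_mono)
  also have "\<dots> = t + t * (5 * \<kappa>)" by (simp add: distrib_left)
  finally have expo: "t * ((1 + \<kappa>) * (1 + 2 * \<kappa>)) \<le> t + \<delta>" using \<kappa>t by linarith
  define C' where "C' = (2 + 3 / \<kappa>\<^sup>2) * C powr (1 + \<kappa>)"
  have C': "C' > 0" using C \<kappa> by (simp add: C'_def add_pos_pos)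
  have "qpt_bound D \<rho> \<mu> (Lstd D) C' (t + \<delta>)"
    unfolding qpt_bound_def
  proof (intro allI impI)
    fix d :: nat and \<epsilon> :: real assume d: "1 \<le> d" and \<epsilon>: "0 < \<epsilon> \<and> \<epsilon> < 1"
    interpret avg_app D \<rho> F N \<mu> d using S d by unfold_locales
    \<comment> \<open>The squared error grows by at most \<open>(1 + 2 * \<kappa>)\<^sup>2\<close>,
      so accuracy \<open>e\<close> for arbitrary functionals gives \<epsilon> for function
      values.\<close>
    define e where "e = \<epsilon> / (1 + 2 * \<kappa>)"
    have e: "0 < e" "e < 1" using \<epsilon> \<kappa> by (auto simp: e_def field_simps)
    obtain n where n: "nABS D \<rho> \<mu> (Lall F N) e d = enat n"
      "real n \<le> C * exp (t * (1 + ln (real d)) * (1 + ln (1 / e)))"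
      using Q d e unfolding qpt_bound_def by blast
    obtain n' where n': "avg_err2 D \<rho> \<mu> (Lstd D) n' d \<le> ennreal ((1 + 2 * \<kappa>) * ((1 + \<kappa>) * e\<^sup>2))"
      "real n' \<le> (2 + 3 / \<kappa>\<^sup>2) * real n powr (1 + \<kappa>)"
      using avg_err2_std_le_all[OF nABS_eq_enat[OF n(1)] e(1) \<kappa>] by blast
    have "(1 + 2 * \<kappa>) * ((1 + \<kappa>) * e\<^sup>2) \<le> (1 + 2 * \<kappa>) * ((1 + 2 * \<kappa>) * e\<^sup>2)"
      using \<kappa> by (intro mult_left_mono mult_right_mono) auto
    also have "\<dots> = \<epsilon>\<^sup>2" using \<kappa> by (simp add: e_def power2_eq_square)
    finally have "avg_err2 D \<rho> \<mu> (Lstd D) n' d \<le> ennreal (\<epsilon>\<^sup>2)"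
      using n'(1) by (meson ennreal_leI order_trans)
    then obtain m where m: "m \<le> n'" "nABS D \<rho> \<mu> (Lstd D) \<epsilon> d = enat m"
      using nABS_le by blast
    define l where "l = 1 + ln (real d)"
    have l: "l \<ge> 0" using d by (simp add: l_def)
    have le: "ln (1 / \<epsilon>) \<ge> 0" using \<epsilon> by simp
    have "ln (1 / e) = ln (1 / \<epsilon>) + ln (1 + 2 * \<kappa>)"
      using \<epsilon> \<kappa> by (simp add: e_def ln_div)
    also have "\<dots> \<le> ln (1 / \<epsilon>) + 2 * \<kappa>"
      using \<kappa> ln_add_one_self_le_self[of "2 * \<kappa>"] by simp
    \<comment> \<open>The summand 1 beside \<open>ln (1 / \<epsilon>)\<close> absorbs the additive
      loss even for \<epsilon> close to 1.\<close>
    also have "\<dots> \<le> ln (1 / \<epsilon>) + 2 * \<kappa> * (1 + ln (1 / \<epsilon>))"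
      using \<kappa> le by (simp add: distrib_left)
    finally have ln_e: "1 + ln (1 / e) \<le> (1 + 2 * \<kappa>) * (1 + ln (1 / \<epsilon>))"
      by (simp add: algebra_simps)
    have "real m \<le> (2 + 3 / \<kappa>\<^sup>2) * real n powr (1 + \<kappa>)" using m(1) n'(2) by linarith
    also have "\<dots> \<le> (2 + 3 / \<kappa>\<^sup>2) * (C * exp (t * l * (1 + ln (1 / e)))) powr (1 + \<kappa>)"
      using n(2) \<kappa> by (intro mult_left_mono powr_mono2) (auto simp: l_def)
    also have "\<dots> = C' * exp ((1 + \<kappa>) * (t * l) * (1 + ln (1 / e)))"
      using C by (simp add: C'_def powr_mult powr_def[of "exp _"] ac_simps)
    also have "\<dots> \<le> C' * exp ((1 + \<kappa>) * (t * l) * ((1 + 2 * \<kappa>) * (1 + ln (1 / \<epsilon>))))"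
      using C' ln_e \<kappa> t l by (intro mult_left_mono) (auto intro!: mult_left_mono)
    also have "(1 + \<kappa>) * (t * l) * ((1 + 2 * \<kappa>) * (1 + ln (1 / \<epsilon>)))
        = t * ((1 + \<kappa>) * (1 + 2 * \<kappa>)) * (l * (1 + ln (1 / \<epsilon>)))" by (simp add: ac_simps)
    also have "C' * exp \<dots> \<le> C' * exp ((t + \<delta>) * (l * (1 + ln (1 / \<epsilon>))))"
      using C' expo l le by (intro mult_left_mono) (auto intro!: mult_right_mono)
    finally show "\<exists>m. nABS D \<rho> \<mu> (Lstd D) \<epsilon> d = enat m \<and>
        real m \<le> C' * exp ((t + \<delta>) * (1 + ln (real d)) * (1 + ln (1 / \<epsilon>)))"
      using m(2) by (intro exI[of _ m]) (simp add: l_def mult.assoc)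
  qed
  then show ?thesis using C' by blast
qed

theorem theorem4p2:
  fixes D :: "nat \<Rightarrow> pt set" and \<rho> :: "nat \<Rightarrow> pt \<Rightarrow> real"
    and F :: "nat \<Rightarrow> fn set" and N :: "nat \<Rightarrow> fn \<Rightarrow> real" and \<mu> :: "nat \<Rightarrow> fn measure"
  assumes "avg_app_setting D \<rho> F N \<mu>"
  shows "(alg_qpt D \<rho> \<mu> (Lall F N) \<longleftrightarrow> alg_qpt D \<rho> \<mu> (Lstd D)) \<and>
         (alg_qpt D \<rho> \<mu> (Lall F N) \<longrightarrow> alg_t_abs D \<rho> \<mu> (Lall F N) = alg_t_abs D \<rho> \<mu> (Lstd D))"
proof -
  define S where "S = (\<lambda>\<Lambda>. {t. t \<ge> 0 \<and> (\<exists>C>0. qpt_bound D \<rho> \<mu> \<Lambda> C t)})"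
  have qpt: "alg_qpt D \<rho> \<mu> \<Lambda> \<longleftrightarrow> S \<Lambda> \<noteq> {}" for \<Lambda>
    by (auto simp: alg_qpt_def S_def)
  have sub: "S (Lstd D) \<subseteq> S (Lall F N)"
    using qpt_bound_all_of_std[OF assms] by (auto simp: S_def)
  have add: "t + \<delta> \<in> S (Lstd D)" if "t \<in> S (Lall F N)" "\<delta> > 0" for t \<delta>
    using that qpt_bound_std_of_all[OF assms, of _ t \<delta>] by (auto simp: S_def)
  have iff: "S (Lall F N) \<noteq> {} \<longleftrightarrow> S (Lstd D) \<noteq> {}"
    using sub add[of _ 1] by (auto simp del: ex_in_conv)
  have bdd: "bdd_below (S \<Lambda>)" for \<Lambda>
    by (rule bdd_belowI[of _ 0]) (simp add: S_def)
  have "Inf (S (Lall F N)) = Inf (S (Lstd D))" if ne: "S (Lall F N) \<noteq> {}"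
  proof (rule antisym)
    show "Inf (S (Lall F N)) \<le> Inf (S (Lstd D))"
      using ne iff sub bdd by (intro cInf_superset_mono) auto
    show "Inf (S (Lstd D)) \<le> Inf (S (Lall F N))"
    proof (rule cInf_greatest[OF ne])
      fix t assume t: "t \<in> S (Lall F N)"
      show "Inf (S (Lstd D)) \<le> t"
        by (rule field_le_epsilon) (rule cInf_lower[OF add[OF t] bdd])
    qed
  qed
  then show ?thesis
    using iff unfolding qpt by (simp add: alg_t_abs_def S_def)
qed

end
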